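(* Let $\Gamma$ be a simple gain graph on vertex set $[\ell]$ whose gain group $G_\Gamma$ is either $\mathbb{Z}$ or $\mathbb{F}_p$ ($p$ prime). Then $\mathbf{c}\mathcal{A}(\Gamma)$ is inductively free along edges if and only if $\mathcal{B}(\Gamma)$ is inductively free along edges.
   Context: A simple gain graph $\Gamma=(V_\Gamma,E_\Gamma,G_\Gamma)$ consists of a finite vertex set $V_\Gamma$, a group $G_\Gamma$ (written additively), and a finite set $E_\Gamma$ of edges, each edge being an equivalence class $[i,j,g]$ of triples $(i,j,g)\in V_\Gamma\times V_\Gamma\times G_\Gamma$ with $i\neq j$ under the equivalence generated by $(i,j,g)\sim(j,i,-g)$. For $V_\Gamma=[\ell]=\{1,\dots,\ell\}$ and $G_\Gamma\in\{\mathbb{Z},\mathbb{F}_p\}$: the affinographic arrangement is $\mathcal{A}(\Gamma)=\{\{x_i-x_j=g\} : [i,j,g]\in E_\Gamma\}$ in $\mathbb{Q}^\ell$ (if $G_\Gamma=\mathbb{Z}$) or in $\mathbb{F}_p^\ell$ (if $G_\Gamma=\mathbb{F}_p$); its cone $\mathbf{c}\mathcal{A}(\Gamma)$ is the central arrangement in $\mathbb{K}^{\ell+1}$ (coordinates $x_1,\dots,x_\ell,z$) consisting of $\{z=0\}$ and the hyperplanes $\{x_i-x_j=gz\}$ for $[i,j,g]\in E_\Gamma$. Fix $q\in\mathbb{C}^\times$ which is not a root of unity if $G_\Gamma=\mathbb{Z}$, or a primitive $p$-th root of unity if $G_\Gamma=\mathbb{F}_p$; the bias arrangement is the central arrangement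 $\mathcal{B}(\Gamma)=\{\{x_i=0\}:1\le i\le \ell\}\cup\{\{x_i-q^g x_j=0\}:[i,j,g]\in E_\Gamma\}$ in $\mathbb{C}^\ell$. For a central arrangement $\mathcal{A}$ in $\mathbb{K}^n$ with $S=\mathbb{K}[x_1,\dots,x_n]$, $D(\mathcal{A})=\{\theta\in\mathrm{Der}(S):\theta(\alpha_H)\in\alpha_H S\ \forall H\in\mathcal{A}\}$ ($\alpha_H$ a defining linear form); $\mathcal{A}$ is free with exponents $(d_1,\dots,d_n)$ (a multiset) if $D(\mathcal{A})\cong\bigoplus_i S(-d_i)$ as graded $S$-modules. Deletion: $\Gamma\setminus e$ has edge set $E_\Gamma\setminus\{e\}$. Contraction: for an edge $e$ with chosen direction $(i,j,g)$, $\Gamma/e$ has vertex set $V_\Gamma\setminus\{i\}$, same gain group, and edges all $[u,v,h]\in E_\Gamma$ with $u,v\neq i$ together with $[k,j,h+g]$ for each $[k,i,h]\in E_\Gamma$, $k\ne i$; the arrangements $\mathcal{A}(\Gamma/e)$, $\mathcal{B}(\Gamma/e)$ do not depend on the chosen direction up to affine equivalence. $\mathbf{c}\mathcal{A}(\Gamma)$ is inductively free along edges if either $E_\Gamma=\varnothing$, or there is an edge $e\in E_\Gamma$ such that $\mathbf{c}\mathcal{A}(\Gamma\setminus e)$ and $\mathbf{c}\mathcal{A}(\Gamma/e)$ are inductively free along edges and $\exp(\mathbf{c}\mathcal{A}(\Gamma/e))\subseteq\exp(\mathbf{c}\mathcal{A}(\Gamma\setminus e))$ (as multisets). Inductive freeness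 along edges for $\mathcal{B}(\Gamma)$ is defined identically with $\mathcal{B}$ in place of $\mathbf{c}\mathcal{A}$. *)

theory Defs
  imports
    Complex_Main
    "HOL-Library.FuncSet"
    "HOL-Library.Multiset"
    "HOL-Library.Poly_Mapping"
    "Berlekamp_Zassenhaus.Finite_Field"
begin

section \<open>Simple gain graphs\<close>

text \<open>The edge \<open>[i,j,g]\<close> is the equivalence class of the triple \<open>(i,j,g)\<close>; lemma
  \<open>gain_edge_eq_class\<close> below shows that the class is the two-element set used here.\<close>

definition gain_edge :: "'v \<Rightarrow> 'v \<Rightarrow> 'g::group_add \<Rightarrow> ('v \<times> 'v \<times> 'g) set" where
  "gain_edge i j g = {(i, j, g), (j, i, - g)}"

lemma gain_edge_eq_class:
  "gain_edge i j (g::'g::group_add) =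
     {((u, v, h), (v, u, - h)) | (u::'v) v (h::'g). True}\<^sup>* `` {(i, j, g)}"
  (is "_ = ?R\<^sup>* `` _")
proof -
  have "y \<in> gain_edge i j g" if "((i, j, g), y) \<in> ?R\<^sup>*" for y
    using that by (induction rule: rtrancl_induct) (auto simp: gain_edge_def)
  moreover have "((i, j, g), (j, i, - g)) \<in> ?R\<^sup>*"
    by (rule r_into_rtrancl) blast
  ultimately show ?thesis
    by (auto simp: gain_edge_def)
qed

record ('v, 'g) gain_graph =
  gverts :: "'v set"
  gedges :: "('v \<times> 'v \<times> 'g) set set"

definition simple_gain_graph :: "('v, 'g::group_add) gain_graph \<Rightarrow> bool" where
  "simple_gain_graph \<Gamma> \<longleftrightarrow>
     finite (gverts \<Gamma>) \<and> finite (gedges \<Gamma>) \<and>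
     gedges \<Gamma> \<subseteq> {gain_edge i j g | i j g. i \<in> gverts \<Gamma> \<and> j \<in> gverts \<Gamma> \<and> i \<noteq> j}"

definition delete_edge ::
    "('v, 'g) gain_graph \<Rightarrow> ('v \<times> 'v \<times> 'g) set \<Rightarrow> ('v, 'g) gain_graph" where
  "delete_edge \<Gamma> e = \<lparr>gverts = gverts \<Gamma>, gedges = gedges \<Gamma> - {e}\<rparr>"

text \<open>Contraction of the edge \<open>[i,j,g]\<close> in the direction \<open>(i,j,g)\<close>.  An edge \<open>[j,i,h]\<close> parallel to
  the contracted one (or that edge itself) would become a loop \<open>[j,j,h + g]\<close>, which is not an edge
  of a simple gain graph; such loops are dropped.\<close>

definition contract_edge ::
    "('v, 'g::group_add) gain_graph \<Rightarrow> 'v \<Rightarrow> 'v \<Rightarrow> 'g \<Rightarrow> ('v, 'g) gain_graph" where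
  "contract_edge \<Gamma> i j g =
     \<lparr>gverts = gverts \<Gamma> - {i},
      gedges = {gain_edge u v h | u v h. gain_edge u v h \<in> gedges \<Gamma> \<and> u \<noteq> i \<and> v \<noteq> i} \<union>
               {gain_edge k j (h + g) | k h. gain_edge k i h \<in> gedges \<Gamma> \<and> k \<noteq> i \<and> k \<noteq> j}\<rparr>"

section \<open>The polynomial ring and its derivations\<close>

text \<open>Polynomials over \<open>'k\<close> in variables from a type \<open>'x\<close> are finitely supported functions from
  monomials to coefficients.  The ring \<open>\<bbbk>[x\<^sub>v | v \<in> X]\<close> is the subset \<open>polys X\<close>.\<close>

type_synonym ('x, 'k) mvpoly = "('x \<Rightarrow>\<^sub>0 nat) \<Rightarrow>\<^sub>0 'k"

definition polys :: "'x set \<Rightarrow> ('x, 'k::zero) mvpoly set" where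
  "polys X = {f. \<forall>m \<in> Poly_Mapping.keys f. Poly_Mapping.keys m \<subseteq> X}"

definition const_poly :: "'k::zero \<Rightarrow> ('x, 'k) mvpoly" where
  "const_poly c = Poly_Mapping.single 0 c"

definition var_poly :: "'x \<Rightarrow> ('x, 'k::zero_neq_one) mvpoly" where
  "var_poly v = Poly_Mapping.single (Poly_Mapping.single v 1) 1"

definition monomial_degree :: "('x \<Rightarrow>\<^sub>0 nat) \<Rightarrow> nat" where
  "monomial_degree m = (\<Sum>v \<in> Poly_Mapping.keys m. Poly_Mapping.lookup m v)"

text \<open>The component of degree \<open>m\<close> of the graded \<open>S\<close>-module \<open>S(-d)\<close>, i.e. the component of degree
  \<open>m - d\<close> of \<open>S\<close>, which is zero for \<open>m < d\<close>.\<close>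

definition shifted_component :: "'x set \<Rightarrow> nat \<Rightarrow> nat \<Rightarrow> ('x, 'k::zero) mvpoly set" where
  "shifted_component X d m =
     {f \<in> polys X. \<forall>t \<in> Poly_Mapping.keys f. monomial_degree t + d = m}"

text \<open>Derivations are extensional functions, i.e. \<open>undefined\<close> outside \<open>polys X\<close>, so that two of them
  are equal iff they agree on \<open>polys X\<close>.\<close>

definition derivations :: "'x set \<Rightarrow> (('x, 'k::comm_ring_1) mvpoly \<Rightarrow> ('x, 'k) mvpoly) set" where
  "derivations X =
     {\<theta> \<in> polys X \<rightarrow>\<^sub>E polys X.
        (\<forall>f \<in> polys X. \<forall>g \<in> polys X. \<theta> (f + g) = \<theta> f + \<theta> g) \<and>
        (\<forall>c. \<forall>f \<in> polys X. \<theta> (const_poly c * f) = const_poly c * \<theta> f) \<and>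
        (\<forall>f \<in> polys X. \<forall>g \<in> polys X. \<theta> (f * g) = f * \<theta> g + g * \<theta> f)}"

section \<open>Central arrangements and freeness\<close>

text \<open>An arrangement in \<open>\<bbbk>\<^sup>X\<close> for a finite coordinate set \<open>X\<close> is a pair of \<open>X\<close> and a set of
  hyperplanes, each hyperplane being a set of points.\<close>

type_synonym ('x, 'k) arrangement = "'x set \<times> ('x \<Rightarrow> 'k) set set"

definition points :: "'x set \<Rightarrow> ('x \<Rightarrow> 'k) set" where
  "points X = X \<rightarrow>\<^sub>E UNIV"

definition linear_form :: "'x set \<Rightarrow> ('x \<Rightarrow> 'k) \<Rightarrow> ('x, 'k::comm_ring_1) mvpoly" where
  "linear_form X a = (\<Sum>v\<in>X. const_poly (a v) * var_poly v)"

definition defines_hyperplane :: "'x set \<Rightarrow> ('x \<Rightarrow> 'k::comm_ring_1) \<Rightarrow> ('x \<Rightarrow> 'k) set \<Rightarrow> bool" where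
  "defines_hyperplane X a H \<longleftrightarrow> H = {x \<in> points X. (\<Sum>v\<in>X. a v * x v) = 0}"

text \<open>A defining form of a hyperplane is unique up to a nonzero scalar, so the quantification over
  all coefficient vectors \<open>a\<close> of defining forms does not depend on a choice.\<close>

definition log_derivations ::
    "('x, 'k::comm_ring_1) arrangement \<Rightarrow> (('x, 'k) mvpoly \<Rightarrow> ('x, 'k) mvpoly) set" where
  "log_derivations A =
     {\<theta> \<in> derivations (fst A). \<forall>H \<in> snd A. \<forall>a. defines_hyperplane (fst A) a H \<longrightarrow>
        (\<exists>s \<in> polys (fst A). \<theta> (linear_form (fst A) a) = linear_form (fst A) a * s)}"

text \<open>The grading is by polynomial degree: \<open>\<theta> = \<Sum>\<^sub>v f\<^sub>v \<partial>/\<partial>x\<^sub>v\<close> has degree \<open>m\<close> if all \<open>f\<^sub>v = \<theta> x\<^sub>v\<close> are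
  homogeneous of degree \<open>m\<close>.\<close>

definition log_derivations_component ::
    "('x, 'k::comm_ring_1) arrangement \<Rightarrow> nat \<Rightarrow> (('x, 'k) mvpoly \<Rightarrow> ('x, 'k) mvpoly) set" where
  "log_derivations_component A m =
     {\<theta> \<in> log_derivations A. \<forall>v \<in> fst A. \<theta> (var_poly v) \<in> shifted_component (fst A) 0 m}"

definition direct_sum :: "'x set \<Rightarrow> nat list \<Rightarrow> (nat \<Rightarrow> ('x, 'k::zero) mvpoly) set" where
  "direct_sum X ds = {..<length ds} \<rightarrow>\<^sub>E polys X"

definition direct_sum_component ::
    "'x set \<Rightarrow> nat list \<Rightarrow> nat \<Rightarrow> (nat \<Rightarrow> ('x, 'k::zero) mvpoly) set" where
  "direct_sum_component X ds m = (\<Pi>\<^sub>E i\<in>{..<length ds}. shifted_component X (ds ! i) m)"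

text \<open>\<open>\<phi>\<close> is an isomorphism of graded modules from \<open>S(-d\<^sub>1) \<oplus> \<dots> \<oplus> S(-d\<^sub>n)\<close> to \<open>D(A)\<close>.  Additivity and
  \<open>S\<close>-linearity are expressed pointwise since the elements of both modules are functions.\<close>

definition graded_iso_log_derivations ::
    "('x, 'k::comm_ring_1) arrangement \<Rightarrow> nat list \<Rightarrow>
     ((nat \<Rightarrow> ('x, 'k) mvpoly) \<Rightarrow> (('x, 'k) mvpoly \<Rightarrow> ('x, 'k) mvpoly)) \<Rightarrow> bool" where
  "graded_iso_log_derivations A ds \<phi> \<longleftrightarrow>
     (let X = fst A; I = {..<length ds} in
        bij_betw \<phi> (direct_sum X ds) (log_derivations A) \<and>
        (\<forall>F \<in> direct_sum X ds. \<forall>G \<in> direct_sum X ds. \<forall>f \<in> polys X.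
           \<phi> (\<lambda>i\<in>I. F i + G i) f = \<phi> F f + \<phi> G f) \<and>
        (\<forall>s \<in> polys X. \<forall>F \<in> direct_sum X ds. \<forall>f \<in> polys X.
           \<phi> (\<lambda>i\<in>I. s * F i) f = s * \<phi> F f) \<and>
        (\<forall>m. \<phi> ` direct_sum_component X ds m \<subseteq> log_derivations_component A m))"

definition free_with_exponents :: "('x, 'k::comm_ring_1) arrangement \<Rightarrow> nat multiset \<Rightarrow> bool" where
  "free_with_exponents A M \<longleftrightarrow>
     (\<exists>ds \<phi>. mset ds = M \<and> length ds = card (fst A) \<and> graded_iso_log_derivations A ds \<phi>)"

section \<open>The arrangements of a gain graph\<close>

text \<open>The cone of the affinographic arrangement in \<open>\<bbbk>\<^bsup>V + 1\<^esup>\<close>: the coordinate \<open>x\<^sub>v\<close> is \<open>Some v\<close> and the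
  homogenizing coordinate \<open>z\<close> is \<open>None\<close>.  The map \<open>\<iota>\<close> embeds the gain group into the field: the
  inclusion of the integers into the rationals, or the identity of the prime field.\<close>

definition cone_affinographic ::
    "('g \<Rightarrow> 'k::field) \<Rightarrow> ('v, 'g::group_add) gain_graph \<Rightarrow> ('v option, 'k) arrangement" where
  "cone_affinographic \<iota> \<Gamma> =
     (let X = insert None (Some ` gverts \<Gamma>) in
        (X, insert {x \<in> points X. x None = 0}
              {{x \<in> points X. x (Some i) - x (Some j) = \<iota> g * x None} | i j g.
                 gain_edge i j g \<in> gedges \<Gamma>}))"

text \<open>The bias arrangement, where \<open>\<chi> g\<close> stands for \<open>q\<^sup>g\<close>.\<close>

definition bias_arrangement ::
    "('g \<Rightarrow> complex) \<Rightarrow> ('v, 'g::group_add) gain_graph \<Rightarrow> ('v, complex) arrangement" where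
  "bias_arrangement \<chi> \<Gamma> =
     (gverts \<Gamma>,
      {{x \<in> points (gverts \<Gamma>). x i = 0} | i. i \<in> gverts \<Gamma>} \<union>
      {{x \<in> points (gverts \<Gamma>). x i - \<chi> g * x j = 0} | i j g. gain_edge i j g \<in> gedges \<Gamma>})"

text \<open>Inductive freeness along edges of the arrangement \<open>A \<Gamma>\<close>, for a construction \<open>A\<close> of arrangements
  from gain graphs.  The multisets \<open>M\<close> and \<open>N\<close> are the exponents of \<open>A(\<Gamma>/e)\<close> and \<open>A(\<Gamma>\<setminus>e)\<close>, which are
  uniquely determined whenever these arrangements are free.\<close>

inductive ind_free_along_edges ::
    "(('v, 'g::group_add) gain_graph \<Rightarrow> ('x, 'k::field) arrangement) \<Rightarrow>
     ('v, 'g) gain_graph \<Rightarrow> bool" for A where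
  no_edges: "gedges \<Gamma> = {} \<Longrightarrow> ind_free_along_edges A \<Gamma>"
| edge: "\<lbrakk>gain_edge i j g \<in> gedges \<Gamma>;
          ind_free_along_edges A (delete_edge \<Gamma> (gain_edge i j g));
          ind_free_along_edges A (contract_edge \<Gamma> i j g);
          free_with_exponents (A (contract_edge \<Gamma> i j g)) M;
          free_with_exponents (A (delete_edge \<Gamma> (gain_edge i j g))) N;
          M \<subseteq># N\<rbrakk> \<Longrightarrow> ind_free_along_edges A \<Gamma>"

end

(*
Both arrangements are controlled by the same combinatorial data.  By Terao's addition theorem, if the
deletion is free with exponents {e_1, ..., e_(n-1), b} and the contraction is free with exponents
{e_1, ..., e_(n-1)}, then the whole arrangement is free with exponents {e_1, ..., e_(n-1), b + 1}.
Since exponents are unique, a derivation of inductive freeness along edges therefore determines a multiset M,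
computed from the gain graph alone, such that the exponents of the cone are M together with 1 and those of the bias
arrangement are the elements of M increased by 1.  The inclusion of exponents is thus the same condition for both.

In the addition theorem, the polynomial B with theta(alpha) in (alpha, B) for all theta in D(A') has degree
|A'| - |A''|.  Here this degree equals b because the sum of M is the number of edges, so that no determinants
(Saito's criterion) are needed.  If some basis element of degree b has a nonzero value at alpha modulo alpha, that
value is a constant multiple of B and an exchange gives a basis of D(A); otherwise too many basis elements of
degree at most b would restrict to independent elements of D(A'').
*)

theory Submission
  imports Defs "HOL-Library.Option_ord"
begin

section \<open>Polynomials\<close>

text \<open>Both arrangements consist of base hyperplanes, fixed by the vertex set, and one
  hyperplane per edge. Restricting to the hyperplane of e = [i,j,g] substitutes for the coordinate
  of i: an edge [k,i,h] moves to j with gain h + g, while an edge [j,i,h] parallel to e turns into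
  (h + g) z = 0, respectively (1 - q^(h+g)) x_j = 0. As the gains embed injectively, this is a base
  hyperplane, so the loops dropped by contraction are no loss and the restriction is the arrangement
  of the contraction. The hyperplane count then drops by the base hyperplanes lost with a vertex
  plus b edges.

  The combinatorial exponents form a relation: different choices of edges might a priori give
  different multisets. Uniqueness of exponents ties the multisets in the definition of inductive
  freeness to those supplied by the induction hypotheses.

  The algebra is done with coefficient vectors of derivations. Reduction modulo a linear form
  \<alpha> is a substitution eliminating one variable. Its values lie again in a polynomial ring,
  which yields both the primality of \<alpha> and the restriction of derivations.\<close>

abbreviation lookup where "lookup \<equiv> Poly_Mapping.lookup"
abbreviation keys where "keys \<equiv> Poly_Mapping.keys"
abbreviation single where "single \<equiv> Poly_Mapping.single"

lemma monomial_degree_add: "monomial_degree (m + n) = monomial_degree m + monomial_degree n"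
proof -
  have s: "monomial_degree k = (\<Sum>v \<in> keys m \<union> keys n. lookup k v)"
    if "keys k \<subseteq> keys m \<union> keys n" for k
    unfolding monomial_degree_def using that
    by (intro sum.mono_neutral_left) (auto simp: in_keys_iff)
  show ?thesis
    using s[of m] s[of n] s[of "m + n"] keys_add[of m n]
    by (simp add: lookup_add sum.distrib)
qed

lemma monomial_degree_0 [simp]: "monomial_degree 0 = 0"
  by (simp add: monomial_degree_def)

lemma monomial_degree_single [simp]: "monomial_degree (single v n) = n"
  by (simp add: monomial_degree_def)

lemma monomial_degree_eq_0_iff: "monomial_degree m = 0 \<longleftrightarrow> m = 0"
  by (auto simp: monomial_degree_def in_keys_iff intro: poly_mapping_eqI)

lemma monomial_induct [case_names zero add_single]:
  assumes "P 0" and "\<And>m v. P m \<Longrightarrow> P (m + single v (1::nat))"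
  shows "P m"
proof (induction "monomial_degree m" arbitrary: m)
  case 0
  then show ?case using assms(1) by (metis monomial_degree_eq_0_iff)
next
  case (Suc n)
  then have "m \<noteq> 0" by auto
  then obtain v where v: "lookup m v \<noteq> 0" by (metis lookup_zero poly_mapping_eqI)
  define m' where "m' = m - single v 1"
  have m: "m = m' + single v 1"
    using v by (intro poly_mapping_eqI)
      (auto simp: m'_def lookup_add lookup_minus lookup_single when_def)
  then have "monomial_degree m' = n" using Suc(2) by (simp add: monomial_degree_add)
  then show ?case using Suc(1) assms(2) m by metis
qed

lemma poly_mapping_induct [case_names single add]:
  assumes "\<And>m c. P (single m c)" and "\<And>f g. P f \<Longrightarrow> P g \<Longrightarrow> P (f + g)"
  shows "P (f :: 'a \<Rightarrow>\<^sub>0 'b::comm_monoid_add)"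
proof (induction f rule: update_induct)
  case const
  then show ?case using assms(1)[of undefined 0] by simp
next
  case (update f a b)
  have "Poly_Mapping.update a b f = f + single a b"
    using update(1) by (intro poly_mapping_eqI)
      (auto simp: lookup_add lookup_update lookup_single when_def in_keys_iff)
  then show ?case using assms update by simp
qed

section \<open>The ring of polynomials in the variables X, as a subset of one polynomial
  type\<close>

lemma polysI: "(\<And>m. m \<in> keys f \<Longrightarrow> keys m \<subseteq> X) \<Longrightarrow> f \<in> polys X"
  by (auto simp: polys_def)

lemma polys_add [intro]: "f \<in> polys X \<Longrightarrow> g \<in> polys X \<Longrightarrow> f + g \<in> polys X"
  using keys_add[of f g] by (auto simp: polys_def)

lemma polys_0 [simp, intro]: "0 \<in> polys X"
  by (auto simp: polys_def)

lemma keys_const_poly: "keys (const_poly c) \<subseteq> {0}"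
  by (auto simp: const_poly_def)

lemma polys_const [simp, intro]: "const_poly c \<in> polys X"
  by (auto simp: polys_def const_poly_def split: if_splits)

lemma const_poly_0 [simp]: "const_poly 0 = 0"
  by (simp add: const_poly_def)

lemma const_poly_1 [simp]: "const_poly 1 = 1"
  by (simp add: const_poly_def)

lemma const_poly_add: "const_poly (a + b) = const_poly a + const_poly b"
  by (simp add: const_poly_def single_add)

lemma const_poly_mult: "const_poly (a * b) = const_poly a * (const_poly b :: ('x, 'k::comm_semiring_1) mvpoly)"
  by (simp add: const_poly_def mult_single)

lemma const_poly_uminus: "const_poly (- a) = - const_poly (a :: 'k::comm_ring_1)"
  by (simp add: const_poly_def single_uminus)

lemma const_poly_inverse_mult [simp]:
  "c \<noteq> 0 \<Longrightarrow> const_poly (inverse c) * const_poly c = (1 :: ('x, 'k::field) mvpoly)"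
  by (simp flip: const_poly_mult)

lemma const_poly_eq_0_iff [simp]: "const_poly c = 0 \<longleftrightarrow> c = 0"
  by (metis const_poly_0 const_poly_def lookup_single_eq)

lemma polys_1 [simp, intro]: "(1 :: ('x, 'k::comm_ring_1) mvpoly) \<in> polys X"
  by (metis const_poly_1 polys_const)

lemma polys_var [simp, intro]: "v \<in> X \<Longrightarrow> (var_poly v :: ('x, 'k::zero_neq_one) mvpoly) \<in> polys X"
  by (auto simp: polys_def var_poly_def)

lemma polys_mult [intro]:
  assumes "f \<in> polys X" "g \<in> polys X" shows "f * (g :: ('x, 'k::comm_ring_1) mvpoly) \<in> polys X"
proof (rule polysI)
  fix m assume "m \<in> keys (f * g)"
  then obtain a b where "m = a + b" "a \<in> keys f" "b \<in> keys g"
    using keys_mult by blast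
  then show "keys m \<subseteq> X" using assms keys_add[of a b] by (fastforce simp: polys_def)
qed

lemma polys_uminus [intro]: "f \<in> polys X \<Longrightarrow> - (f :: ('x, 'k::comm_ring_1) mvpoly) \<in> polys X"
  by (auto simp: polys_def in_keys_iff)

lemma polys_diff [intro]:
  "f \<in> polys X \<Longrightarrow> g \<in> polys X \<Longrightarrow> f - (g :: ('x, 'k::comm_ring_1) mvpoly) \<in> polys X"
  using polys_add[of f X "- g"] by auto

lemma polys_sum [intro]: "(\<And>a. a \<in> A \<Longrightarrow> f a \<in> polys X) \<Longrightarrow> sum f A \<in> polys X"
  by (induction A rule: infinite_finite_induct) auto

lemma polys_prod [intro]:
  "(\<And>a. a \<in> A \<Longrightarrow> (f a :: ('x, 'k::comm_ring_1) mvpoly) \<in> polys X) \<Longrightarrow> prod f A \<in> polys X"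
  by (induction A rule: infinite_finite_induct) auto

lemma polys_power [intro]:
  "(f :: ('x, 'k::comm_ring_1) mvpoly) \<in> polys X \<Longrightarrow> f ^ n \<in> polys X"
  by (induction n) auto

lemma polys_mono: "X \<subseteq> Y \<Longrightarrow> polys X \<subseteq> polys Y"
  by (auto simp: polys_def)

lemma polys_UNIV [simp]: "polys UNIV = UNIV"
  by (auto simp: polys_def)

text \<open>Presents \<open>polys X\<close> as the algebra generated by the constants and the
  variables in X, so that ring maps and derivations can be compared on generators.\<close>

lemma polys_induct [consumes 1, case_names const var add mult]:
  assumes f: "(f :: ('x, 'k::comm_ring_1) mvpoly) \<in> polys X"
    and "\<And>c. P (const_poly c)" and "\<And>v. v \<in> X \<Longrightarrow> P (var_poly v)"
    and add: "\<And>f g. f \<in> polys X \<Longrightarrow> g \<in> polys X \<Longrightarrow> P f \<Longrightarrow> P g \<Longrightarrow> P (f + g)"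
    and "\<And>f g. f \<in> polys X \<Longrightarrow> g \<in> polys X \<Longrightarrow> P f \<Longrightarrow> P g \<Longrightarrow> P (f * g)"
  shows "P f"
proof -
  \<comment> \<open>Membership is carried along because the sum and product cases of the rule
    require it.\<close>
  have mono: "P (single m c) \<and> single m c \<in> polys X" if "keys m \<subseteq> X" for m c
    using that
  proof (induction m rule: monomial_induct)
    case zero
    then show ?case using assms(2) by (simp flip: const_poly_def)
  next
    case (add_single m v)
    have keys: "keys (m + single v 1) = insert v (keys m)"
      by (auto simp: in_keys_iff lookup_add lookup_single when_def split: if_splits)
    have "single (m + single v 1) c = single m c * var_poly v"
      by (simp add: var_poly_def mult_single)
    moreover have "P (single m c)" "single m c \<in> polys X" "v \<in> X"
      using add_single keys by auto
    ultimately show ?case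
      using assms(3)[of v] assms(5)[of "single m c" "var_poly v"] polys_mult[of "single m c" X "var_poly v"]
      by simp
  qed
  have "P (sum (\<lambda>m. single m (lookup f m)) A) \<and> sum (\<lambda>m. single m (lookup f m)) A \<in> polys X"
    if "A \<subseteq> keys f" for A
    using finite_subset[OF that finite_keys] that
  proof (induction A rule: finite_induct)
    case empty
    then show ?case using assms(2)[of 0] by simp
  next
    case (insert m A)
    then have "keys m \<subseteq> X" using f by (auto simp: polys_def)
    then show ?case
      using insert mono[of m "lookup f m"] add[of "single m (lookup f m)"]
      by (simp add: polys_add)
  qed
  moreover have "f = sum (\<lambda>m. single m (lookup f m)) (keys f)"
    by (intro poly_mapping_eqI) (auto simp: lookup_sum lookup_single when_def in_keys_iff)
  ultimately show ?thesis by (metis order_refl)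
qed

text \<open>Common source of three maps determined by their values on monomials: substitutions,
  homogeneous components and derivations.\<close>

definition lin_ext ::
    "(('x \<Rightarrow>\<^sub>0 nat) \<Rightarrow> ('y, 'k::comm_ring_1) mvpoly) \<Rightarrow> ('x, 'k) mvpoly \<Rightarrow> ('y, 'k) mvpoly" where
  "lin_ext \<phi> f = (\<Sum>m \<in> keys f. const_poly (lookup f m) * \<phi> m)"

lemma lin_ext_superset:
  "finite A \<Longrightarrow> keys f \<subseteq> A \<Longrightarrow> lin_ext \<phi> f = (\<Sum>m \<in> A. const_poly (lookup f m) * \<phi> m)"
  unfolding lin_ext_def by (intro sum.mono_neutral_left) (auto simp: in_keys_iff)

lemma lin_ext_add: "lin_ext \<phi> (f + g) = lin_ext \<phi> f + lin_ext \<phi> g"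
proof -
  let ?A = "keys f \<union> keys g"
  have "lin_ext \<phi> h = (\<Sum>m \<in> ?A. const_poly (lookup h m) * \<phi> m)" if "keys h \<subseteq> ?A" for h
    using that by (intro lin_ext_superset) auto
  from this[of f] this[of g] this[of "f + g"] keys_add[of f g] show ?thesis
    by (simp add: lookup_add const_poly_add distrib_right sum.distrib)
qed

lemma lin_ext_single: "lin_ext \<phi> (single m c) = const_poly c * \<phi> m"
  by (simp add: lin_ext_def)

lemma lin_ext_0 [simp]: "lin_ext \<phi> 0 = 0"
  by (simp add: lin_ext_def)

lemma lin_ext_const_mult: "lin_ext \<phi> (const_poly c * f) = const_poly c * lin_ext \<phi> f"
proof (induction f rule: poly_mapping_induct)
  case (single m d)
  have "const_poly c * single m d = single m (c * d)"
    by (simp add: const_poly_def mult_single)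
  then show ?case by (simp add: lin_ext_single const_poly_mult ac_simps)
qed (simp add: lin_ext_add distrib_left)

definition monomial_subst :: "('x \<Rightarrow> ('y, 'k::comm_ring_1) mvpoly) \<Rightarrow> ('x \<Rightarrow>\<^sub>0 nat) \<Rightarrow> ('y, 'k) mvpoly" where
  "monomial_subst \<sigma> m = (\<Prod>v \<in> keys m. \<sigma> v ^ lookup m v)"

lemma monomial_subst_add: "monomial_subst \<sigma> (m + n) = monomial_subst \<sigma> m * monomial_subst \<sigma> n"
proof -
  let ?A = "keys m \<union> keys n"
  have "monomial_subst \<sigma> k = (\<Prod>v \<in> ?A. \<sigma> v ^ lookup k v)" if "keys k \<subseteq> ?A" for k
    unfolding monomial_subst_def using that
    by (intro prod.mono_neutral_left) (auto simp: in_keys_iff)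
  from this[of m] this[of n] this[of "m + n"] keys_add[of m n] show ?thesis
    by (simp add: lookup_add power_add prod.distrib)
qed

definition poly_subst :: "('x \<Rightarrow> ('y, 'k::comm_ring_1) mvpoly) \<Rightarrow> ('x, 'k) mvpoly \<Rightarrow> ('y, 'k) mvpoly" where
  "poly_subst \<sigma> = lin_ext (monomial_subst \<sigma>)"

lemma poly_subst_add: "poly_subst \<sigma> (f + g) = poly_subst \<sigma> f + poly_subst \<sigma> g"
  by (simp add: poly_subst_def lin_ext_add)

lemma poly_subst_const [simp]: "poly_subst \<sigma> (const_poly c) = const_poly c"
  using lin_ext_single[of "monomial_subst \<sigma>" 0 c]
  by (simp add: poly_subst_def monomial_subst_def flip: const_poly_def)

lemma poly_subst_0 [simp]: "poly_subst \<sigma> 0 = 0"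
  by (simp add: poly_subst_def)

lemma poly_subst_1 [simp]: "poly_subst \<sigma> 1 = 1"
  using poly_subst_const[of \<sigma> 1] by simp

lemma poly_subst_var [simp]: "poly_subst \<sigma> (var_poly v) = \<sigma> v"
  by (simp add: poly_subst_def var_poly_def lin_ext_single monomial_subst_def)

lemma poly_subst_mult: "poly_subst \<sigma> (f * g) = poly_subst \<sigma> f * poly_subst \<sigma> g"
proof (induction f rule: poly_mapping_induct)
  case (single m c)
  show ?case
  proof (induction g rule: poly_mapping_induct)
    case (single n d)
    then show ?case
      by (simp add: poly_subst_def mult_single lin_ext_single monomial_subst_add const_poly_mult ac_simps)
  qed (simp add: poly_subst_add distrib_left)
qed (simp add: poly_subst_add distrib_right)

lemma poly_subst_uminus: "poly_subst \<sigma> (- f) = - poly_subst \<sigma> f"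
  using poly_subst_add[of \<sigma> f "- f"] by (simp add: eq_neg_iff_add_eq_0 add.commute)

lemma poly_subst_diff: "poly_subst \<sigma> (f - g) = poly_subst \<sigma> f - poly_subst \<sigma> g"
  using poly_subst_add[of \<sigma> f "- g"] by (simp add: poly_subst_uminus)

lemma poly_subst_sum: "poly_subst \<sigma> (sum f A) = (\<Sum>a\<in>A. poly_subst \<sigma> (f a))"
  by (induction A rule: infinite_finite_induct) (auto simp: poly_subst_add)

lemma poly_subst_prod: "poly_subst \<sigma> (prod f A) = (\<Prod>a\<in>A. poly_subst \<sigma> (f a))"
  by (induction A rule: infinite_finite_induct) (auto simp: poly_subst_mult)

lemma poly_subst_in_polys:
  assumes "f \<in> polys X" "\<And>v. v \<in> X \<Longrightarrow> \<sigma> v \<in> polys Y"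
  shows "poly_subst \<sigma> f \<in> polys Y"
  using assms(1) by (induction f rule: polys_induct) (auto simp: assms poly_subst_add poly_subst_mult)

lemma poly_subst_ident:
  assumes "f \<in> polys X" "\<And>v. v \<in> X \<Longrightarrow> \<sigma> v = var_poly v"
  shows "poly_subst \<sigma> f = f"
  using assms(1) by (induction f rule: polys_induct) (auto simp: assms poly_subst_add poly_subst_mult)

text \<open>Modulo p the substitution fixes the variables, hence everything they generate.\<close>

lemma dvd_diff_poly_subst:
  assumes "f \<in> polys X" "\<And>v. v \<in> X \<Longrightarrow> p dvd var_poly v - \<sigma> v"
  shows "p dvd f - poly_subst \<sigma> (f :: ('x, 'k::comm_ring_1) mvpoly)"
  using assms(1)
proof (induction f rule: polys_induct)
  case (add f g)
  have "f + g - poly_subst \<sigma> (f + g) = (f - poly_subst \<sigma> f) + (g - poly_subst \<sigma> g)"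
    by (simp add: poly_subst_add)
  then show ?case using add by (metis dvd_add)
next
  case (mult f g)
  have "f * g - poly_subst \<sigma> (f * g) = f * (g - poly_subst \<sigma> g) + poly_subst \<sigma> g * (f - poly_subst \<sigma> f)"
    by (simp add: poly_subst_mult algebra_simps)
  then show ?case using mult by (metis dvd_add dvd_mult)
qed (use assms in auto)

lemma dvd_polysE:
  assumes "p dvd f" "p \<in> polys X" "f \<in> polys X"
  obtains s where "s \<in> polys X" "f = p * (s :: ('x, 'k::comm_ring_1) mvpoly)"
proof -
  \<comment> \<open>The cofactor may contain variables outside X. Setting these to 0 changes neither
    p nor f and moves the cofactor into \<open>polys X\<close>.\<close>
  define \<pi> where "\<pi> = poly_subst (\<lambda>v. if v \<in> X then (var_poly v :: ('x, 'k) mvpoly) else 0)"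
  have id: "\<pi> g = g" if "g \<in> polys X" for g
    unfolding \<pi>_def using that by (intro poly_subst_ident) auto
  obtain s where s: "f = p * s" using assms by auto
  have "\<pi> s \<in> polys X"
    unfolding \<pi>_def by (rule poly_subst_in_polys[of _ UNIV]) auto
  moreover have "f = p * \<pi> s" using arg_cong[OF s, of \<pi>] id assms
    by (simp add: \<pi>_def poly_subst_mult)
  ultimately show ?thesis using that by blast
qed

section \<open>Homogeneous polynomials and components\<close>

definition homogeneous :: "nat \<Rightarrow> ('x, 'k::zero) mvpoly \<Rightarrow> bool" where
  "homogeneous d f \<longleftrightarrow> (\<forall>t \<in> keys f. monomial_degree t = d)"

lemma homogeneous_0 [simp, intro]: "homogeneous d 0"
  by (simp add: homogeneous_def)

lemma homogeneous_const [simp, intro]: "homogeneous 0 (const_poly c)"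
  using keys_const_poly[of c] by (auto simp: homogeneous_def)

lemma homogeneous_1 [simp, intro]: "homogeneous 0 (1 :: ('x, 'k::comm_ring_1) mvpoly)"
  by (simp add: homogeneous_def)

lemma homogeneous_var [simp, intro]: "homogeneous 1 (var_poly v)" "homogeneous (Suc 0) (var_poly v)"
  by (auto simp: homogeneous_def var_poly_def)

lemma homogeneous_add [intro]: "homogeneous d f \<Longrightarrow> homogeneous d g \<Longrightarrow> homogeneous d (f + g)"
  using keys_add[of f g] by (auto simp: homogeneous_def)

lemma homogeneous_uminus [intro]: "homogeneous d f \<Longrightarrow> homogeneous d (- f :: ('x, 'k::comm_ring_1) mvpoly)"
  by (auto simp: homogeneous_def in_keys_iff)

lemma homogeneous_diff [intro]:
  "homogeneous d f \<Longrightarrow> homogeneous d g \<Longrightarrow> homogeneous d (f - g :: ('x, 'k::comm_ring_1) mvpoly)"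
  using homogeneous_add[of d f "- g"] by auto

lemma homogeneous_mult:
  assumes "homogeneous d f" "homogeneous e g"
  shows "homogeneous (d + e) (f * g :: ('x, 'k::comm_ring_1) mvpoly)"
  unfolding homogeneous_def
proof
  fix m assume "m \<in> keys (f * g)"
  then obtain a b where "m = a + b" "a \<in> keys f" "b \<in> keys g"
    using keys_mult by blast
  then show "monomial_degree m = d + e" using assms
    by (simp add: homogeneous_def monomial_degree_add)
qed

lemma homogeneous_const_mult [intro]:
  "homogeneous d f \<Longrightarrow> homogeneous d (const_poly c * f :: ('x, 'k::comm_ring_1) mvpoly)"
  using homogeneous_mult[of 0 "const_poly c" d f] by simp

lemma homogeneous_sum [intro]: "(\<And>a. a \<in> A \<Longrightarrow> homogeneous d (f a)) \<Longrightarrow> homogeneous d (sum f A)"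
  by (induction A rule: infinite_finite_induct) auto

lemma homogeneous_power:
  "homogeneous d f \<Longrightarrow> homogeneous (n * d) (f ^ n :: ('x, 'k::comm_ring_1) mvpoly)"
  by (induction n) (auto intro: homogeneous_mult)

lemma homogeneous_prod:
  "(\<And>a. a \<in> A \<Longrightarrow> homogeneous (d a) (f a :: ('x, 'k::comm_ring_1) mvpoly)) \<Longrightarrow>
   homogeneous (sum d A) (prod f A)"
  by (induction A rule: infinite_finite_induct) (auto intro: homogeneous_mult)

lemma homogeneous_monomial_subst:
  assumes "\<And>v. v \<in> keys m \<Longrightarrow> homogeneous 1 (\<sigma> v)"
  shows "homogeneous (monomial_degree m) (monomial_subst \<sigma> m)"
  unfolding monomial_degree_def monomial_subst_def
proof (rule homogeneous_prod)
  fix v assume "v \<in> keys m"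
  then show "homogeneous (lookup m v) (\<sigma> v ^ lookup m v)"
    using homogeneous_power[of 1 "\<sigma> v" "lookup m v"] assms by simp
qed

lemma homogeneous_poly_subst:
  assumes "homogeneous d f" "f \<in> polys X" "\<And>v. v \<in> X \<Longrightarrow> homogeneous 1 (\<sigma> v)"
  shows "homogeneous d (poly_subst \<sigma> f)"
  unfolding poly_subst_def lin_ext_def
proof (intro homogeneous_sum homogeneous_const_mult)
  fix m assume "m \<in> keys f"
  then show "homogeneous d (monomial_subst \<sigma> m)"
    using assms homogeneous_monomial_subst[of m \<sigma>] by (force simp: homogeneous_def polys_def)
qed

definition hom_comp :: "nat \<Rightarrow> ('x, 'k::comm_ring_1) mvpoly \<Rightarrow> ('x, 'k) mvpoly" where
  "hom_comp d = lin_ext (\<lambda>m. if monomial_degree m = d then single m 1 else 0)"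

lemma hom_comp_single: "hom_comp d (single m c) = (if monomial_degree m = d then single m c else 0)"
  by (simp add: hom_comp_def lin_ext_single const_poly_def mult_single)

lemma hom_comp_add: "hom_comp d (f + g) = hom_comp d f + hom_comp d g"
  by (simp add: hom_comp_def lin_ext_add)

lemma hom_comp_0 [simp]: "hom_comp d 0 = 0"
  by (simp add: hom_comp_def)

lemma hom_comp_sum: "hom_comp d (sum f A) = (\<Sum>a\<in>A. hom_comp d (f a))"
  by (induction A rule: infinite_finite_induct) (auto simp: hom_comp_add)

lemma lookup_hom_comp: "lookup (hom_comp d f) m = (lookup f m when monomial_degree m = d)"
  by (induction f rule: poly_mapping_induct)
    (auto simp: hom_comp_single hom_comp_add lookup_single lookup_add when_def)

lemma homogeneous_hom_comp [simp, intro]: "homogeneous d (hom_comp d f)"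
  by (auto simp: homogeneous_def in_keys_iff lookup_hom_comp)

lemma hom_comp_in_polys [intro]: "f \<in> polys X \<Longrightarrow> hom_comp d f \<in> polys X"
  by (auto simp: polys_def in_keys_iff lookup_hom_comp)

lemma hom_comp_homogeneous: "homogeneous e f \<Longrightarrow> hom_comp d f = (if d = e then f else 0)"
  by (auto simp: homogeneous_def in_keys_iff lookup_hom_comp when_def intro!: poly_mapping_eqI)

text \<open>Multiplication by g shifts degrees by e. The case distinction keeps the truncated n - e
  from producing a spurious component when n < e.\<close>

lemma hom_comp_mult:
  assumes g: "homogeneous e g"
  shows "hom_comp n (f * g) = (if e \<le> n then hom_comp (n - e) f * g else 0)"
proof (induction f rule: poly_mapping_induct)
  case (single m c)
  have "homogeneous (monomial_degree m + e) (single m c * g)"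
    using g by (intro homogeneous_mult) (auto simp: homogeneous_def)
  then show ?case by (auto simp: hom_comp_homogeneous hom_comp_single)
qed (simp add: hom_comp_add distrib_right)

lemma homogeneous_0E:
  assumes "homogeneous 0 f" obtains c where "f = const_poly c"
proof -
  have "f = const_poly (lookup f 0)"
    using assms by (intro poly_mapping_eqI) (auto simp: homogeneous_def const_poly_def
        lookup_single in_keys_iff when_def monomial_degree_eq_0_iff)
  then show ?thesis using that by blast
qed

section \<open>Linear forms and hyperplanes\<close>

text \<open>The value \<theta>(\<alpha>) of the derivation with coefficient vector \<eta> at the
  linear form with coefficients a. The form itself is its value under the Euler derivation, \<eta> =
  \<open>var_poly\<close>.\<close>

definition form_at :: "'x set \<Rightarrow> ('x \<Rightarrow> 'k::comm_ring_1) \<Rightarrow> ('x \<Rightarrow> ('y, 'k) mvpoly) \<Rightarrow> ('y, 'k) mvpoly" where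
  "form_at X a \<eta> = (\<Sum>v\<in>X. const_poly (a v) * \<eta> v)"

lemma linear_form_eq_form_at: "linear_form X a = form_at X a var_poly"
  by (simp add: linear_form_def form_at_def)

lemma form_at_in_polys [intro]: "(\<And>v. v \<in> X \<Longrightarrow> \<eta> v \<in> polys Y) \<Longrightarrow> form_at X a \<eta> \<in> polys Y"
  by (auto simp: form_at_def)

lemma linear_form_in_polys [simp, intro]: "linear_form X a \<in> polys X"
  by (auto simp: linear_form_eq_form_at)

lemma homogeneous_form_at [intro]:
  "(\<And>v. v \<in> X \<Longrightarrow> homogeneous d (\<eta> v)) \<Longrightarrow> homogeneous d (form_at X a \<eta>)"
  by (auto simp: form_at_def)

lemma homogeneous_linear_form [simp, intro]: "homogeneous 1 (linear_form X a)"
  unfolding linear_form_eq_form_at by (intro homogeneous_form_at homogeneous_var)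

lemma form_at_cong:
  "(\<And>v. v \<in> X \<Longrightarrow> a v = b v) \<Longrightarrow> (\<And>v. v \<in> X \<Longrightarrow> \<eta> v = \<zeta> v) \<Longrightarrow> form_at X a \<eta> = form_at X b \<zeta>"
  by (auto simp: form_at_def intro: sum.cong)

lemma linear_form_cong: "(\<And>v. v \<in> X \<Longrightarrow> a v = b v) \<Longrightarrow> linear_form X a = linear_form X b"
  unfolding linear_form_eq_form_at by (rule form_at_cong) auto

lemma form_at_scale: "form_at X (\<lambda>v. c * a v) \<eta> = const_poly c * form_at X a \<eta>"
  by (simp add: form_at_def const_poly_mult sum_distrib_left ac_simps)

lemma form_at_add: "form_at X (\<lambda>v. a v + b v) \<eta> = form_at X a \<eta> + form_at X b \<eta>"
  by (simp add: form_at_def const_poly_add distrib_right sum.distrib)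

lemma form_at_mult_vec: "form_at X a (\<lambda>v. p * \<eta> v) = p * form_at X a \<eta>"
  by (simp add: form_at_def sum_distrib_left ac_simps)

lemma form_at_add_vec: "form_at X a (\<lambda>v. \<eta> v + \<zeta> v) = form_at X a \<eta> + form_at X a \<zeta>"
  by (simp add: form_at_def distrib_left sum.distrib)

lemma form_at_sum_vec: "form_at X a (\<lambda>v. \<Sum>i\<in>I. \<eta> i v) = (\<Sum>i\<in>I. form_at X a (\<eta> i))"
  unfolding form_at_def by (subst sum.swap) (simp add: sum_distrib_left)

lemma form_at_remove:
  "finite X \<Longrightarrow> i \<in> X \<Longrightarrow> form_at X a \<eta> = const_poly (a i) * \<eta> i + form_at (X - {i}) a \<eta>"
  unfolding form_at_def by (rule sum.remove)

lemma poly_subst_form_at: "poly_subst \<sigma> (form_at X a \<eta>) = form_at X a (\<lambda>v. poly_subst \<sigma> (\<eta> v))"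
  by (simp add: form_at_def poly_subst_sum poly_subst_mult)

lemma lookup_linear_form:
  fixes X :: "'x set"
  assumes "finite X" "v \<in> X" shows "lookup (linear_form X a) (single v 1) = a v"
proof -
  have "single w (1::nat) = single v 1 \<longleftrightarrow> w = v" for w :: 'x
    by (metis lookup_single_eq lookup_single_not_eq one_neq_zero)
  then have "lookup (const_poly (a w) * var_poly w) (single v 1) = (if w = v then a w else 0)" for w
    by (simp add: const_poly_def var_poly_def mult_single lookup_single when_def)
  then show ?thesis using assms by (simp add: linear_form_def lookup_sum)
qed

lemma linear_form_eq_0_iff: "finite X \<Longrightarrow> linear_form X a = 0 \<longleftrightarrow> (\<forall>v\<in>X. a v = 0)"
  using lookup_linear_form[of X _ a] by (auto simp: linear_form_def intro!: sum.neutral)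

text \<open>The substitution solving \<open>\<Sum>\<^sub>v a\<^sub>v x\<^sub>v = 0\<close> for \<open>x\<^sub>i\<close>; it presents the quotient by this linear form
  as the polynomial ring without \<open>x\<^sub>i\<close>.\<close>

definition solve_subst :: "'x set \<Rightarrow> ('x \<Rightarrow> 'k::field) \<Rightarrow> 'x \<Rightarrow> 'x \<Rightarrow> ('x, 'k) mvpoly" where
  "solve_subst X a i v = (if v = i then linear_form (X - {i}) (\<lambda>w. - a w / a i) else var_poly v)"

text \<open>Coefficients of the form b on the hyperplane of a, in the coordinates other than i: the
  multiple of a subtracted from b is the one that kills the entry at i.\<close>

definition form_restrict :: "('x \<Rightarrow> 'k::field) \<Rightarrow> 'x \<Rightarrow> ('x \<Rightarrow> 'k) \<Rightarrow> 'x \<Rightarrow> 'k" where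
  "form_restrict a i b v = b v - b i * a v / a i"

context
  fixes X :: "'x set" and a :: "'x \<Rightarrow> 'k::field" and i :: 'x
  assumes fin: "finite X" and i: "i \<in> X" and ai: "a i \<noteq> 0"
begin

lemma linear_form_eq_solve:
  "linear_form X a = const_poly (a i) * (var_poly i - solve_subst X a i i)"
proof -
  have "linear_form (X - {i}) (\<lambda>w. - a w / a i) = linear_form (X - {i}) (\<lambda>w. (- inverse (a i)) * a w)"
    by (rule linear_form_cong) (simp add: field_simps)
  also have "\<dots> = const_poly (- inverse (a i)) * linear_form (X - {i}) a"
    unfolding linear_form_eq_form_at by (rule form_at_scale)
  finally have "const_poly (a i) * solve_subst X a i i = - linear_form (X - {i}) a"
    using ai by (simp add: solve_subst_def flip: mult.assoc const_poly_mult)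
      (simp add: const_poly_uminus)
  then show ?thesis
    using form_at_remove[OF fin i, of a var_poly]
    by (simp add: linear_form_eq_form_at right_diff_distrib)
qed

lemma solve_subst_in_polys: "f \<in> polys X \<Longrightarrow> poly_subst (solve_subst X a i) f \<in> polys (X - {i})"
  by (erule poly_subst_in_polys) (auto simp: solve_subst_def)

lemma solve_subst_ident: "f \<in> polys (X - {i}) \<Longrightarrow> poly_subst (solve_subst X a i) f = f"
  by (erule poly_subst_ident) (auto simp: solve_subst_def)

lemma homogeneous_solve_subst:
  "homogeneous d f \<Longrightarrow> homogeneous d (poly_subst (solve_subst X a i) f)"
  by (rule homogeneous_poly_subst[of _ _ UNIV]) (auto simp: solve_subst_def simp del: One_nat_def)

text \<open>The hypothesis says that \<eta> is tangent to the hyperplane of a. The multiple of a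
  subtracted in \<open>form_restrict\<close> then contributes 0, and the term at i disappears, so
  the reduced vector acts on restricted forms without its component at i.\<close>

lemma solve_subst_form_at_restrict:
  assumes "poly_subst (solve_subst X a i) (form_at X a \<eta>) = 0"
  shows "poly_subst (solve_subst X a i) (form_at X b \<eta>) =
    form_at (X - {i}) (form_restrict a i b) (\<lambda>v. poly_subst (solve_subst X a i) (\<eta> v))"
proof -
  let ?\<zeta> = "\<lambda>v. poly_subst (solve_subst X a i) (\<eta> v)"
  have eq: "form_at X (form_restrict a i b) ?\<zeta> = form_at X b ?\<zeta> + form_at X (\<lambda>v. (- b i / a i) * a v) ?\<zeta>"
    by (subst form_at_add[symmetric]) (rule form_at_cong, auto simp: form_restrict_def)
  have "form_at X (\<lambda>v. (- b i / a i) * a v) ?\<zeta> = 0"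
    using assms by (subst form_at_scale) (simp add: poly_subst_form_at)
  moreover have "form_at X (form_restrict a i b) ?\<zeta> = form_at (X - {i}) (form_restrict a i b) ?\<zeta>"
    using ai by (subst form_at_remove[OF fin i]) (simp add: form_restrict_def)
  ultimately show ?thesis using eq by (simp add: poly_subst_form_at)
qed

lemma solve_subst_self: "poly_subst (solve_subst X a i) (linear_form X a) = 0"
proof -
  have "poly_subst (solve_subst X a i) (solve_subst X a i i) = solve_subst X a i i"
    by (rule solve_subst_ident) (simp add: solve_subst_def)
  then show ?thesis
    by (subst linear_form_eq_solve) (simp add: poly_subst_mult poly_subst_diff)
qed

lemma solve_subst_linear_form:
  "poly_subst (solve_subst X a i) (linear_form X b) = linear_form (X - {i}) (form_restrict a i b)"
proof -
  have "form_at (X - {i}) (form_restrict a i b) (\<lambda>v. poly_subst (solve_subst X a i) (var_poly v)) =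
    linear_form (X - {i}) (form_restrict a i b)"
    unfolding linear_form_eq_form_at by (rule form_at_cong) (auto simp: solve_subst_def)
  then show ?thesis
    using solve_subst_form_at_restrict[of var_poly b] solve_subst_self
    by (simp add: linear_form_eq_form_at)
qed

text \<open>The kernel of the substitution is the ideal of the form: the form is sent to 0, and
  every f is congruent to its image modulo the form.\<close>

lemma linear_form_dvd_iff: "linear_form X a dvd f \<longleftrightarrow> poly_subst (solve_subst X a i) f = 0"
proof
  assume "linear_form X a dvd f"
  then show "poly_subst (solve_subst X a i) f = 0"
    by (auto simp: poly_subst_mult solve_subst_self)
next
  assume "poly_subst (solve_subst X a i) f = 0"
  moreover have "linear_form X a dvd f - poly_subst (solve_subst X a i) f"
  proof (rule dvd_diff_poly_subst[of _ UNIV])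
    fix v
    show "linear_form X a dvd var_poly v - solve_subst X a i v"
    proof (cases "v = i")
      case True
      have "linear_form X a * const_poly (inverse (a i)) =
          (var_poly i - solve_subst X a i i) * (const_poly (a i) * const_poly (inverse (a i)))"
        by (simp only: linear_form_eq_solve ac_simps)
      also have "const_poly (a i) * const_poly (inverse (a i)) = (1 :: ('x, 'k) mvpoly)"
        using ai by (simp flip: const_poly_mult)
      finally have "var_poly i - solve_subst X a i i = linear_form X a * const_poly (inverse (a i))"
        by simp
      then show ?thesis using True by (metis dvd_triv_left)
    qed (simp add: solve_subst_def)
  qed simp
  ultimately show "linear_form X a dvd f" by simp
qed

end

text \<open>Divisibility by the form is the kernel of a ring map into a domain. The order on the
  variables is there to give the polynomial type its instance without zero divisors.\<close>

lemma prime_elem_linear_form: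
  assumes "finite X" "i \<in> X" "(a :: 'x::linorder \<Rightarrow> 'k::field) i \<noteq> 0"
  shows "prime_elem (linear_form X a)"
proof (rule prime_elemI)
  note dvd_iff = linear_form_dvd_iff[of X i a, OF assms]
  show "linear_form X a \<noteq> 0" using assms by (auto simp: linear_form_eq_0_iff)
  show "\<not> linear_form X a dvd 1" by (simp add: dvd_iff)
  fix f g assume "linear_form X a dvd f * g"
  then show "linear_form X a dvd f \<or> linear_form X a dvd g"
    by (simp add: dvd_iff poly_subst_mult)
qed

lemma linear_form_dvd_linear_form:
  assumes "finite X" "i \<in> X" "(a :: 'x \<Rightarrow> 'k::field) i \<noteq> 0" "linear_form X a dvd linear_form X b" "v \<in> X"
  shows "b v = b i / a i * a v"
proof (cases "v = i")
  case False
  have "linear_form (X - {i}) (form_restrict a i b) = 0"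
    using assms by (simp add: linear_form_dvd_iff solve_subst_linear_form)
  then show ?thesis using assms False by (simp add: linear_form_eq_0_iff form_restrict_def)
qed (use assms in simp)

lemma hyperplane_subset_imp_proportional:
  assumes "finite X" "i \<in> X" "(a :: 'x \<Rightarrow> 'k::field) i \<noteq> 0" "v \<in> X"
    "defines_hyperplane X a H" "defines_hyperplane X b H'" "H \<subseteq> H'"
  shows "b v = b i / a i * a v"
proof (cases "v = i")
  case False
  \<comment> \<open>The point a_i e_v - a_v e_i lies on H; evaluating b there gives a 2 by 2 minor
    of the coefficient vectors.\<close>
  define x where "x = (\<lambda>w\<in>X. if w = v then a i else if w = i then - a v else 0)"
  have sum: "(\<Sum>w\<in>X. c w * x w) = c v * a i - c i * a v" for c :: "'x \<Rightarrow> 'k"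
  proof -
    have "(\<Sum>w\<in>X. c w * x w) =
        (\<Sum>w\<in>X. (if w = v then c v * a i else 0) + (if w = i then - c i * a v else 0))"
      using False by (intro sum.cong) (auto simp: x_def)
    then show ?thesis using assms by (simp add: sum.distrib)
  qed
  have "x \<in> H" using assms sum[of a] by (auto simp: defines_hyperplane_def points_def x_def)
  then have "x \<in> H'" using assms by auto
  then have "b v * a i - b i * a v = 0"
    using assms sum[of b] by (auto simp: defines_hyperplane_def)
  then show ?thesis using assms by (simp add: field_simps)
qed (use assms in simp)

definition is_hyperplane :: "'x set \<Rightarrow> ('x \<Rightarrow> 'k::field) set \<Rightarrow> bool" where
  "is_hyperplane X H \<longleftrightarrow> (\<exists>a. defines_hyperplane X a H \<and> (\<exists>v\<in>X. a v \<noteq> 0))"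

lemma defines_hyperplane_scale:
  assumes "c \<noteq> (0 :: 'k::field)" "\<And>v. v \<in> X \<Longrightarrow> b v = c * a v"
  shows "defines_hyperplane X b H \<longleftrightarrow> defines_hyperplane X a H"
proof -
  have "(\<Sum>v\<in>X. b v * x v) = c * (\<Sum>v\<in>X. a v * x v)" for x
    using assms by (simp add: sum_distrib_left ac_simps)
  then show ?thesis using assms by (simp add: defines_hyperplane_def)
qed

lemma hyperplane_forms_proportional:
  assumes "finite X" "i \<in> X" "(a :: 'x \<Rightarrow> 'k::field) i \<noteq> 0"
    "defines_hyperplane X a H" "defines_hyperplane X b H"
  shows "b i \<noteq> 0" "\<And>v. v \<in> X \<Longrightarrow> b v = b i / a i * a v"
proof -
  show *: "b v = b i / a i * a v" if "v \<in> X" for v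
    using hyperplane_subset_imp_proportional[OF assms(1-3) that assms(4,5)] by simp
  show "b i \<noteq> 0"
  proof
    assume "b i = 0"
    then have "b v = 0" if "v \<in> X" for v using *[OF that] by simp
    then have "\<forall>v\<in>X. a v = 0" if "v \<in> X" for v
    proof -
      \<comment> \<open>If b vanished, H would be the whole space and contain the unit point of i,
        where the form a takes the value a_i.\<close>
      define x where "x = (\<lambda>w\<in>X. if w = i then (1::'k) else 0)"
      have "(\<Sum>w\<in>X. a w * x w) = (\<Sum>w\<in>X. if w = i then a i else 0)"
        by (intro sum.cong) (auto simp: x_def)
      moreover have "x \<in> H"
        using assms(5) \<open>\<And>v. v \<in> X \<Longrightarrow> b v = 0\<close> by (simp add: defines_hyperplane_def points_def x_def)
      moreover from \<open>x \<in> H\<close> have "x \<in> {x \<in> points X. (\<Sum>v\<in>X. a v * x v) = 0}"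
        using assms(4) by (simp only: defines_hyperplane_def)
      ultimately have False using assms(1-3) by simp
      then show ?thesis ..
    qed
    then show False using assms by auto
  qed
qed

text \<open>Divisibility between nonzero linear forms means proportionality, and proportional forms
  define the same hyperplane. This supplies the coprimality for products of forms.\<close>

lemma not_dvd_linear_form:
  assumes "finite X" "(\<exists>v\<in>X. (a :: 'x \<Rightarrow> 'k::field) v \<noteq> 0)" "\<exists>v\<in>X. b v \<noteq> 0"
    "defines_hyperplane X a H" "defines_hyperplane X b H'" "H \<noteq> H'"
  shows "\<not> linear_form X a dvd linear_form X b"
proof
  assume dvd: "linear_form X a dvd linear_form X b"
  obtain i where i: "i \<in> X" "a i \<noteq> 0" using assms by auto
  have *: "b v = b i / a i * a v" if "v \<in> X" for v
    using linear_form_dvd_linear_form[OF assms(1) i dvd that] .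
  then have "b i \<noteq> 0" using assms(3) by force
  then have "defines_hyperplane X b H' \<longleftrightarrow> defines_hyperplane X a H'"
    using i by (intro defines_hyperplane_scale[of "b i / a i"] *) auto
  then show False using assms by (simp add: defines_hyperplane_def)
qed

text \<open>The derivation \<open>\<Sum>\<^sub>v \<eta>\<^sub>v \<partial>/\<partial>x\<^sub>v\<close> is represented by its coefficient vector \<open>\<eta>\<close>, whose values outside the
  coordinate set are irrelevant.\<close>

definition log_vectors :: "('x, 'k::comm_ring_1) arrangement \<Rightarrow> ('x \<Rightarrow> ('x, 'k) mvpoly) set" where
  "log_vectors A = {\<eta>. (\<forall>v \<in> fst A. \<eta> v \<in> polys (fst A)) \<and>
     (\<forall>H \<in> snd A. \<forall>a. defines_hyperplane (fst A) a H \<longrightarrow>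
        linear_form (fst A) a dvd form_at (fst A) a \<eta>)}"

lemma linear_form_scale_dvd:
  assumes "c \<noteq> (0 :: 'k::field)" "\<And>v. v \<in> X \<Longrightarrow> b v = c * a v"
  shows "linear_form X b dvd form_at X b \<eta> \<longleftrightarrow> linear_form X a dvd form_at X a \<eta>"
proof -
  have 1: "linear_form X b = const_poly c * linear_form X a"
    unfolding linear_form_eq_form_at form_at_scale[symmetric] using assms by (intro form_at_cong) auto
  have 2: "form_at X b \<eta> = const_poly c * form_at X a \<eta>"
    unfolding form_at_scale[symmetric] using assms by (intro form_at_cong) auto
  have inv: "const_poly (inverse c) * (const_poly c * f) = f" for f :: "('d, 'k) mvpoly"
    using assms by (simp flip: mult.assoc)
  show ?thesis
    unfolding 1 2 by (metis inv dvd_refl mult_dvd_mono)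
qed

text \<open>All defining forms of a hyperplane are nonzero multiples of each other and the
  divisibility condition is invariant under scaling, so one freely chosen form per hyperplane
  decides membership.\<close>

lemma log_vectors_iff:
  assumes "finite X"
    and "\<And>H. H \<in> HS \<Longrightarrow> defines_hyperplane X (\<gamma> H) H \<and> (\<exists>v\<in>X. \<gamma> H v \<noteq> 0)"
  shows "\<eta> \<in> log_vectors (X, HS) \<longleftrightarrow> (\<forall>v\<in>X. \<eta> v \<in> polys X) \<and>
     (\<forall>H\<in>HS. linear_form X (\<gamma> H) dvd form_at X (\<gamma> H) (\<eta> :: 'x \<Rightarrow> ('x, 'k::field) mvpoly))"
proof -
  have "(\<forall>b. defines_hyperplane X b H \<longrightarrow> linear_form X b dvd form_at X b \<eta>) \<longleftrightarrow>
      linear_form X (\<gamma> H) dvd form_at X (\<gamma> H) \<eta>" if H: "H \<in> HS" for H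
  proof -
    obtain i where i: "i \<in> X" "\<gamma> H i \<noteq> 0" "defines_hyperplane X (\<gamma> H) H" using assms(2)[OF H] by auto
    have "linear_form X b dvd form_at X b \<eta> \<longleftrightarrow> linear_form X (\<gamma> H) dvd form_at X (\<gamma> H) \<eta>"
      if "defines_hyperplane X b H" for b
      using hyperplane_forms_proportional(1)[OF assms(1) i that] i
      by (intro linear_form_scale_dvd[of "b i / \<gamma> H i"] hyperplane_forms_proportional(2)[OF assms(1) i that]) auto
    then show ?thesis using i by blast
  qed
  then show ?thesis by (simp add: log_vectors_def)
qed

section \<open>Derivations and their coefficient vectors\<close>

text \<open>If v does not occur in m, the truncated difference of exponents is harmless because the
  coefficient is 0.\<close>

definition monomial_partial :: "'x \<Rightarrow> ('x \<Rightarrow>\<^sub>0 nat) \<Rightarrow> ('x, 'k::comm_ring_1) mvpoly" where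
  "monomial_partial v m = single (m - single v 1) (of_nat (lookup m v))"

lemma monomial_partial_add:
  "(monomial_partial v (m + n) :: ('x, 'k::comm_ring_1) mvpoly) =
    single m 1 * monomial_partial v n + single n 1 * monomial_partial v m"
proof -
  have shift: "a + (b - single v (Suc 0)) = a + b - single v (Suc 0)" if "0 < lookup b v" for a b :: "'x \<Rightarrow>\<^sub>0 nat"
    using that by (intro poly_mapping_eqI) (auto simp: lookup_add lookup_minus lookup_single when_def)
  have shift': "(a - single v (Suc 0)) + b = a + b - single v (Suc 0)" if "0 < lookup a v" for a b :: "'x \<Rightarrow>\<^sub>0 nat"
    using shift[OF that, of b] by (simp add: add.commute)
  show ?thesis
    by (cases "lookup m v = 0"; cases "lookup n v = 0")
      (simp_all add: monomial_partial_def mult_single lookup_add shift shift' single_add add.commute[of n])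
qed

definition vector_derivation ::
    "'x set \<Rightarrow> ('x \<Rightarrow> ('x, 'k::comm_ring_1) mvpoly) \<Rightarrow> ('x, 'k) mvpoly \<Rightarrow> ('x, 'k) mvpoly" where
  "vector_derivation X \<eta> = lin_ext (\<lambda>m. \<Sum>v\<in>X. monomial_partial v m * \<eta> v)"

lemma vector_derivation_add:
  "vector_derivation X \<eta> (f + g) = vector_derivation X \<eta> f + vector_derivation X \<eta> g"
  by (simp add: vector_derivation_def lin_ext_add)

lemma vector_derivation_const_mult:
  "vector_derivation X \<eta> (const_poly c * f) = const_poly c * vector_derivation X \<eta> f"
  by (simp add: vector_derivation_def lin_ext_const_mult)

lemma vector_derivation_const [simp]: "vector_derivation X \<eta> (const_poly c) = 0"
  using lin_ext_single[of "\<lambda>m. \<Sum>v\<in>X. monomial_partial v m * \<eta> v" 0 c]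
  by (simp add: vector_derivation_def monomial_partial_def flip: const_poly_def)

lemma vector_derivation_sum:
  "vector_derivation X \<eta> (sum f A) = (\<Sum>a\<in>A. vector_derivation X \<eta> (f a))"
  using vector_derivation_const[of X \<eta> 0]
  by (induction A rule: infinite_finite_induct) (auto simp: vector_derivation_add)

lemma vector_derivation_mult:
  "vector_derivation X \<eta> (f * g) = f * vector_derivation X \<eta> g + g * vector_derivation X \<eta> f"
proof (induction f rule: poly_mapping_induct)
  case (single m c)
  show ?case
  proof (induction g rule: poly_mapping_induct)
    case (single n d)
    have decomp: "single k b = const_poly b * single k 1" for k and b :: 'b
      by (simp add: const_poly_def mult_single)
    define D where "D k = (\<Sum>v\<in>X. monomial_partial v k * \<eta> v)" for k
    have D: "vector_derivation X \<eta> (single k b) = const_poly b * D k" for k b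
      by (simp add: vector_derivation_def lin_ext_single D_def)
    have "D (m + n) = single m 1 * D n + single n 1 * D m"
      by (simp add: D_def monomial_partial_add distrib_right sum.distrib sum_distrib_left mult.assoc)
    then have "vector_derivation X \<eta> (single m c * single n d) =
        const_poly c * const_poly d * (single m 1 * D n + single n 1 * D m)"
      by (simp add: mult_single D const_poly_mult)
    also have "\<dots> = (const_poly c * single m 1) * (const_poly d * D n) +
        (const_poly d * single n 1) * (const_poly c * D m)"
      by (simp only: distrib_left ac_simps)
    finally show ?case by (simp only: D flip: decomp)
  qed (simp add: vector_derivation_add algebra_simps)
qed (simp add: vector_derivation_add algebra_simps)

lemma vector_derivation_var:
  assumes "finite X" "w \<in> X" shows "vector_derivation X \<eta> (var_poly w) = \<eta> w"
proof -
  have "monomial_partial v (single w 1) = (if v = w then 1 else (0 :: ('a, 'b) mvpoly))" for v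
    by (simp add: monomial_partial_def lookup_single when_def)
  then have "(\<Sum>v\<in>X. monomial_partial v (single w 1) * \<eta> v) = (\<Sum>v\<in>X. if v = w then \<eta> v else 0)"
    by (intro sum.cong) auto
  then show ?thesis using assms
    by (simp add: vector_derivation_def var_poly_def lin_ext_single)
qed

lemma vector_derivation_in_polys:
  assumes "finite X" "\<And>v. v \<in> X \<Longrightarrow> \<eta> v \<in> polys X" "f \<in> polys X"
  shows "vector_derivation X \<eta> f \<in> polys X"
  using assms(3)
proof (induction f rule: polys_induct)
  case (mult f g)
  then show ?case by (simp add: vector_derivation_mult polys_add polys_mult)
qed (use assms in \<open>auto simp: vector_derivation_add vector_derivation_var\<close>)

lemma vector_derivation_linear_form:
  assumes "finite X" shows "vector_derivation X \<eta> (linear_form X a) = form_at X a \<eta>"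
  using assms by (simp add: linear_form_def form_at_def vector_derivation_sum
      vector_derivation_const_mult vector_derivation_var)

lemma vector_derivation_mult_vec:
  "vector_derivation X (\<lambda>v. s * \<eta> v) f = s * vector_derivation X \<eta> f"
  by (simp add: vector_derivation_def lin_ext_def sum_distrib_left ac_simps)

lemma vector_derivation_add_vec:
  "vector_derivation X (\<lambda>v. \<eta> v + \<zeta> v) f = vector_derivation X \<eta> f + vector_derivation X \<zeta> f"
  by (simp add: vector_derivation_def lin_ext_def distrib_left sum.distrib)

lemma vector_derivation_cong:
  "(\<And>v. v \<in> X \<Longrightarrow> \<eta> v = \<zeta> v) \<Longrightarrow> vector_derivation X \<eta> f = vector_derivation X \<zeta> f"
  by (simp add: vector_derivation_def cong: sum.cong)

lemma derivation_eq_vector_derivation: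
  assumes "finite X" "\<theta> \<in> derivations X" "f \<in> polys X"
  shows "\<theta> f = vector_derivation X (\<lambda>v. \<theta> (var_poly v)) f"
  using assms(3)
proof (induction f rule: polys_induct)
  case (const c)
  \<comment> \<open>The Leibniz rule gives \<theta> 1 = \<theta> 1 + \<theta> 1, so constants are
    killed in every characteristic.\<close>
  have mult: "\<theta> (1 * 1) = 1 * \<theta> 1 + 1 * \<theta> 1"
    using assms(2) polys_1 unfolding derivations_def by blast
  then have "\<theta> 1 = 0" by simp
  moreover have "\<theta> (const_poly c * 1) = const_poly c * \<theta> 1"
    using assms(2) polys_1 unfolding derivations_def by blast
  ultimately show ?case by simp
next
  case (add f g)
  then have "\<theta> (f + g) = \<theta> f + \<theta> g" using assms(2) unfolding derivations_def by blast
  then show ?case using add by (simp add: vector_derivation_add)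
next
  case (mult f g)
  then have "\<theta> (f * g) = f * \<theta> g + g * \<theta> f" using assms(2) unfolding derivations_def by blast
  then show ?case using mult by (simp add: vector_derivation_mult)
qed (use assms in \<open>simp add: vector_derivation_var\<close>)

lemma vector_derivation_log_derivation:
  assumes "finite (fst A)" "\<eta> \<in> log_vectors A"
  shows "restrict (vector_derivation (fst A) \<eta>) (polys (fst A)) \<in> log_derivations A"
proof -
  let ?X = "fst A"
  have \<eta>: "\<And>v. v \<in> ?X \<Longrightarrow> \<eta> v \<in> polys ?X" using assms by (auto simp: log_vectors_def)
  have der: "restrict (vector_derivation ?X \<eta>) (polys ?X) \<in> derivations ?X"
    using vector_derivation_in_polys[OF assms(1) \<eta>]
    by (auto simp: derivations_def vector_derivation_add vector_derivation_mult
        vector_derivation_const_mult polys_add polys_mult)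
  have "\<exists>s\<in>polys ?X. form_at ?X a \<eta> = linear_form ?X a * s"
    if "H \<in> snd A" "defines_hyperplane ?X a H" for H a
  proof -
    have "linear_form ?X a dvd form_at ?X a \<eta>" using that assms by (auto simp: log_vectors_def)
    then show ?thesis using form_at_in_polys[OF \<eta>] by (elim dvd_polysE) auto
  qed
  then show ?thesis using der
    by (auto simp: log_derivations_def vector_derivation_linear_form[OF assms(1)])
qed

lemma log_derivation_vector:
  assumes "finite (fst A)" "\<theta> \<in> log_derivations A"
  shows "(\<lambda>v. \<theta> (var_poly v)) \<in> log_vectors A"
    and "\<theta> = restrict (vector_derivation (fst A) (\<lambda>v. \<theta> (var_poly v))) (polys (fst A))"
proof -
  let ?X = "fst A"
  have der: "\<theta> \<in> derivations ?X" using assms by (auto simp: log_derivations_def)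
  note eq = derivation_eq_vector_derivation[OF assms(1) der]
  have maps: "\<theta> \<in> polys ?X \<rightarrow>\<^sub>E polys ?X" using der by (auto simp: derivations_def)
  show "\<theta> = restrict (vector_derivation ?X (\<lambda>v. \<theta> (var_poly v))) (polys ?X)"
  proof
    fix f
    show "\<theta> f = restrict (vector_derivation ?X (\<lambda>v. \<theta> (var_poly v))) (polys ?X) f"
    proof (cases "f \<in> polys ?X")
      case True
      then show ?thesis using eq[OF True] by (simp only: restrict_apply')
    next
      case False
      then show ?thesis using PiE_arb[OF maps] by simp
    qed
  qed
  have "linear_form ?X a dvd form_at ?X a (\<lambda>v. \<theta> (var_poly v))"
    if H: "H \<in> snd A" "defines_hyperplane ?X a H" for H a
  proof -
    have "\<theta> (linear_form ?X a) = form_at ?X a (\<lambda>v. \<theta> (var_poly v))"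
      by (rule trans[OF eq[OF linear_form_in_polys] vector_derivation_linear_form[OF assms(1)]])
    moreover obtain s where "\<theta> (linear_form ?X a) = linear_form ?X a * s"
      using assms(2) H unfolding log_derivations_def by blast
    ultimately show ?thesis by (metis dvd_triv_left)
  qed
  then show "(\<lambda>v. \<theta> (var_poly v)) \<in> log_vectors A"
    using maps by (auto simp: log_vectors_def)
qed

lemma log_derivation_eqI:
  assumes "finite (fst A)" "\<theta> \<in> log_derivations A" "\<theta>' \<in> log_derivations A"
    and "\<And>v. v \<in> fst A \<Longrightarrow> \<theta> (var_poly v) = \<theta>' (var_poly v)"
  shows "\<theta> = \<theta>'"
proof -
  have "\<theta> = restrict (vector_derivation (fst A) (\<lambda>v. \<theta> (var_poly v))) (polys (fst A))"
    by (rule log_derivation_vector(2)[OF assms(1,2)])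
  also have "vector_derivation (fst A) (\<lambda>v. \<theta> (var_poly v)) =
      vector_derivation (fst A) (\<lambda>v. \<theta>' (var_poly v))"
    using assms(4) by (intro ext vector_derivation_cong)
  also have "restrict \<dots> (polys (fst A)) = \<theta>'"
    by (rule log_derivation_vector(2)[OF assms(1,3), symmetric])
  finally show ?thesis .
qed

lemma log_vectors_mult:
  assumes "\<eta> \<in> log_vectors A" "s \<in> polys (fst A)"
  shows "(\<lambda>v. s * \<eta> v) \<in> log_vectors A"
  using assms by (auto simp: log_vectors_def form_at_mult_vec)

lemma log_vectors_add:
  assumes "\<eta> \<in> log_vectors A" "\<zeta> \<in> log_vectors A"
  shows "(\<lambda>v. \<eta> v + \<zeta> v) \<in> log_vectors A"
  using assms by (auto simp: log_vectors_def form_at_add_vec)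

lemma log_vectors_0: "(\<lambda>v. 0) \<in> log_vectors A"
  by (auto simp: log_vectors_def form_at_def)

lemma log_vectors_sum:
  assumes "\<And>k. k \<in> I \<Longrightarrow> \<Theta> k \<in> log_vectors A" "\<And>k. k \<in> I \<Longrightarrow> s k \<in> polys (fst A)"
  shows "(\<lambda>v. \<Sum>k\<in>I. s k * \<Theta> k v) \<in> log_vectors A"
  using assms
proof (induction I rule: infinite_finite_induct)
  case (insert k I)
  have "(\<lambda>v. s k * \<Theta> k v + (\<Sum>k\<in>I. s k * \<Theta> k v)) \<in> log_vectors A"
    by (rule log_vectors_add[OF log_vectors_mult]) (use insert in auto)
  then show ?case using insert by simp
qed (auto simp: log_vectors_0)

section \<open>Homogeneous bases\<close>

text \<open>Graded freeness in terms of coefficient vectors: homogeneous members, spanning,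
  independence. The index type is left open, since coordinate arrangements are indexed by their
  coordinates and bases obtained from an isomorphism by numbers.\<close>

definition log_basis ::
    "('x, 'k::comm_ring_1) arrangement \<Rightarrow> 'i set \<Rightarrow> ('i \<Rightarrow> nat) \<Rightarrow> ('i \<Rightarrow> 'x \<Rightarrow> ('x, 'k) mvpoly) \<Rightarrow> bool" where
  "log_basis A I d \<Theta> \<longleftrightarrow> finite I \<and>
     (\<forall>k\<in>I. \<Theta> k \<in> log_vectors A \<and> (\<forall>v\<in>fst A. homogeneous (d k) (\<Theta> k v))) \<and>
     (\<forall>\<eta>\<in>log_vectors A. \<exists>s. (\<forall>k\<in>I. s k \<in> polys (fst A)) \<and> (\<forall>v\<in>fst A. \<eta> v = (\<Sum>k\<in>I. s k * \<Theta> k v))) \<and>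
     (\<forall>s. (\<forall>k\<in>I. s k \<in> polys (fst A)) \<and> (\<forall>v\<in>fst A. (\<Sum>k\<in>I. s k * \<Theta> k v) = 0) \<longrightarrow> (\<forall>k\<in>I. s k = 0))"

lemma log_basis_indep:
  assumes "log_basis A I d \<Theta>" and "\<And>k. k \<in> I \<Longrightarrow> s k \<in> polys (fst A)"
    and "\<And>v. v \<in> fst A \<Longrightarrow> (\<Sum>k\<in>I. s k * \<Theta> k v) = 0" and "k \<in> I"
  shows "s k = 0"
proof -
  have "(\<forall>k\<in>I. s k \<in> polys (fst A)) \<and> (\<forall>v\<in>fst A. (\<Sum>k\<in>I. s k * \<Theta> k v) = 0) \<longrightarrow> (\<forall>k\<in>I. s k = 0)"
    using assms(1) unfolding log_basis_def by (elim conjE) (drule spec[of _ s], assumption)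
  then show ?thesis using assms(2-) by simp
qed

lemma log_basis_span:
  assumes "log_basis A I d \<Theta>" "\<eta> \<in> log_vectors A"
  obtains s where "\<And>k. k \<in> I \<Longrightarrow> s k \<in> polys (fst A)"
    "\<And>v. v \<in> fst A \<Longrightarrow> \<eta> v = (\<Sum>k\<in>I. s k * \<Theta> k v)"
proof -
  have "\<exists>s. (\<forall>k\<in>I. s k \<in> polys (fst A)) \<and> (\<forall>v\<in>fst A. \<eta> v = (\<Sum>k\<in>I. s k * \<Theta> k v))"
    using assms unfolding log_basis_def by (elim conjE) (drule(1) bspec, assumption)
  then show ?thesis using that by auto
qed

lemma log_basis_mem:
  assumes "log_basis A I d \<Theta>" "k \<in> I"
  shows "\<Theta> k \<in> log_vectors A" "v \<in> fst A \<Longrightarrow> homogeneous (d k) (\<Theta> k v)"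
    "v \<in> fst A \<Longrightarrow> \<Theta> k v \<in> polys (fst A)"
  using assms by (auto simp: log_basis_def log_vectors_def)

lemma shifted_component_0: "shifted_component X 0 m = {f \<in> polys X. homogeneous m f}"
  by (auto simp: shifted_component_def homogeneous_def)

text \<open>The basis consists of the images of the unit vectors; spanning is surjectivity of the
  isomorphism and independence its injectivity.\<close>

lemma free_imp_log_basis:
  fixes A :: "('x, 'k::comm_ring_1) arrangement"
  assumes fin: "finite (fst A)" and free: "free_with_exponents A M"
  obtains I :: "nat set" and d \<Theta>
  where "log_basis A I d \<Theta>" "image_mset d (mset_set I) = M" "card I = card (fst A)"
proof -
  let ?X = "fst A"
  obtain ds \<phi> where ds: "mset ds = M" "length ds = card ?X" and iso: "graded_iso_log_derivations A ds \<phi>"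
    using free by (auto simp: free_with_exponents_def)
  define I where "I = {..<length ds}"
  have bij: "bij_betw \<phi> (direct_sum ?X ds) (log_derivations A)"
    and add: "\<And>F G f. F \<in> direct_sum ?X ds \<Longrightarrow> G \<in> direct_sum ?X ds \<Longrightarrow> f \<in> polys ?X \<Longrightarrow>
        \<phi> (\<lambda>i\<in>I. F i + G i) f = \<phi> F f + \<phi> G f"
    and mult: "\<And>s F f. s \<in> polys ?X \<Longrightarrow> F \<in> direct_sum ?X ds \<Longrightarrow> f \<in> polys ?X \<Longrightarrow>
        \<phi> (\<lambda>i\<in>I. s * F i) f = s * \<phi> F f"
    and deg: "\<And>m. \<phi> ` direct_sum_component ?X ds m \<subseteq> log_derivations_component A m"
    using iso by (auto simp: graded_iso_log_derivations_def Let_def I_def)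
  have ds_iff: "F \<in> direct_sum ?X ds \<longleftrightarrow> (\<forall>i\<in>I. F i \<in> polys ?X) \<and> F \<in> extensional I" for F :: "nat \<Rightarrow> ('x, 'k) mvpoly"
    by (auto simp: direct_sum_def I_def PiE_def)
  define u where "u i = (\<lambda>j\<in>I. if j = i then 1 else (0 :: ('x, 'k) mvpoly))" for i
  have u: "u i \<in> direct_sum ?X ds" for i by (auto simp: ds_iff u_def)
  define \<Theta> where "\<Theta> i v = \<phi> (u i) (var_poly v)" for i v
  have zero: "\<phi> (\<lambda>i\<in>I. 0) f = 0" if "f \<in> polys ?X" for f
    using mult[of 0 "u 0" f] u that by simp
  \<comment> \<open>Additivity is available only for two summands, so F is assembled from multiples
    of unit vectors by induction over the set J of coordinates already included.\<close>
  have expand: "\<phi> F (var_poly v) = (\<Sum>i\<in>I. F i * \<Theta> i v)" if F: "F \<in> direct_sum ?X ds" and v: "v \<in> ?X" for F v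
  proof -
    have "J \<subseteq> I \<Longrightarrow> \<phi> (\<lambda>i\<in>I. if i \<in> J then F i else 0) (var_poly v) = (\<Sum>i\<in>J. F i * \<Theta> i v)" if "finite J" for J
      using that
    proof (induction J rule: finite_induct)
      case empty
      then show ?case using zero[of "var_poly v"] v by (simp add: restrict_def)
    next
      case (insert j J)
      let ?G = "\<lambda>i\<in>I. F j * u j i" and ?R = "\<lambda>i\<in>I. if i \<in> J then F i else 0"
      have eq: "(\<lambda>i\<in>I. if i \<in> insert j J then F i else 0) = (\<lambda>i\<in>I. ?G i + ?R i)"
        using insert by (auto simp: u_def fun_eq_iff)
      have GR: "?G \<in> direct_sum ?X ds" "?R \<in> direct_sum ?X ds"
        using F u[of j] insert.prems by (auto simp: ds_iff)
      have "\<phi> ?G (var_poly v) = F j * \<Theta> j v"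
        using mult[of "F j" "u j" "var_poly v"] F v u insert.prems by (simp add: ds_iff \<Theta>_def)
      moreover have "\<phi> ?R (var_poly v) = (\<Sum>i\<in>J. F i * \<Theta> i v)" using insert by blast
      ultimately show ?case
        using add[OF GR polys_var[OF v]] insert.hyps by (simp only: eq sum.insert not_False_eq_True)
    qed
    from this[of I] have "\<phi> (\<lambda>i\<in>I. if i \<in> I then F i else 0) (var_poly v) = (\<Sum>i\<in>I. F i * \<Theta> i v)"
      by (simp add: I_def)
    moreover have "(\<lambda>i\<in>I. if i \<in> I then F i else 0) = F"
      using F by (auto simp: ds_iff fun_eq_iff extensional_def)
    ultimately show ?thesis by simp
  qed
  have "log_basis A I ((!) ds) \<Theta>"
    unfolding log_basis_def
  proof (intro conjI ballI allI impI; (elim conjE)?)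
    show "finite I" by (simp add: I_def)
  next
    fix k assume k: "k \<in> I"
    \<comment> \<open>The constant 1 has degree \<open>ds ! k\<close> in the shifted summand, which
      becomes the degree of the basis element.\<close>
    have "u k \<in> direct_sum_component ?X ds (ds ! k)"
      using k by (auto simp: direct_sum_component_def u_def I_def shifted_component_def)
    then have comp: "\<phi> (u k) \<in> log_derivations_component A (ds ! k)" using deg by blast
    then show "\<Theta> k \<in> log_vectors A"
      using log_derivation_vector(1)[OF fin, of "\<phi> (u k)"]
      by (simp add: log_derivations_component_def \<Theta>_def[abs_def])
    fix v assume "v \<in> ?X"
    then show "homogeneous (ds ! k) (\<Theta> k v)"
      using comp by (auto simp: log_derivations_component_def shifted_component_0 \<Theta>_def)
  next
    fix \<eta> assume \<eta>: "\<eta> \<in> log_vectors A"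
    let ?\<theta> = "restrict (vector_derivation ?X \<eta>) (polys ?X)"
    have "?\<theta> \<in> log_derivations A" using vector_derivation_log_derivation[OF fin \<eta>] .
    then have "?\<theta> \<in> \<phi> ` direct_sum ?X ds" using bij_betw_imp_surj_on[OF bij] by blast
    then obtain F where F: "F \<in> direct_sum ?X ds" "\<phi> F = ?\<theta>" by (elim imageE) (rule that, auto)
    have "\<eta> v = (\<Sum>i\<in>I. F i * \<Theta> i v)" if "v \<in> ?X" for v
      using expand[OF F(1) that] F(2) vector_derivation_var[OF fin that, of \<eta>] that by simp
    then show "\<exists>s. (\<forall>k\<in>I. s k \<in> polys ?X) \<and> (\<forall>v\<in>?X. \<eta> v = (\<Sum>k\<in>I. s k * \<Theta> k v))"
      using F(1) ds_iff by blast
  next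
    fix s k assume s: "\<forall>k\<in>I. s k \<in> polys ?X" "\<forall>v\<in>?X. (\<Sum>k\<in>I. s k * \<Theta> k v) = 0" and k: "k \<in> I"
    let ?F = "restrict s I" and ?Z = "\<lambda>i\<in>I. 0 :: ('x, 'k) mvpoly"
    have F: "?F \<in> direct_sum ?X ds" "?Z \<in> direct_sum ?X ds" using s by (auto simp: ds_iff)
    then have log: "\<phi> ?F \<in> log_derivations A" "\<phi> ?Z \<in> log_derivations A" using bij by (auto simp: bij_betw_def)
    have "\<phi> ?F (var_poly v) = \<phi> ?Z (var_poly v)" if "v \<in> ?X" for v
      using expand[OF F(1) that] expand[OF F(2) that] s(2) that by simp
    then have "\<phi> ?F = \<phi> ?Z" by (rule log_derivation_eqI[OF fin log])
    then have "?F = ?Z" using bij F by (auto simp: bij_betw_def inj_on_def)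
    then show "s k = 0" using k by (metis restrict_apply')
  qed
  moreover have "image_mset ((!) ds) (mset_set I) = mset ds"
    by (metis I_def lessThan_atLeast0 map_nth mset_map mset_upt)
  ultimately show ?thesis using that ds by (simp add: I_def)
qed

lemma log_basis_imp_free:
  fixes A :: "('x, 'k::comm_ring_1) arrangement"
  assumes fin: "finite (fst A)" and basis: "log_basis A I d \<Theta>" and card: "card I = card (fst A)"
  shows "free_with_exponents A (image_mset d (mset_set I))"
proof -
  let ?X = "fst A"
  have finI: "finite I" using basis by (auto simp: log_basis_def)
  \<comment> \<open>The graded isomorphism works with a list of degrees, so the index set is
    enumerated.\<close>
  obtain h where h: "bij_betw h {..<card I} I"
    using ex_bij_betw_nat_finite[OF finI] by (auto simp: lessThan_atLeast0)
  define ds where "ds = map (d \<circ> h) [0..<card I]"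
  define J where "J = {..<length ds}"
  have J: "J = {..<card I}" by (simp add: J_def ds_def)
  have dsnth: "ds ! i = d (h i)" if "i \<in> J" for i using that by (simp add: ds_def J)
  have mset: "mset ds = image_mset d (mset_set I)"
  proof -
    have "image_mset h (mset_set {0..<card I}) = mset_set I"
      using h image_mset_mset_set[of h "{0..<card I}"] by (simp add: bij_betw_def lessThan_atLeast0)
    moreover have "mset ds = image_mset d (image_mset h (mset_set {0..<card I}))"
      by (simp add: ds_def multiset.map_comp)
    ultimately show ?thesis by simp
  qed
  define \<zeta> where "\<zeta> F v = (\<Sum>i\<in>J. F i * \<Theta> (h i) v)" for F v
  define \<phi> where "\<phi> F = restrict (vector_derivation ?X (\<zeta> F)) (polys ?X)" for F
  have ds_iff: "F \<in> direct_sum ?X ds \<longleftrightarrow> (\<forall>i\<in>J. F i \<in> polys ?X) \<and> F \<in> extensional J" for F :: "nat \<Rightarrow> ('x, 'k) mvpoly"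
    by (auto simp: direct_sum_def J_def PiE_def)
  have hJ: "h i \<in> I" if "i \<in> J" for i using h that J by (auto simp: bij_betw_def)
  have \<Theta>: "\<Theta> k \<in> log_vectors A" "v \<in> ?X \<Longrightarrow> homogeneous (d k) (\<Theta> k v)" if "k \<in> I" for k v
    using basis that by (auto simp: log_basis_def)
  have \<zeta>: "\<zeta> F \<in> log_vectors A" if "F \<in> direct_sum ?X ds" for F
    unfolding \<zeta>_def[abs_def] using that by (intro log_vectors_sum \<Theta> hJ) (auto simp: ds_iff)
  have \<phi>_var: "\<phi> F (var_poly v) = \<zeta> F v" if "v \<in> ?X" for F v
    using that fin by (simp add: \<phi>_def vector_derivation_var)
  have reindex: "(\<Sum>k\<in>I. s k * \<Theta> k v) = (\<Sum>i\<in>J. s (h i) * \<Theta> (h i) v)" for s v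
    using sum.reindex_bij_betw[OF h, of "\<lambda>k. s k * \<Theta> k v"] by (simp add: J)
  have "bij_betw \<phi> (direct_sum ?X ds) (log_derivations A)"
    unfolding bij_betw_def
  proof
    show "inj_on \<phi> (direct_sum ?X ds)"
    proof
      fix F G assume FG: "F \<in> direct_sum ?X ds" "G \<in> direct_sum ?X ds" "\<phi> F = \<phi> G"
      let ?g = "the_inv_into {..<card I} h"
      \<comment> \<open>The difference of F and G, transported back to the index set of the basis,
        is a relation there.\<close>
      let ?s = "\<lambda>k. F (?g k) - G (?g k)"
      have g: "?g (h i) = i" if "i \<in> J" for i
        using h that J by (simp add: bij_betw_def the_inv_into_f_f)
      have gI: "?g k \<in> J" if "k \<in> I" for k
        using bij_betw_the_inv_into[OF h] that J by (auto simp: bij_betw_def)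
      have sum0: "(\<Sum>k\<in>I. ?s k * \<Theta> k v) = 0" if "v \<in> ?X" for v
      proof -
        have "(\<Sum>k\<in>I. ?s k * \<Theta> k v) = (\<Sum>i\<in>J. (F i - G i) * \<Theta> (h i) v)"
          unfolding reindex by (rule sum.cong) (auto simp: g)
        also have "\<dots> = \<zeta> F v - \<zeta> G v" by (simp add: \<zeta>_def left_diff_distrib sum_subtractf)
        also have "\<dots> = 0" using FG(3) \<phi>_var[OF that, of F] \<phi>_var[OF that, of G] by simp
        finally show ?thesis .
      qed
      have polys_s: "?s k \<in> polys ?X" if "k \<in> I" for k
        using FG gI[OF that] by (auto simp: ds_iff)
      have s: "?s k = 0" if "k \<in> I" for k
        by (rule log_basis_indep[OF basis polys_s sum0 that])
      show "F = G"
      proof (rule extensionalityI[of _ J])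
        show "F \<in> extensional J" "G \<in> extensional J" using FG by (auto simp: ds_iff)
        fix i assume "i \<in> J"
        then show "F i = G i" using s[of "h i"] hJ g by simp
      qed
    qed
    show "\<phi> ` direct_sum ?X ds = log_derivations A"
    proof (intro equalityI subsetI)
      fix \<theta> assume "\<theta> \<in> \<phi> ` direct_sum ?X ds"
      then show "\<theta> \<in> log_derivations A"
        using vector_derivation_log_derivation[OF fin \<zeta>] by (auto simp: \<phi>_def)
    next
      fix \<theta> assume \<theta>: "\<theta> \<in> log_derivations A"
      note vec = log_derivation_vector[OF fin \<theta>]
      obtain s where s: "\<And>k. k \<in> I \<Longrightarrow> s k \<in> polys ?X"
          "\<And>v. v \<in> ?X \<Longrightarrow> \<theta> (var_poly v) = (\<Sum>k\<in>I. s k * \<Theta> k v)"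
        using log_basis_span[OF basis vec(1)] by metis
      let ?F = "\<lambda>i\<in>J. s (h i)"
      have F: "?F \<in> direct_sum ?X ds" using s hJ by (auto simp: ds_iff)
      have "\<theta> (var_poly v) = \<zeta> ?F v" if "v \<in> ?X" for v
        using s(2)[OF that] by (simp add: reindex \<zeta>_def)
      then have "\<theta> = \<phi> ?F"
        using vector_derivation_log_derivation[OF fin \<zeta>[OF F]] \<phi>_var[of _ ?F]
        by (intro log_derivation_eqI[OF fin \<theta>]) (simp_all add: \<phi>_def)
      then show "\<theta> \<in> \<phi> ` direct_sum ?X ds" using F by blast
    qed
  qed
  moreover have "\<phi> (\<lambda>i\<in>J. F i + G i) f = \<phi> F f + \<phi> G f" if "f \<in> polys ?X" for F G f
  proof -
    have "\<zeta> (\<lambda>i\<in>J. F i + G i) = (\<lambda>v. \<zeta> F v + \<zeta> G v)"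
      by (simp add: \<zeta>_def fun_eq_iff distrib_right sum.distrib)
    then show ?thesis using that by (simp add: \<phi>_def vector_derivation_add_vec)
  qed
  moreover have "\<phi> (\<lambda>i\<in>J. s * F i) f = s * \<phi> F f" if "f \<in> polys ?X" for s F f
  proof -
    have "\<zeta> (\<lambda>i\<in>J. s * F i) = (\<lambda>v. s * \<zeta> F v)"
      by (simp add: \<zeta>_def fun_eq_iff sum_distrib_left mult.assoc)
    then show ?thesis using that by (simp add: \<phi>_def vector_derivation_mult_vec)
  qed
  moreover have "\<phi> ` direct_sum_component ?X ds m \<subseteq> log_derivations_component A m" for m
  proof
    fix \<theta> assume "\<theta> \<in> \<phi> ` direct_sum_component ?X ds m"
    then obtain F where F: "\<theta> = \<phi> F" "F \<in> direct_sum_component ?X ds m" by auto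
    have comp: "F i \<in> shifted_component ?X (ds ! i) m" if "i \<in> J" for i
      using F that by (auto simp: direct_sum_component_def J_def)
    have ds: "F \<in> direct_sum ?X ds"
      using F comp by (auto simp: ds_iff direct_sum_component_def J_def shifted_component_def PiE_def)
    have "homogeneous m (F i * \<Theta> (h i) v)" if "i \<in> J" "v \<in> ?X" for i v
    \<comment> \<open>A monomial of a nonzero F i witnesses \<open>d (h i)\<close> \<le> m, without
      which the truncated difference of degrees would be wrong.\<close>
    proof (cases "F i = 0")
      case False
      then obtain t where "t \<in> keys (F i)" by (metis ex_in_conv keys_eq_empty)
      then have "d (h i) \<le> m" "homogeneous (m - d (h i)) (F i)"
        using comp[OF that(1)] dsnth[OF that(1)] by (auto simp: shifted_component_def homogeneous_def)
      then show ?thesis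
        using homogeneous_mult[of "m - d (h i)" "F i" "d (h i)" "\<Theta> (h i) v"] \<Theta>(2) hJ that by simp
    qed simp
    then have hom: "homogeneous m (\<zeta> F v)" if "v \<in> ?X" for v using that by (auto simp: \<zeta>_def)
    have "\<phi> F \<in> log_derivations A"
      using vector_derivation_log_derivation[OF fin \<zeta>[OF ds]] by (simp add: \<phi>_def)
    then show "\<theta> \<in> log_derivations_component A m"
      using hom \<phi>_var F(1) \<zeta>[OF ds] by (auto simp: log_derivations_component_def shifted_component_0 log_vectors_def)
  qed
  ultimately have "graded_iso_log_derivations A ds \<phi>"
    unfolding graded_iso_log_derivations_def Let_def J_def by blast
  moreover have "length ds = card ?X" using card by (simp add: ds_def)
  ultimately show ?thesis using mset by (auto simp: free_with_exponents_def)
qed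

text \<open>Fraction-free Gaussian elimination: more rows than columns over a domain are dependent.
  The subring S is explicit so that the relation found has coefficients in
  \<open>polys X\<close>.\<close>

lemma ex_linear_dependence:
  fixes S :: "'r::idom set" and s :: "'i \<Rightarrow> 'j \<Rightarrow> 'r"
  assumes S: "0 \<in> S" "1 \<in> S" "\<And>a b. a \<in> S \<Longrightarrow> b \<in> S \<Longrightarrow> a + b \<in> S"
      "\<And>a b. a \<in> S \<Longrightarrow> b \<in> S \<Longrightarrow> a - b \<in> S" "\<And>a b. a \<in> S \<Longrightarrow> b \<in> S \<Longrightarrow> a * b \<in> S"
    and "finite J" "finite I" "card J < card I" "\<And>i j. i \<in> I \<Longrightarrow> j \<in> J \<Longrightarrow> s i j \<in> S"
  shows "\<exists>r. (\<forall>i\<in>I. r i \<in> S) \<and> (\<exists>i\<in>I. r i \<noteq> 0) \<and> (\<forall>j\<in>J. (\<Sum>i\<in>I. r i * s i j) = 0)"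
  using assms(6-)
proof (induction J arbitrary: I s rule: finite_induct)
  case empty
  then obtain i where "i \<in> I" by fastforce
  then show ?case using S by (intro exI[of _ "\<lambda>_. 1"]) auto
next
  case (insert j J)
  show ?case
  proof (cases "\<forall>i\<in>I. s i j = 0")
    case True
    have "\<exists>r. (\<forall>i\<in>I. r i \<in> S) \<and> (\<exists>i\<in>I. r i \<noteq> 0) \<and> (\<forall>j\<in>J. (\<Sum>i\<in>I. r i * s i j) = 0)"
      using insert by (intro insert.IH) auto
    then obtain r where "\<forall>i\<in>I. r i \<in> S" "\<exists>i\<in>I. r i \<noteq> 0" "\<forall>j\<in>J. (\<Sum>i\<in>I. r i * s i j) = 0"
      by blast
    then show ?thesis using True by (intro exI[of _ r]) simp
  next
    case False
    then obtain i0 where i0: "i0 \<in> I" "s i0 j \<noteq> 0" by auto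
    let ?I = "I - {i0}"
    \<comment> \<open>Rows with column j cleared by cross-multiplication with the pivot row
      i0.\<close>
    let ?s = "\<lambda>i l. s i0 j * s i l - s i j * s i0 l"
    have "\<exists>r. (\<forall>i\<in>?I. r i \<in> S) \<and> (\<exists>i\<in>?I. r i \<noteq> 0) \<and> (\<forall>l\<in>J. (\<Sum>i\<in>?I. r i * ?s i l) = 0)"
      using insert i0 by (intro insert.IH) (auto intro!: S)
    then obtain r where r: "\<forall>i\<in>?I. r i \<in> S" "\<exists>i\<in>?I. r i \<noteq> 0" "\<forall>l\<in>J. (\<Sum>i\<in>?I. r i * ?s i l) = 0"
      by blast
    have sumS: "(\<Sum>i\<in>A. f i) \<in> S" if "\<And>i. i \<in> A \<Longrightarrow> f i \<in> S" for A :: "'i set" and f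
      using that by (induction A rule: infinite_finite_induct) (auto intro: S)
    \<comment> \<open>The relation between the cleared rows, rewritten for the original ones: every
      weight is multiplied by the nonzero pivot, and row i0 collects the subtracted
      multiples.\<close>
    define r' where "r' i = (if i = i0 then 0 - (\<Sum>i\<in>?I. r i * s i j) else r i * s i0 j)" for i
    have sum: "(\<Sum>i\<in>I. r' i * s i l) = (\<Sum>i\<in>?I. r i * ?s i l)" for l
    proof -
      have "(\<Sum>i\<in>I. r' i * s i l) = r' i0 * s i0 l + (\<Sum>i\<in>?I. r' i * s i l)"
        using insert.prems i0 by (intro sum.remove) auto
      also have "(\<Sum>i\<in>?I. r' i * s i l) = (\<Sum>i\<in>?I. r i * s i0 j * s i l)"
        by (rule sum.cong) (auto simp: r'_def)
      also have "r' i0 * s i0 l = - (\<Sum>i\<in>?I. r i * s i j * s i0 l)"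
        by (simp add: r'_def sum_distrib_right)
      finally show ?thesis by (simp add: sum_subtractf right_diff_distrib mult.assoc)
    qed
    have "(\<Sum>i\<in>?I. r i * ?s i j) = 0" by (simp add: mult.commute)
    then have "\<forall>l\<in>insert j J. (\<Sum>i\<in>I. r' i * s i l) = 0" using r(3) by (simp add: sum)
    moreover have "\<exists>i\<in>I. r' i \<noteq> 0" using r(2) i0 by (auto simp: r'_def)
    moreover have "0 - (\<Sum>i\<in>?I. r i * s i j) \<in> S"
      using r(1) insert.prems by (intro S(4)[OF S(1)] sumS S(5)) auto
    then have "\<forall>i\<in>I. r' i \<in> S"
      using r(1) i0 insert.prems by (auto simp: r'_def intro!: S(5))
    ultimately show ?thesis by blast
  qed
qed

text \<open>Only basis elements of degree at most \<open>n\<close> contribute to homogeneous vectors of degree at most \<open>n\<close>.\<close>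

lemma log_basis_card_bound:
  fixes A :: "('x::linorder, 'k::field) arrangement"
  assumes basis: "log_basis A J e \<Phi>" and "finite K"
    and \<Psi>: "\<And>k. k \<in> K \<Longrightarrow> \<Psi> k \<in> log_vectors A"
    and hom: "\<And>k v. k \<in> K \<Longrightarrow> v \<in> fst A \<Longrightarrow> homogeneous (d k) (\<Psi> k v)"
    and le: "\<And>k. k \<in> K \<Longrightarrow> d k \<le> n"
    and indep: "\<And>s. (\<And>k. k \<in> K \<Longrightarrow> s k \<in> polys (fst A)) \<Longrightarrow>
        (\<And>v. v \<in> fst A \<Longrightarrow> (\<Sum>k\<in>K. s k * \<Psi> k v) = 0) \<Longrightarrow> (\<And>k. k \<in> K \<Longrightarrow> s k = 0)"
  shows "card K \<le> card {j \<in> J. e j \<le> n}"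
proof (rule ccontr)
  let ?X = "fst A" and ?J = "{j \<in> J. e j \<le> n}"
  assume "\<not> card K \<le> card ?J"
  then have less: "card ?J < card K" by simp
  have finJ: "finite J" and \<Phi>: "\<And>j v. j \<in> J \<Longrightarrow> v \<in> ?X \<Longrightarrow> homogeneous (e j) (\<Phi> j v)"
    using basis by (auto simp: log_basis_def)
  have "\<exists>s. \<forall>k\<in>K. (\<forall>j\<in>J. s k j \<in> polys ?X) \<and> (\<forall>v\<in>?X. \<Psi> k v = (\<Sum>j\<in>J. s k j * \<Phi> j v))"
    using basis \<Psi> unfolding log_basis_def by (intro bchoice) blast
  then obtain s where s: "\<And>k j. k \<in> K \<Longrightarrow> j \<in> J \<Longrightarrow> s k j \<in> polys ?X"
    "\<And>k v. k \<in> K \<Longrightarrow> v \<in> ?X \<Longrightarrow> \<Psi> k v = (\<Sum>j\<in>J. s k j * \<Phi> j v)" by blast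
  \<comment> \<open>Only the part of the coefficients in degree d k - e j matters, since both sides
    are homogeneous. It is 0 when e j > d k, which discards the basis elements of degree above
    n.\<close>
  define s' where "s' k j = (if e j \<le> d k then hom_comp (d k - e j) (s k j) else 0)" for k j
  have expand: "\<Psi> k v = (\<Sum>j\<in>?J. s' k j * \<Phi> j v)" if k: "k \<in> K" and v: "v \<in> ?X" for k v
  proof -
    have "\<Psi> k v = hom_comp (d k) (\<Psi> k v)" using hom[OF k v] by (simp add: hom_comp_homogeneous)
    also have "\<dots> = (\<Sum>j\<in>J. hom_comp (d k) (s k j * \<Phi> j v))" using s(2)[OF k v] by (simp add: hom_comp_sum)
    also have "\<dots> = (\<Sum>j\<in>J. s' k j * \<Phi> j v)"
      using hom_comp_mult[OF \<Phi>[OF _ v]] by (intro sum.cong) (simp_all add: s'_def)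
    also have "\<dots> = (\<Sum>j\<in>?J. s' k j * \<Phi> j v)"
      using finJ le[OF k] by (intro sum.mono_neutral_right) (auto simp: s'_def)
    finally show ?thesis .
  qed
  \<comment> \<open>The coefficient matrix has more rows than columns, and a relation between its
    rows is one between the vectors.\<close>
  have "\<exists>r. (\<forall>k\<in>K. r k \<in> polys ?X) \<and> (\<exists>k\<in>K. r k \<noteq> 0) \<and> (\<forall>j\<in>?J. (\<Sum>k\<in>K. r k * s' k j) = 0)"
    using finJ \<open>finite K\<close> less s(1) by (intro ex_linear_dependence) (auto simp: s'_def)
  then obtain r where r: "\<And>k. k \<in> K \<Longrightarrow> r k \<in> polys ?X" "\<exists>k\<in>K. r k \<noteq> 0"
    "\<And>j. j \<in> ?J \<Longrightarrow> (\<Sum>k\<in>K. r k * s' k j) = 0" by blast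
  have "(\<Sum>k\<in>K. r k * \<Psi> k v) = 0" if v: "v \<in> ?X" for v
  proof -
    have "(\<Sum>k\<in>K. r k * \<Psi> k v) = (\<Sum>k\<in>K. \<Sum>j\<in>?J. r k * s' k j * \<Phi> j v)"
      using expand v by (intro sum.cong) (auto simp: sum_distrib_left mult.assoc)
    also have "\<dots> = (\<Sum>j\<in>?J. (\<Sum>k\<in>K. r k * s' k j) * \<Phi> j v)"
      by (subst sum.swap) (simp add: sum_distrib_right)
    finally show ?thesis using r(3) by simp
  qed
  then show False using indep[of r] r by blast
qed

text \<open>The elements of degree at most n of one basis are independent homogeneous vectors, whose
  number the other basis bounds. Used in both directions, this makes the cumulative degree counts
  invariants of the module.\<close>

lemma log_basis_card_le:
  fixes A :: "('x::linorder, 'k::field) arrangement"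
  assumes "log_basis A I d \<Theta>" "log_basis A J e \<Phi>"
  shows "card {i \<in> I. d i \<le> n} \<le> card {j \<in> J. e j \<le> n}"
proof (rule log_basis_card_bound[OF assms(2), where \<Psi> = \<Theta> and d = d])
  fix s k assume s: "\<And>k. k \<in> {i \<in> I. d i \<le> n} \<Longrightarrow> s k \<in> polys (fst A)"
    "\<And>v. v \<in> fst A \<Longrightarrow> (\<Sum>k\<in>{i \<in> I. d i \<le> n}. s k * \<Theta> k v) = 0" and k: "k \<in> {i \<in> I. d i \<le> n}"
  \<comment> \<open>A relation on part of the basis becomes one on all of it by extension with
    0.\<close>
  define s' where "s' k = (if d k \<le> n then s k else 0)" for k
  have finI: "finite I" using assms by (simp add: log_basis_def)
  have "(\<Sum>k\<in>I. s' k * \<Theta> k v) = (\<Sum>k\<in>{i \<in> I. d i \<le> n}. s k * \<Theta> k v)" for v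
    using finI by (intro sum.mono_neutral_cong_right) (auto simp: s'_def)
  then have sum0: "(\<Sum>k\<in>I. s' k * \<Theta> k v) = 0" if "v \<in> fst A" for v using s(2) that by simp
  have poly: "s' k \<in> polys (fst A)" if "k \<in> I" for k using s(1) that by (simp add: s'_def)
  have "s' k = 0"
    by (rule log_basis_indep[OF assms(1), of s' k]) (use poly sum0 k in simp_all)
  then show "s k = 0" using k by (simp add: s'_def)
qed (use assms in \<open>auto simp: log_basis_def\<close>)

text \<open>Multiplicities are differences of consecutive cumulative counts.\<close>

lemma mset_eq_if_size_le_eq:
  assumes "\<And>n. size {#x \<in># M. x \<le> n#} = size {#x \<in># N. x \<le> (n::nat)#}"
  shows "M = N"
proof (rule multiset_eqI)
  fix n
  have split: "size {#x \<in># L. x \<le> Suc m#} = size {#x \<in># L. x \<le> m#} + count L (Suc m)" for L :: "nat multiset" and m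
    by (induction L) (auto simp: le_Suc_eq)
  have zero: "size {#x \<in># L. x \<le> 0#} = count L 0" for L :: "nat multiset"
    by (induction L) auto
  show "count M n = count N n"
  proof (cases n)
    case 0
    then show ?thesis using assms[of 0] by (simp only: zero)
  next
    case (Suc m)
    then show ?thesis using assms[of m] assms[of "Suc m"] by (simp only: split)
  qed
qed

lemma size_filter_image_mset_set:
  "finite I \<Longrightarrow> size {#x \<in># image_mset d (mset_set I). P x#} = card {i \<in> I. P (d i)}"
  by (simp add: filter_mset_image_mset)

theorem free_exponents_unique:
  fixes A :: "('x::linorder, 'k::field) arrangement"
  assumes "finite (fst A)" "free_with_exponents A M" "free_with_exponents A N"
  shows "M = N"
proof -
  obtain I :: "nat set" and d \<Theta> where I: "log_basis A I d \<Theta>" "image_mset d (mset_set I) = M"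
    using free_imp_log_basis[OF assms(1,2)] by metis
  obtain J :: "nat set" and e \<Phi> where J: "log_basis A J e \<Phi>" "image_mset e (mset_set J) = N"
    using free_imp_log_basis[OF assms(1,3)] by metis
  have "card {i \<in> I. d i \<le> n} = card {j \<in> J. e j \<le> n}" for n
    using log_basis_card_le[OF I(1) J(1)] log_basis_card_le[OF J(1) I(1)] by (rule antisym)
  moreover have "finite I" "finite J" using I J by (auto simp: log_basis_def)
  ultimately show ?thesis
    using I(2) J(2) size_filter_image_mset_set[of I _ d] size_filter_image_mset_set[of J _ e]
    by (intro mset_eq_if_size_le_eq) auto
qed

section \<open>The addition theorem\<close>

text \<open>Euclid's lemma for prime powers: one factor p at a time passes to f and is
  cancelled.\<close>

lemma prime_elem_power_dvd_mult:
  fixes p :: "'a::idom"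
  assumes "prime_elem p" "\<not> p dvd a"
  shows "p ^ n dvd a * f \<Longrightarrow> p ^ n dvd f"
proof (induction n arbitrary: f)
  case (Suc n)
  then have "p dvd a * f" by (metis dvd_mult_left power_Suc)
  then obtain g where g: "f = p * g"
    using assms by (auto simp: prime_elem_dvd_mult_iff)
  have "p * p ^ n dvd p * (a * g)" using Suc.prems by (simp add: g ac_simps)
  then have "p ^ n dvd a * g" using assms by (simp add: dvd_mult_cancel_left)
  then show ?case using Suc.IH[of g] by (simp add: g mult_dvd_mono)
qed simp

text \<open>Used twice: for the forms in a single fibre of the restriction, and for the forms of the
  distinct restricted hyperplanes that make up B.\<close>

lemma prod_prime_powers_dvd:
  fixes p :: "'k \<Rightarrow> 'a::idom"
  assumes "finite K" "\<And>k. k \<in> K \<Longrightarrow> prime_elem (p k)"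
    "\<And>k l. k \<in> K \<Longrightarrow> l \<in> K \<Longrightarrow> k \<noteq> l \<Longrightarrow> \<not> p k dvd p l"
    "\<And>k. k \<in> K \<Longrightarrow> p k ^ e k dvd f"
  shows "(\<Prod>k\<in>K. p k ^ e k) dvd f"
  using assms
proof (induction K arbitrary: f rule: finite_induct)
  case (insert k K)
  obtain g where g: "f = p k ^ e k * g" using insert.prems(3)[of k] by auto
  have "p l ^ e l dvd g" if "l \<in> K" for l
  proof (rule prime_elem_power_dvd_mult)
    show "prime_elem (p l)" using insert that by auto
    have "\<not> p l dvd p k" using insert that by auto
    then show "\<not> p l dvd p k ^ e k"
      using \<open>prime_elem (p l)\<close> by (metis prime_elem_dvd_power)
    show "p l ^ e l dvd p k ^ e k * g" using insert.prems(3)[of l] that g by simp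
  qed
  then have "(\<Prod>k\<in>K. p k ^ e k) dvd g"
    using insert.prems(1,2) by (intro insert.IH) auto
  then show ?case using insert.hyps g by (simp add: mult_dvd_mono)
qed simp

text \<open>When the form of H0 has a nonzero coefficient at i, forgetting that coordinate
  identifies H0 with the space on X - {i}; the intersection with H is recorded there.\<close>

definition restrict_hyperplane :: "'x set \<Rightarrow> 'x \<Rightarrow> ('x \<Rightarrow> 'k) set \<Rightarrow> ('x \<Rightarrow> 'k) set \<Rightarrow> ('x \<Rightarrow> 'k) set" where
  "restrict_hyperplane X i H0 H = (\<lambda>x. restrict x (X - {i})) ` (H \<inter> H0)"

section \<open>The triple of deletion HS, added hyperplane H0 and restriction of HS to H0\<close>

context
  fixes X :: "'x::linorder set" and a :: "'x \<Rightarrow> 'k::field" and i :: 'x and H0 :: "('x \<Rightarrow> 'k) set"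
    and HS :: "('x \<Rightarrow> 'k) set set"
  assumes finX: "finite X" and i: "i \<in> X" and ai: "a i \<noteq> 0" and H0: "defines_hyperplane X a H0"
    and finHS: "finite HS" and hyp: "\<And>H. H \<in> HS \<Longrightarrow> is_hyperplane X H" and new: "H0 \<notin> HS"
begin

private abbreviation "X' \<equiv> X - {i}"
private abbreviation "\<rho> \<equiv> restrict_hyperplane X i H0"
private abbreviation "res \<equiv> form_restrict a i"
private abbreviation "\<sigma> \<equiv> poly_subst (solve_subst X a i)"
private abbreviation "\<alpha> \<equiv> linear_form X a"

private definition \<gamma> :: "('x \<Rightarrow> 'k) set \<Rightarrow> 'x \<Rightarrow> 'k" where
  "\<gamma> H = (SOME c. defines_hyperplane X c H \<and> (\<exists>v\<in>X. c v \<noteq> 0))"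
text \<open>The form of K is induced by one chosen member of its fibre, so that divisibility
  statements about that member can be transported directly.\<close>

private definition \<beta> :: "('x \<Rightarrow> 'k) set \<Rightarrow> 'x \<Rightarrow> 'k" where
  "\<beta> K = res (\<gamma> (inv_into HS \<rho> K))"
private definition fib :: "('x \<Rightarrow> 'k) set \<Rightarrow> nat" where
  "fib K = card {H \<in> HS. \<rho> H = K}"
text \<open>Terao's polynomial modulo \<alpha>: the forms in a fibre become proportional on H0, and
  all but one of them are multiplied. The degree is therefore the number of hyperplanes lost by
  restriction.\<close>

private definition B :: "('x, 'k) mvpoly" where
  "B = (\<Prod>K\<in>\<rho> ` HS. linear_form X' (\<beta> K) ^ (fib K - 1))"

private lemma \<gamma>: assumes "H \<in> HS" shows "defines_hyperplane X (\<gamma> H) H" "\<exists>v\<in>X. \<gamma> H v \<noteq> 0"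
proof -
  have "defines_hyperplane X (\<gamma> H) H \<and> (\<exists>v\<in>X. \<gamma> H v \<noteq> 0)"
    unfolding \<gamma>_def using hyp[OF assms] unfolding is_hyperplane_def by (rule someI_ex)
  then show "defines_hyperplane X (\<gamma> H) H" "\<exists>v\<in>X. \<gamma> H v \<noteq> 0" by auto
qed

private lemma prime_\<gamma>: "H \<in> HS \<Longrightarrow> prime_elem (linear_form X (\<gamma> H))"
  using prime_elem_linear_form[OF finX] \<gamma>(2) by blast

private lemma not_dvd_\<gamma>:
  assumes "H \<in> HS" shows "\<not> \<alpha> dvd linear_form X (\<gamma> H)" "\<not> linear_form X (\<gamma> H) dvd \<alpha>"
proof -
  have a: "\<exists>v\<in>X. a v \<noteq> 0" using i ai by blast
  have ne: "H \<noteq> H0" using assms new by blast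
  show "\<not> \<alpha> dvd linear_form X (\<gamma> H)"
    by (rule not_dvd_linear_form[OF finX a \<gamma>(2)[OF assms] H0 \<gamma>(1)[OF assms] ne[symmetric]])
  show "\<not> linear_form X (\<gamma> H) dvd \<alpha>"
    by (rule not_dvd_linear_form[OF finX \<gamma>(2)[OF assms] a \<gamma>(1)[OF assms] H0 ne])
qed

text \<open>On points of H0 the correction term is 0, so the restricted form takes there the same
  values as c.\<close>

private lemma sum_res:
  "(\<Sum>v\<in>X'. res c v * x v) = (\<Sum>v\<in>X. c v * x v) - c i / a i * (\<Sum>v\<in>X. a v * (x v :: 'k))"
proof -
  have "(\<Sum>v\<in>X'. res c v * x v) = (\<Sum>v\<in>X. res c v * x v)"
    using finX i ai by (simp add: sum.remove form_restrict_def)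
  also have "\<dots> = (\<Sum>v\<in>X. c v * x v - c i / a i * (a v * x v))"
    by (rule sum.cong) (auto simp: form_restrict_def left_diff_distrib)
  finally show ?thesis by (simp add: sum_subtractf sum_distrib_left)
qed

private lemma res_\<gamma>:
  assumes "H \<in> HS"
  shows "defines_hyperplane X' (res (\<gamma> H)) (\<rho> H)" "\<exists>v\<in>X'. res (\<gamma> H) v \<noteq> 0"
proof -
  define c where "c = \<gamma> H"
  have H: "H = {x \<in> points X. (\<Sum>v\<in>X. c v * x v) = 0}"
    using \<gamma>(1)[OF assms] by (simp add: defines_hyperplane_def c_def)
  have H0': "H0 = {x \<in> points X. (\<Sum>v\<in>X. a v * x v) = 0}"
    using H0 by (simp add: defines_hyperplane_def)
  have "\<rho> H = {x \<in> points X'. (\<Sum>v\<in>X'. res c v * x v) = 0}"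
  proof (intro equalityI subsetI)
    fix y assume "y \<in> \<rho> H"
    then obtain x where x: "x \<in> H" "x \<in> H0" "y = restrict x X'"
      by (auto simp: restrict_hyperplane_def)
    have "(\<Sum>v\<in>X'. res c v * y v) = (\<Sum>v\<in>X'. res c v * x v)"
      by (rule sum.cong) (auto simp: x(3))
    also have "\<dots> = 0" using x(1,2) unfolding sum_res H H0' by simp
    finally show "y \<in> {x \<in> points X'. (\<Sum>v\<in>X'. res c v * x v) = 0}"
      by (simp add: x(3) points_def)
  next
    fix y assume y: "y \<in> {x \<in> points X'. (\<Sum>v\<in>X'. res c v * x v) = 0}"
    \<comment> \<open>The unique lift of y to H0, with the coordinate at i solved from the equation
      of H0.\<close>
    define x where "x = y(i := - (\<Sum>v\<in>X'. a v * y v) / a i)"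
    have xX: "x \<in> points X" using y i by (auto simp: x_def points_def PiE_def extensional_def)
    have rest: "(\<Sum>v\<in>X'. c v * x v) = (\<Sum>v\<in>X'. c v * y v)" for c :: "'x \<Rightarrow> 'k"
      by (rule sum.cong) (auto simp: x_def)
    have a0: "(\<Sum>v\<in>X. a v * x v) = 0"
      using rest[of a] ai by (simp add: sum.remove[OF finX i]) (simp add: x_def)
    moreover have "(\<Sum>v\<in>X. c v * x v) = 0"
      using sum_res[of c x] rest[of "res c"] y a0 by simp
    moreover have "y = restrict x X'"
      using y by (auto simp: x_def points_def PiE_def extensional_def fun_eq_iff)
    ultimately show "y \<in> \<rho> H"
      unfolding restrict_hyperplane_def H H0' using xX by blast
  qed
  then show "defines_hyperplane X' (res (\<gamma> H)) (\<rho> H)" by (simp add: defines_hyperplane_def c_def)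
  show "\<exists>v\<in>X'. res (\<gamma> H) v \<noteq> 0"
  proof (rule ccontr)
    \<comment> \<open>A form that restricts to 0 is divisible by \<alpha>, which would force H =
      H0.\<close>
    assume "\<not> ?thesis"
    then have "linear_form X' (res (\<gamma> H)) = 0" using finX by (subst linear_form_eq_0_iff) auto
    then have "\<alpha> dvd linear_form X (\<gamma> H)"
      by (simp add: linear_form_dvd_iff[where a = a, OF finX i ai] solve_subst_linear_form[where a = a, OF finX i ai])
    then show False using not_dvd_\<gamma>[OF assms] by blast
  qed
qed

private lemma \<beta>: assumes "K \<in> \<rho> ` HS" shows "defines_hyperplane X' (\<beta> K) K" "\<exists>v\<in>X'. \<beta> K v \<noteq> 0"
  using res_\<gamma>[OF inv_into_into[OF assms]] f_inv_into_f[OF assms] by (simp_all add: \<beta>_def)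

private lemma fiber_proportional:
  assumes "H \<in> HS" "H1 \<in> HS" "\<rho> H = \<rho> H1"
  obtains s where "s \<noteq> 0" "\<And>v. v \<in> X' \<Longrightarrow> res (\<gamma> H) v = s * res (\<gamma> H1) v"
proof -
  obtain j where j: "j \<in> X'" "res (\<gamma> H1) j \<noteq> 0" using res_\<gamma>(2)[OF assms(2)] by blast
  have fin: "finite X'" using finX by simp
  have defs: "defines_hyperplane X' (res (\<gamma> H)) (\<rho> H1)" using res_\<gamma>(1)[OF assms(1)] assms(3) by simp
  note prp = hyperplane_forms_proportional[OF fin j res_\<gamma>(1)[OF assms(2)] defs]
  show ?thesis
  proof (rule that)
    show "res (\<gamma> H) j / res (\<gamma> H1) j \<noteq> 0" using prp(1) j by simp
  qed (rule prp(2))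
qed

private lemma fib_pos: "K \<in> \<rho> ` HS \<Longrightarrow> 0 < fib K"
  using finHS by (auto simp: fib_def card_gt_0_iff)

text \<open>With \<open>P = \<alpha> \<theta>(b) - b \<theta>(\<alpha>)\<close>, every form \<open>c = s b + t \<alpha>\<close> with \<open>s \<noteq> 0\<close> in the fibre of \<open>b\<close> satisfies
  \<open>s P = \<alpha> \<theta>(c) - c \<theta>(\<alpha>)\<close>, hence divides \<open>P\<close>; modulo \<open>\<alpha>\<close> all these forms become multiples of \<open>b\<close>, and
  \<open>P\<close> becomes \<open>- b \<theta>(\<alpha>)\<close>.\<close>

private lemma fiber_power_dvd:
  assumes \<theta>: "\<theta> \<in> log_vectors (X, HS)" and K: "K \<in> \<rho> ` HS"
  shows "linear_form X' (\<beta> K) ^ (fib K - 1) dvd \<sigma> (form_at X a \<theta>)"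
proof -
  define H1 where "H1 = inv_into HS \<rho> K"
  have H1: "H1 \<in> HS" "\<rho> H1 = K" unfolding H1_def using inv_into_into[OF K] f_inv_into_f[OF K] by simp_all
  define b where "b = \<gamma> H1"
  have \<beta>K: "\<beta> K = res b" by (simp add: \<beta>_def H1_def b_def)
  define F where "F = {H \<in> HS. \<rho> H = K}"
  have finF: "finite F" using finHS by (simp add: F_def)
  define P where "P = \<alpha> * form_at X b \<theta> - linear_form X b * form_at X a \<theta>"
  let ?p = "linear_form X' (res b)"
  have dvd: "linear_form X (\<gamma> H) dvd P" and dvd': "?p dvd \<sigma> (linear_form X (\<gamma> H))" if "H \<in> F" for H
  proof -
    have H: "H \<in> HS" "\<rho> H = \<rho> H1" using that H1 by (auto simp: F_def)
    obtain s where s: "s \<noteq> 0" "\<And>v. v \<in> X' \<Longrightarrow> res (\<gamma> H) v = s * res b v"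
      using fiber_proportional[OF H(1) H1(1) H(2)] unfolding b_def by metis
    define c where "c = \<gamma> H"
    \<comment> \<open>Forced by comparing c = s b + t a at the coordinate i.\<close>
    define t where "t = (c i - s * b i) / a i"
    have c: "c v = s * b v + t * a v" if "v \<in> X" for v
    proof (cases "v = i")
      case True
      then show ?thesis using ai by (simp add: t_def)
    next
      case False
      then have "c v - c i * a v / a i = s * (b v - b i * a v / a i)"
        using s(2)[of v] that by (simp add: form_restrict_def c_def)
      then show ?thesis using ai by (simp add: t_def field_simps)
    qed
    have form: "form_at X c \<eta> = const_poly s * form_at X b \<eta> + const_poly t * form_at X a \<eta>"
      for \<eta> :: "'x \<Rightarrow> ('x, 'k) mvpoly"
      unfolding form_at_scale[symmetric] form_at_add[symmetric] using c by (intro form_at_cong) auto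
    have "const_poly s * P = \<alpha> * form_at X c \<theta> - linear_form X c * form_at X a \<theta>"
      by (simp add: P_def linear_form_eq_form_at form algebra_simps)
    moreover have "linear_form X c dvd form_at X c \<theta>"
      using \<theta> H(1) \<gamma>(1)[OF H(1)] by (auto simp: log_vectors_def c_def)
    ultimately have "linear_form X c dvd const_poly (inverse s) * (const_poly s * P)"
      by (metis dvd_diff dvd_mult dvd_triv_left)
    moreover have "const_poly (inverse s) * (const_poly s * P) = P"
      using s(1) by (simp flip: mult.assoc)
    ultimately show "linear_form X (\<gamma> H) dvd P" by (simp add: c_def)
    have "linear_form X' (res c) = const_poly s * ?p"
      unfolding linear_form_eq_form_at form_at_scale[symmetric]
      using s(2) by (intro form_at_cong) (auto simp: c_def)
    then show "?p dvd \<sigma> (linear_form X (\<gamma> H))"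
      by (simp add: solve_subst_linear_form[where a = a, OF finX i ai] flip: c_def)
  qed
  have "(\<Prod>H\<in>F. linear_form X (\<gamma> H) ^ 1) dvd P"
  proof (rule prod_prime_powers_dvd[OF finF])
    fix H assume "H \<in> F"
    then show "prime_elem (linear_form X (\<gamma> H))" "linear_form X (\<gamma> H) ^ 1 dvd P"
      using prime_\<gamma> dvd by (auto simp: F_def)
    fix H' assume "H' \<in> F" "H \<noteq> H'"
    then show "\<not> linear_form X (\<gamma> H) dvd linear_form X (\<gamma> H')"
      using \<open>H \<in> F\<close> by (intro not_dvd_linear_form[OF finX \<gamma>(2) \<gamma>(2) \<gamma>(1) \<gamma>(1)]) (auto simp: F_def)
  qed
  then obtain Q where Q: "P = (\<Prod>H\<in>F. linear_form X (\<gamma> H)) * Q" by auto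
  have "\<sigma> P = - (?p * \<sigma> (form_at X a \<theta>))"
    by (simp add: P_def poly_subst_diff poly_subst_mult solve_subst_self[where a = a, OF finX i ai])
      (simp add: solve_subst_linear_form[where a = a, OF finX i ai])
  \<comment> \<open>P is divisible by the product over the fibre, and each factor reduces to a
    multiple of \<open>?p\<close>. So \<open>?p\<close> to the power \<open>fib K\<close> divides
    the reduced P; one power is then cancelled against the explicit factor \<open>?p\<close>,
    leaving \<open>fib K - 1\<close>.\<close>
  moreover have "(\<Prod>H\<in>F. ?p) dvd (\<Prod>H\<in>F. \<sigma> (linear_form X (\<gamma> H)))"
    using dvd' by (rule prod_dvd_prod)
  then have "?p ^ fib K dvd \<sigma> P"
    by (simp add: Q poly_subst_mult poly_subst_prod fib_def F_def)
  ultimately have "?p * ?p ^ (fib K - 1) dvd ?p * \<sigma> (form_at X a \<theta>)"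
    using fib_pos[OF K] by (metis dvd_minus_iff power_minus_mult mult.commute)
  moreover have "?p \<noteq> 0"
    using \<beta>(2)[OF K] finX by (subst linear_form_eq_0_iff) (auto simp: \<beta>K)
  ultimately show ?thesis by (simp add: \<beta>K)
qed

private lemma B_dvd:
  assumes "\<theta> \<in> log_vectors (X, HS)"
  shows "B dvd \<sigma> (form_at X a \<theta>)"
  unfolding B_def
proof (rule prod_prime_powers_dvd)
  show "finite (\<rho> ` HS)" using finHS by simp
  have fin: "finite X'" using finX by simp
  fix K assume K: "K \<in> \<rho> ` HS"
  show "prime_elem (linear_form X' (\<beta> K))"
    using prime_elem_linear_form[OF fin] \<beta>(2)[OF K] by blast
  show "linear_form X' (\<beta> K) ^ (fib K - 1) dvd \<sigma> (form_at X a \<theta>)"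
    by (rule fiber_power_dvd[OF assms K])
  fix K' assume "K' \<in> \<rho> ` HS" "K \<noteq> K'"
  then show "\<not> linear_form X' (\<beta> K) dvd linear_form X' (\<beta> K')"
    using \<beta> K by (intro not_dvd_linear_form[OF fin]) auto
qed

private lemma B_props: "B \<noteq> 0" "B \<in> polys X'" "homogeneous (card HS - card (\<rho> ` HS)) B"
proof -
  have fin: "finite X'" using finX by simp
  have "linear_form X' (\<beta> K) \<noteq> 0" if "K \<in> \<rho> ` HS" for K
    using \<beta>(2)[OF that] by (simp add: linear_form_eq_0_iff[OF fin])
  then show "B \<noteq> 0" using finHS by (simp add: B_def)
  show "B \<in> polys X'" unfolding B_def by (intro polys_prod polys_power linear_form_in_polys)
  have "homogeneous (\<Sum>K\<in>\<rho> ` HS. fib K - 1) B"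
    unfolding B_def
  proof (rule homogeneous_prod)
    fix K
    show "homogeneous (fib K - 1) (linear_form X' (\<beta> K) ^ (fib K - 1))"
      using homogeneous_power[where n = "fib K - 1", OF homogeneous_linear_form] by simp
  qed
  moreover have "(\<Sum>K\<in>\<rho> ` HS. fib K - 1) = card HS - card (\<rho> ` HS)"
  proof -
    \<comment> \<open>Fibres are nonempty, so the truncated differences \<open>fib K - 1\<close> are
      exact and can be summed.\<close>
    have "(\<Sum>K\<in>\<rho> ` HS. fib K) = (\<Sum>K\<in>\<rho> ` HS. fib K - 1) + (\<Sum>K\<in>\<rho> ` HS. 1)"
      unfolding sum.distrib[symmetric] using fib_pos by (intro sum.cong) force+
    moreover have "(\<Sum>K\<in>\<rho> ` HS. fib K) = card HS"
      using sum.group[where g = \<rho> and h = "\<lambda>_. 1::nat", OF finHS finite_imageI[OF finHS] subset_refl]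
      by (simp add: fib_def)
    ultimately show ?thesis by simp
  qed
  ultimately show "homogeneous (card HS - card (\<rho> ` HS)) B" by simp
qed

text \<open>Reduce modulo \<alpha> the divisibility of \<theta>(\<gamma> H) by \<gamma> H. Tangency
  to H0 turns the reduced value into that of the restricted form, and one hyperplane per fibre
  suffices.\<close>

private lemma restrict_log_vector:
  assumes \<theta>: "\<theta> \<in> log_vectors (X, HS)" and a\<theta>: "\<sigma> (form_at X a \<theta>) = 0"
  shows "(\<lambda>v. \<sigma> (\<theta> v)) \<in> log_vectors (X', \<rho> ` HS)"
proof -
  have fin: "finite X'" using finX by simp
  have "linear_form X' (\<beta> K) dvd form_at X' (\<beta> K) (\<lambda>v. \<sigma> (\<theta> v))" if K: "K \<in> \<rho> ` HS" for K
  proof -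
    define H where "H = inv_into HS \<rho> K"
    have H: "H \<in> HS" unfolding H_def by (rule inv_into_into[OF K])
    have "linear_form X (\<gamma> H) dvd form_at X (\<gamma> H) \<theta>"
      using \<theta> H \<gamma>(1)[OF H] by (auto simp: log_vectors_def)
    then have "\<sigma> (linear_form X (\<gamma> H)) dvd \<sigma> (form_at X (\<gamma> H) \<theta>)"
      by (auto simp: poly_subst_mult)
    then show ?thesis
      by (simp add: solve_subst_linear_form[where a = a, OF finX i ai]
          solve_subst_form_at_restrict[where a = a, OF finX i ai a\<theta>] \<beta>_def flip: H_def)
  qed
  moreover have "\<sigma> (\<theta> v) \<in> polys X'" if "v \<in> X'" for v
    using \<theta> that by (intro solve_subst_in_polys[where a = a, OF finX i ai]) (auto simp: log_vectors_def)
  moreover have "defines_hyperplane X' (\<beta> K) K \<and> (\<exists>v\<in>X'. \<beta> K v \<noteq> 0)" if "K \<in> \<rho> ` HS" for K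
    using \<beta>[OF that] by simp
  ultimately show ?thesis
    by (subst log_vectors_iff[OF fin, where \<gamma> = \<beta>]) auto
qed

private lemma log_vectors_insert_iff:
  "\<theta> \<in> log_vectors (X, insert H0 HS) \<longleftrightarrow> \<theta> \<in> log_vectors (X, HS) \<and> \<sigma> (form_at X a \<theta>) = 0"
proof -
  define g where "g H = (if H = H0 then a else \<gamma> H)" for H
  have g: "defines_hyperplane X (g H) H \<and> (\<exists>v\<in>X. g H v \<noteq> 0)" if "H \<in> insert H0 HS" for H
    using that \<gamma> H0 i ai by (auto simp: g_def)
  have "\<theta> \<in> log_vectors (X, insert H0 HS) \<longleftrightarrow> (\<forall>v\<in>X. \<theta> v \<in> polys X) \<and>
      (\<forall>H\<in>insert H0 HS. linear_form X (g H) dvd form_at X (g H) \<theta>)"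
    by (rule log_vectors_iff[OF finX g])
  moreover have "\<theta> \<in> log_vectors (X, HS) \<longleftrightarrow> (\<forall>v\<in>X. \<theta> v \<in> polys X) \<and>
      (\<forall>H\<in>HS. linear_form X (g H) dvd form_at X (g H) \<theta>)"
    by (rule log_vectors_iff[OF finX g]) simp
  moreover have "g H0 = a" by (simp add: g_def)
  ultimately show ?thesis by (auto simp: linear_form_dvd_iff[where a = a, OF finX i ai])
qed

private lemma solve_subst_eq_0E:
  assumes "\<sigma> f = 0" "f \<in> polys X"
  obtains t where "t \<in> polys X" "f = \<alpha> * t"
proof -
  have "\<alpha> dvd f" using assms(1) by (simp add: linear_form_dvd_iff[where a = a, OF finX i ai])
  then show ?thesis using assms(2) that by (rule dvd_polysE[OF _ linear_form_in_polys])
qed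

text \<open>The basis element \<open>k0\<close>, whose value at \<open>\<alpha>\<close> is the unit multiple \<open>u B\<close> modulo \<open>\<alpha>\<close>, clears the values of
  the others and is itself multiplied by \<open>\<alpha>\<close>.\<close>

private lemma exchange_basis:
  assumes basis: "log_basis (X, HS) I d \<Theta>" and k0: "k0 \<in> I" "d k0 = b"
    and c: "\<And>k. k \<in> I \<Longrightarrow> \<sigma> (form_at X a (\<Theta> k)) = c k * B"
    and c_polys: "\<And>k. k \<in> I \<Longrightarrow> c k \<in> polys X'"
    and c_hom: "\<And>k. k \<in> I \<Longrightarrow> c k = 0 \<or> b \<le> d k \<and> homogeneous (d k - b) (c k)"
    and u: "c k0 = const_poly u" "u \<noteq> 0"
  obtains \<Theta>' where "log_basis (X, insert H0 HS) I (d(k0 := Suc b)) \<Theta>'"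
proof -
  \<comment> \<open>The multiple of element k0 to subtract from element k. It does not involve the
    variable i, so reduction modulo \<alpha> leaves it unchanged.\<close>
  define w where "w k = const_poly (inverse u) * c k" for k
  have wk: "w k \<in> polys X" "\<sigma> (w k) = w k" if "k \<in> I" for k
  proof -
    have "w k \<in> polys X'" unfolding w_def using c_polys[OF that] by (intro polys_mult) auto
    then show "w k \<in> polys X" "\<sigma> (w k) = w k"
      using polys_mono[of X' X] solve_subst_ident[where a = a, OF finX i ai] by auto
  qed
  have w: "w k * c k0 = c k" for k
    using u by (simp add: w_def mult.assoc mult.commute[of "c k"] flip: mult.assoc)
  define \<Theta>' where "\<Theta>' k v = (if k = k0 then \<alpha> * \<Theta> k0 v else \<Theta> k v - w k * \<Theta> k0 v)" for k v
  have finI: "finite I" using basis by (simp add: log_basis_def)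
  note \<Theta> = log_basis_mem[OF basis, simplified]
  let ?I = "I - {k0}"
  have \<Theta>'_log: "\<Theta>' k \<in> log_vectors (X, insert H0 HS)" if k: "k \<in> I" for k
  proof (cases "k = k0")
    case True
    have "(\<lambda>v. \<alpha> * \<Theta> k0 v) \<in> log_vectors (X, HS)"
      using \<Theta>(1)[OF k0(1)] by (rule log_vectors_mult) simp
    moreover have "\<sigma> (form_at X a (\<lambda>v. \<alpha> * \<Theta> k0 v)) = 0"
      by (simp add: form_at_mult_vec poly_subst_mult solve_subst_self[where a = a, OF finX i ai])
    ultimately show ?thesis using True by (simp add: log_vectors_insert_iff \<Theta>'_def[abs_def])
  next
    case False
    then have eq: "\<Theta>' k = (\<lambda>v. \<Theta> k v + (- w k) * \<Theta> k0 v)" by (simp add: \<Theta>'_def fun_eq_iff)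
    have "\<Theta>' k \<in> log_vectors (X, HS)" unfolding eq
      using \<Theta>(1)[OF k] \<Theta>(1)[OF k0(1)] wk(1)[OF k]
      by (intro log_vectors_add log_vectors_mult) auto
    moreover have "\<sigma> (form_at X a (\<Theta>' k)) = 0"
    proof -
      have "\<sigma> (form_at X a (\<Theta>' k)) = c k * B + - w k * (c k0 * B)" unfolding eq
        using c[OF k] c[OF k0(1)] wk(2)[OF k]
        by (simp only: form_at_add_vec form_at_mult_vec poly_subst_add poly_subst_mult poly_subst_uminus)
      also have "\<dots> = c k * B - w k * c k0 * B" by (simp add: mult.assoc)
      finally show ?thesis by (simp add: w)
    qed
    ultimately show ?thesis by (simp add: log_vectors_insert_iff)
  qed
  have \<Theta>'_hom: "homogeneous ((d(k0 := Suc b)) k) (\<Theta>' k v)" if k: "k \<in> I" and v: "v \<in> X" for k v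
  proof (cases "k = k0")
    case True
    then show ?thesis
      using homogeneous_mult[OF homogeneous_linear_form \<Theta>(2)[OF k0(1) v], of X a] k0 by (simp add: \<Theta>'_def)
  next
    case False
    have "homogeneous (d k) (w k * \<Theta> k0 v)"
      using c_hom[OF k]
    proof
      assume "c k = 0" then show ?thesis by (simp add: w_def)
    next
      assume *: "b \<le> d k \<and> homogeneous (d k - b) (c k)"
      then have "homogeneous (d k - b) (w k)" by (auto simp: w_def)
      from homogeneous_mult[OF this \<Theta>(2)[OF k0(1) v]] * k0 show ?thesis by simp
    qed
    then show ?thesis using False \<Theta>(2)[OF k v] by (auto simp: \<Theta>'_def)
  qed
  \<comment> \<open>Change of basis: a combination of the new elements in terms of the old ones.
    Only the coefficient at k0 changes.\<close>
  have sum_\<Theta>': "(\<Sum>k\<in>I. s k * \<Theta>' k v) = (\<Sum>k\<in>I. (if k = k0 then \<alpha> * s k0 - (\<Sum>k\<in>?I. s k * w k) else s k) * \<Theta> k v)"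
    for s v
  proof -
    have "(\<Sum>k\<in>I. s k * \<Theta>' k v) = s k0 * (\<alpha> * \<Theta> k0 v) + (\<Sum>k\<in>?I. s k * \<Theta>' k v)"
      using sum.remove[OF finI k0(1), of "\<lambda>k. s k * \<Theta>' k v"] by (simp add: \<Theta>'_def)
    also have "(\<Sum>k\<in>?I. s k * \<Theta>' k v) = (\<Sum>k\<in>?I. s k * \<Theta> k v - s k * w k * \<Theta> k0 v)"
      by (rule sum.cong) (auto simp: \<Theta>'_def right_diff_distrib mult.assoc)
    also have "\<dots> = (\<Sum>k\<in>?I. s k * \<Theta> k v) - (\<Sum>k\<in>?I. s k * w k) * \<Theta> k0 v"
      by (simp add: sum_subtractf sum_distrib_right)
    finally have "(\<Sum>k\<in>I. s k * \<Theta>' k v) =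
        (\<alpha> * s k0 - (\<Sum>k\<in>?I. s k * w k)) * \<Theta> k0 v + (\<Sum>k\<in>?I. s k * \<Theta> k v)"
      by (simp add: algebra_simps)
    also have "\<dots> = (\<Sum>k\<in>I. (if k = k0 then \<alpha> * s k0 - (\<Sum>k\<in>?I. s k * w k) else s k) * \<Theta> k v)"
      by (subst sum.remove[OF finI k0(1)]) (auto intro!: arg_cong2[of _ _ _ _ "(+)"] sum.cong)
    finally show ?thesis .
  qed
  have span: "\<exists>s. (\<forall>k\<in>I. s k \<in> polys X) \<and> (\<forall>v\<in>X. \<eta> v = (\<Sum>k\<in>I. s k * \<Theta>' k v))"
    if \<eta>: "\<eta> \<in> log_vectors (X, insert H0 HS)" for \<eta>
  proof -
    have \<eta>': "\<eta> \<in> log_vectors (X, HS)" "\<sigma> (form_at X a \<eta>) = 0"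
      using \<eta> by (simp_all add: log_vectors_insert_iff)
    obtain s where s: "\<And>k. k \<in> I \<Longrightarrow> s k \<in> polys X" "\<And>v. v \<in> X \<Longrightarrow> \<eta> v = (\<Sum>k\<in>I. s k * \<Theta> k v)"
      using log_basis_span[OF basis \<eta>'(1)] by auto
    have "form_at X a \<eta> = form_at X a (\<lambda>v. \<Sum>k\<in>I. s k * \<Theta> k v)"
      using s(2) by (intro form_at_cong) auto
    also have "\<dots> = (\<Sum>k\<in>I. s k * form_at X a (\<Theta> k))"
      by (simp add: form_at_sum_vec form_at_mult_vec)
    finally have "0 = (\<Sum>k\<in>I. \<sigma> (s k) * (c k * B))"
      using \<eta>'(2) c by (simp add: poly_subst_sum poly_subst_mult)
    also have "\<dots> = (\<Sum>k\<in>I. \<sigma> (s k) * w k) * (c k0 * B)"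
      unfolding sum_distrib_right by (rule sum.cong[OF refl], subst w[symmetric]) (simp only: mult.assoc)
    \<comment> \<open>B and the constant \<open>c k0\<close> are nonzero and cancel, leaving a
      scalar condition that says exactly when a combination is tangent to H0.\<close>
    finally have "(\<Sum>k\<in>I. \<sigma> (s k) * w k) = 0" using B_props(1) u by simp
    moreover have "w k0 = 1" using u by (simp add: w_def)
    ultimately have zero: "\<sigma> (s k0 + (\<Sum>k\<in>?I. s k * w k)) = 0"
      using sum.remove[OF finI k0(1), of "\<lambda>k. \<sigma> (s k) * w k"] wk(2)
      by (simp add: poly_subst_add poly_subst_sum poly_subst_mult)
    have "s k0 + (\<Sum>k\<in>?I. s k * w k) \<in> polys X"
      using s(1) wk(1) k0(1) by (intro polys_add polys_sum polys_mult) auto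
    then obtain t where t: "t \<in> polys X" "s k0 + (\<Sum>k\<in>?I. s k * w k) = \<alpha> * t"
      by (rule solve_subst_eq_0E[OF zero])
    \<comment> \<open>Inverts the change of basis: the coefficient at k0 has to be the quotient by
      \<alpha> just obtained.\<close>
    define s' where "s' k = (if k = k0 then t else s k)" for k
    have "(\<Sum>k\<in>?I. s' k * w k) = (\<Sum>k\<in>?I. s k * w k)" by (rule sum.cong) (auto simp: s'_def)
    then have "\<alpha> * s' k0 - (\<Sum>k\<in>?I. s' k * w k) = s k0" using t(2) by (simp add: s'_def algebra_simps)
    then have "(\<Sum>k\<in>I. s' k * \<Theta>' k v) = (\<Sum>k\<in>I. s k * \<Theta> k v)" for v
      unfolding sum_\<Theta>' by (intro sum.cong) (auto simp: s'_def)
    then show ?thesis using s t(1) by (intro exI[of _ s']) (auto simp: s'_def)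
  qed
  have indep: "s k = 0"
    if s: "\<And>k. k \<in> I \<Longrightarrow> s k \<in> polys X" "\<And>v. v \<in> X \<Longrightarrow> (\<Sum>k\<in>I. s k * \<Theta>' k v) = 0" and k: "k \<in> I" for s k
  proof -
    define r where "r k = (if k = k0 then \<alpha> * s k0 - (\<Sum>k\<in>?I. s k * w k) else s k)" for k
    have r: "r k = 0" if "k \<in> I" for k
    proof (rule log_basis_indep[OF basis])
      show "r k \<in> polys (fst (X, HS))" if "k \<in> I" for k
        unfolding r_def using that s(1) wk(1) k0(1)
        by (auto intro!: polys_diff polys_mult polys_sum)
      show "(\<Sum>k\<in>I. r k * \<Theta> k v) = 0" if "v \<in> fst (X, HS)" for v
        using s(2)[of v] that by (simp add: r_def sum_\<Theta>')
    qed fact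
    have other: "s k = 0" if "k \<in> ?I" for k using r[of k] that by (simp add: r_def)
    then have "\<alpha> * s k0 = 0" using r[OF k0(1)] by (simp add: r_def)
    moreover have "\<alpha> \<noteq> 0" using finX i ai by (auto simp: linear_form_eq_0_iff)
    ultimately show ?thesis using other k by (cases "k = k0") auto
  qed
  have "log_basis (X, insert H0 HS) I (d(k0 := Suc b)) \<Theta>'"
    unfolding log_basis_def using finI \<Theta>'_log \<Theta>'_hom span indep by auto
  then show ?thesis using that by blast
qed

text \<open>The restrictions of these basis elements stay independent: a relation between them lifts to a
  combination divisible by \<open>\<alpha>\<close>, whose quotient by \<open>\<alpha>\<close> is again a log derivation.\<close>

private lemma restricted_basis_card:
  assumes basis: "log_basis (X, HS) I d \<Theta>" and basis'': "log_basis (X', \<rho> ` HS) J e \<Phi>"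
    and vanish: "\<And>k. k \<in> I \<Longrightarrow> d k \<le> b \<Longrightarrow> \<sigma> (form_at X a (\<Theta> k)) = 0"
  shows "card {k \<in> I. d k \<le> b} \<le> card {j \<in> J. e j \<le> b}"
proof (rule log_basis_card_bound[OF basis'', where \<Psi> = "\<lambda>k v. \<sigma> (\<Theta> k v)" and d = d])
  let ?K = "{k \<in> I. d k \<le> b}"
  have finI: "finite I" using basis by (simp add: log_basis_def)
  then show "finite ?K" by simp
  note \<Theta> = log_basis_mem[OF basis, simplified]
  show "(\<lambda>v. \<sigma> (\<Theta> k v)) \<in> log_vectors (X', \<rho> ` HS)" if "k \<in> ?K" for k
    using that \<Theta>(1) vanish by (intro restrict_log_vector) auto
  show "homogeneous (d k) (\<sigma> (\<Theta> k v))" if "k \<in> ?K" "v \<in> fst (X', \<rho> ` HS)" for k v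
    using that \<Theta>(2) by (intro homogeneous_solve_subst[where a = a, OF finX i ai]) auto
  show "d k \<le> b" if "k \<in> ?K" for k using that by simp
  fix s k
  assume s: "\<And>k. k \<in> ?K \<Longrightarrow> s k \<in> polys (fst (X', \<rho> ` HS))"
    and sum0: "\<And>v. v \<in> fst (X', \<rho> ` HS) \<Longrightarrow> (\<Sum>k\<in>?K. s k * \<sigma> (\<Theta> k v)) = 0" and k: "k \<in> ?K"
  define \<zeta> where "\<zeta> v = (\<Sum>k\<in>?K. s k * \<Theta> k v)" for v
  have \<sigma>s: "\<sigma> (s k) = s k" "s k \<in> polys X" if "k \<in> ?K" for k
    using s[OF that] solve_subst_ident[where a = a, OF finX i ai] polys_mono[of X' X] by auto
  have \<zeta>_log: "\<zeta> \<in> log_vectors (X, HS)"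
    unfolding \<zeta>_def[abs_def] using \<Theta>(1) \<sigma>s(2) by (intro log_vectors_sum) auto
  have \<sigma>\<zeta>: "\<sigma> (\<zeta> v) = (\<Sum>k\<in>?K. s k * \<sigma> (\<Theta> k v))" for v
    unfolding \<zeta>_def poly_subst_sum poly_subst_mult using \<sigma>s(1) by (intro sum.cong) auto
  \<comment> \<open>The assumed relation covers only the coordinates other than i. The component at
    i vanishes too, because the combination is tangent to H0 and a_i is nonzero.\<close>
  have "form_at X a (\<lambda>v. \<sigma> (\<zeta> v)) = (\<Sum>k\<in>?K. s k * \<sigma> (form_at X a (\<Theta> k)))"
    by (simp add: \<sigma>\<zeta> form_at_sum_vec form_at_mult_vec poly_subst_form_at)
  also have "\<dots> = 0" using vanish by (intro sum.neutral) auto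
  finally have "const_poly (a i) * \<sigma> (\<zeta> i) + form_at X' a (\<lambda>v. \<sigma> (\<zeta> v)) = 0"
    by (simp add: form_at_remove[OF finX i])
  moreover have "form_at X' a (\<lambda>v. \<sigma> (\<zeta> v)) = 0"
    unfolding form_at_def using sum0 by (intro sum.neutral) (auto simp: \<sigma>\<zeta>)
  ultimately have \<sigma>\<zeta>_0: "\<sigma> (\<zeta> v) = 0" if "v \<in> X" for v
    using sum0[of v] ai that by (cases "v = i") (auto simp: \<sigma>\<zeta>)
  have "\<exists>t\<in>polys X. \<zeta> v = \<alpha> * t" if v: "v \<in> X" for v
  proof -
    have "\<zeta> v \<in> polys X" using \<zeta>_log v by (simp add: log_vectors_def)
    then obtain t where "t \<in> polys X" "\<zeta> v = \<alpha> * t" by (rule solve_subst_eq_0E[OF \<sigma>\<zeta>_0[OF v]])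
    then show ?thesis by blast
  qed
  then obtain \<eta> where \<eta>: "\<And>v. v \<in> X \<Longrightarrow> \<eta> v \<in> polys X" "\<And>v. v \<in> X \<Longrightarrow> \<zeta> v = \<alpha> * \<eta> v"
    by metis
  \<comment> \<open>The prime form of H divides \<alpha> times the value of \<eta> but not \<alpha>,
    so dividing by \<alpha> stays inside the module.\<close>
  have "linear_form X (\<gamma> H) dvd form_at X (\<gamma> H) \<eta>" if H: "H \<in> HS" for H
  proof -
    have "form_at X (\<gamma> H) \<zeta> = \<alpha> * form_at X (\<gamma> H) \<eta>"
      unfolding form_at_mult_vec[symmetric] using \<eta>(2) by (intro form_at_cong) auto
    moreover have "linear_form X (\<gamma> H) dvd form_at X (\<gamma> H) \<zeta>"
      using \<zeta>_log H \<gamma>(1)[OF H] by (auto simp: log_vectors_def)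
    ultimately show ?thesis
      using prime_\<gamma>[OF H] not_dvd_\<gamma>(2)[OF H] by (simp add: prime_elem_dvd_mult_iff)
  qed
  then have "\<eta> \<in> log_vectors (X, HS)"
    using \<eta>(1) \<gamma> by (subst log_vectors_iff[OF finX, where \<gamma> = \<gamma>]) auto
  then obtain t where t: "\<And>k. k \<in> I \<Longrightarrow> t k \<in> polys X" "\<And>v. v \<in> X \<Longrightarrow> \<eta> v = (\<Sum>k\<in>I. t k * \<Theta> k v)"
    using log_basis_span[OF basis] by auto
  \<comment> \<open>The two expansions of \<zeta> = \<alpha> \<eta> in the basis are
    compared.\<close>
  define r where "r k = (if d k \<le> b then s k else 0) - \<alpha> * t k" for k
  have "r k = 0"
  proof (rule log_basis_indep[OF basis])
    show "k \<in> I" using k by simp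
    show "r k \<in> polys (fst (X, HS))" if "k \<in> I" for k
      unfolding r_def using that \<sigma>s(2) t(1) by (auto intro!: polys_diff polys_mult)
    fix v assume v: "v \<in> fst (X, HS)"
    have "(\<Sum>k\<in>I. (if d k \<le> b then s k else 0) * \<Theta> k v) = \<zeta> v"
      unfolding \<zeta>_def using finI by (intro sum.mono_neutral_cong_right) auto
    moreover have "(\<Sum>k\<in>I. \<alpha> * t k * \<Theta> k v) = \<alpha> * \<eta> v"
      using t(2) v by (simp add: sum_distrib_left mult.assoc)
    ultimately show "(\<Sum>k\<in>I. r k * \<Theta> k v) = 0"
      using \<eta>(2) v by (simp add: r_def left_diff_distrib sum_subtractf)
  qed
  \<comment> \<open>Reduction modulo \<alpha> kills the right side and fixes the left side, which is
    free of the variable i.\<close>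
  then have "s k = \<alpha> * t k" using k by (simp add: r_def)
  then have "\<sigma> (s k) = 0" by (simp add: poly_subst_mult solve_subst_self[where a = a, OF finX i ai])
  then show "s k = 0" using \<sigma>s(1)[OF k] by simp
qed

theorem free_addition:
  assumes free': "free_with_exponents (X, HS) (add_mset b M)"
    and free'': "free_with_exponents (X - {i}, restrict_hyperplane X i H0 ` HS) M"
    and card: "card HS = card (restrict_hyperplane X i H0 ` HS) + b"
  shows "free_with_exponents (X, insert H0 HS) (add_mset (Suc b) M)"
proof -
  obtain I :: "nat set" and d \<Theta> where basis: "log_basis (X, HS) I d \<Theta>"
    and I: "image_mset d (mset_set I) = add_mset b M" "card I = card X"
    using free_imp_log_basis[OF _ free'] finX by (metis fst_conv)
  obtain J :: "nat set" and e \<Phi> where basis'': "log_basis (X', \<rho> ` HS) J e \<Phi>"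
    and J: "image_mset e (mset_set J) = M"
    using free_imp_log_basis[OF _ free''] finX by (metis fst_conv finite_Diff)
  have fin: "finite I" "finite J" using basis basis'' by (auto simp: log_basis_def)
  note \<Theta> = log_basis_mem[OF basis, simplified]
  have B_hom: "homogeneous b B" using B_props(3) card by simp
  have "\<exists>q\<in>polys X'. \<sigma> (form_at X a (\<Theta> k)) = B * q" if "k \<in> I" for k
  proof -
    have "\<sigma> (form_at X a (\<Theta> k)) \<in> polys X'"
      using \<Theta>(3)[OF that] by (intro solve_subst_in_polys[where a = a, OF finX i ai] form_at_in_polys) auto
    then show ?thesis using dvd_polysE[OF B_dvd[OF \<Theta>(1)[OF that]] B_props(2)] by metis
  qed
  then obtain q where q: "\<And>k. k \<in> I \<Longrightarrow> q k \<in> polys X'"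
    "\<And>k. k \<in> I \<Longrightarrow> \<sigma> (form_at X a (\<Theta> k)) = B * q k" by metis
  \<comment> \<open>Homogeneous part of the quotient by B. For d k < b there is no room for a
    multiple of B, so the value itself is 0.\<close>
  define c where "c k = (if b \<le> d k then hom_comp (d k - b) (q k) else 0)" for k
  have c: "\<sigma> (form_at X a (\<Theta> k)) = c k * B" if "k \<in> I" for k
  proof -
    have "homogeneous (d k) (\<sigma> (form_at X a (\<Theta> k)))"
      using \<Theta>(2)[OF that] by (intro homogeneous_solve_subst[where a = a, OF finX i ai] homogeneous_form_at) auto
    then have "\<sigma> (form_at X a (\<Theta> k)) = hom_comp (d k) (q k * B)"
      using q(2)[OF that] by (simp add: hom_comp_homogeneous mult.commute)
    then show ?thesis by (simp add: hom_comp_mult[OF B_hom] c_def)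
  qed
  show ?thesis
  proof (cases "\<exists>k0\<in>I. d k0 = b \<and> c k0 \<noteq> 0")
    case True
    then obtain k0 where k0: "k0 \<in> I" "d k0 = b" "c k0 \<noteq> 0" by blast
    \<comment> \<open>In degree exactly b the quotient is a constant, hence a unit; this is what
      permits the exchange.\<close>
    have "homogeneous 0 (c k0)" using k0 by (simp add: c_def)
    then obtain u where u: "c k0 = const_poly u" by (rule homogeneous_0E)
    then have "u \<noteq> 0" using k0 by auto
    have "c k \<in> polys X'" "c k = 0 \<or> b \<le> d k \<and> homogeneous (d k - b) (c k)" if "k \<in> I" for k
      using q(1)[OF that] by (auto simp: c_def)
    then obtain \<Theta>' where basis': "log_basis (X, insert H0 HS) I (d(k0 := Suc b)) \<Theta>'"
      using exchange_basis[OF basis k0(1,2) c _ _ u \<open>u \<noteq> 0\<close>] by blast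
    have "mset_set I = add_mset k0 (mset_set (I - {k0}))"
      using mset_set.remove[OF fin(1) k0(1)] .
    moreover have "image_mset (d(k0 := Suc b)) (mset_set (I - {k0})) = image_mset d (mset_set (I - {k0}))"
      using fin by (intro image_mset_cong) auto
    ultimately have "image_mset (d(k0 := Suc b)) (mset_set I) = add_mset (Suc b) M"
      using I(1) k0(2) by simp
    then show ?thesis using log_basis_imp_free[OF _ basis'] finX I(2) by simp
  next
    case False
    have "\<sigma> (form_at X a (\<Theta> k)) = 0" if "k \<in> I" "d k \<le> b" for k
      using c[OF that(1)] False that by (cases "d k = b") (auto simp: c_def)
    then have "card {k \<in> I. d k \<le> b} \<le> card {j \<in> J. e j \<le> b}"
      by (rule restricted_basis_card[OF basis basis''])
    \<comment> \<open>The exponents of HS are those of the restriction together with b itself, which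
      is one element too many up to degree b.\<close>
    moreover have "card {k \<in> I. d k \<le> b} = Suc (card {j \<in> J. e j \<le> b})"
      using size_filter_image_mset_set[OF fin(1), of "\<lambda>x. x \<le> b" d]
        size_filter_image_mset_set[OF fin(2), of "\<lambda>x. x \<le> b" e] I(1) J by simp
    ultimately show ?thesis by simp
  qed
qed

end

section \<open>Coordinate arrangements\<close>

text \<open>A basis is given by x_v d/dx_v for v in Y and d/dx_v for the other v. With Y the
  homogenizing coordinate, or all coordinates, this is the edgeless case of the two
  arrangements.\<close>

lemma free_coordinate_arrangement:
  fixes X :: "'x::linorder set"
  assumes "finite X" "Y \<subseteq> X"
  shows "free_with_exponents (X, {{x \<in> points X. x w = (0 :: 'k::field)} | w. w \<in> Y})
    (image_mset (\<lambda>v. if v \<in> Y then 1 else 0) (mset_set X))"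
proof -
  define g where "g w = (\<lambda>v. if v = w then 1 else (0 :: 'k))" for w :: 'x
  define HS where "HS = {{x \<in> points X. x w = (0 :: 'k)} | w. w \<in> Y}"
  define d where "d v = (if v \<in> Y then 1 else 0 :: nat)" for v
  define p where "p v = (if v \<in> Y then var_poly v else (1 :: ('x, 'k) mvpoly))" for v
  define \<Theta> where "\<Theta> k v = (if v = k then p k else 0)" for k v
  have sum_g: "(\<Sum>v\<in>X. g w v * x v) = x w" if "w \<in> X" for x w
  proof -
    have "(\<Sum>v\<in>X. g w v * x v) = (\<Sum>v\<in>X. if v = w then x v else 0)"
      by (rule sum.cong) (auto simp: g_def)
    then show ?thesis using that assms by simp
  qed
  have form_g: "form_at X (g w) \<eta> = \<eta> w" if "w \<in> X" for \<eta> :: "'x \<Rightarrow> ('x, 'k) mvpoly" and w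
  proof -
    have "form_at X (g w) \<eta> = (\<Sum>v\<in>X. if v = w then \<eta> v else 0)"
      unfolding form_at_def by (rule sum.cong) (auto simp: g_def)
    then show ?thesis using that assms by simp
  qed
  have defs: "defines_hyperplane X (g w) {x \<in> points X. x w = 0}" if "w \<in> Y" for w
    using that assms sum_g by (auto simp: defines_hyperplane_def)
  have log: "\<eta> \<in> log_vectors (X, HS) \<longleftrightarrow> (\<forall>v\<in>X. \<eta> v \<in> polys X \<and> p v dvd \<eta> v)"
    for \<eta> :: "'x \<Rightarrow> ('x, 'k) mvpoly"
  proof -
    have equiv: "linear_form X (g w) dvd form_at X (g w) \<eta> \<longleftrightarrow> p w dvd \<eta> w" if "w \<in> Y" for w
      using that assms form_g[of w] by (auto simp: linear_form_eq_form_at p_def)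
    have "(\<forall>b. defines_hyperplane X b {x \<in> points X. x w = 0} \<longrightarrow> linear_form X b dvd form_at X b \<eta>) \<longleftrightarrow>
        p w dvd \<eta> w" if w: "w \<in> Y" for w
    proof -
      have "linear_form X b dvd form_at X b \<eta> \<longleftrightarrow> p w dvd \<eta> w"
        if b: "defines_hyperplane X b {x \<in> points X. x w = 0}" for b
      proof -
        have wX: "w \<in> X" "g w w \<noteq> 0" using w assms by (auto simp: g_def)
        note prp = hyperplane_forms_proportional[where a = "g w", OF assms(1) wX defs[OF w] b]
        have "b w / g w w \<noteq> 0" using prp(1) wX by simp
        then have "linear_form X b dvd form_at X b \<eta> \<longleftrightarrow> linear_form X (g w) dvd form_at X (g w) \<eta>"
          by (rule linear_form_scale_dvd) (rule prp(2))
        then show ?thesis using equiv[OF w] by simp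
      qed
      then show ?thesis using defs[OF w] by blast
    qed
    then have "(\<forall>H\<in>HS. \<forall>b. defines_hyperplane X b H \<longrightarrow> linear_form X b dvd form_at X b \<eta>) \<longleftrightarrow>
        (\<forall>w\<in>Y. p w dvd \<eta> w)"
      unfolding HS_def by blast
    then show ?thesis using assms by (auto simp: log_vectors_def p_def)
  qed
  have "log_basis (X, HS) X d \<Theta>"
    unfolding log_basis_def
  proof (intro conjI ballI allI impI; (elim conjE)?)
    show "finite X" by fact
    fix k assume k: "k \<in> X"
    show "\<Theta> k \<in> log_vectors (X, HS)"
      using k assms by (auto simp: log \<Theta>_def p_def)
    show "homogeneous (d k) (\<Theta> k v)" for v
      by (auto simp: \<Theta>_def p_def d_def)
  next
    fix \<eta> assume "\<eta> \<in> log_vectors (X, HS)"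
    then have "\<exists>s. \<eta> v = p v * s \<and> s \<in> polys X" if "v \<in> X" for v
    proof -
      have "p v \<in> polys X" using that by (auto simp: p_def)
      then show ?thesis
        using \<open>\<eta> \<in> log_vectors (X, HS)\<close> that by (auto simp: log elim!: dvd_polysE)
    qed
    then obtain s where s: "\<And>v. v \<in> X \<Longrightarrow> \<eta> v = p v * s v \<and> s v \<in> polys X" by metis
    have "(\<Sum>k\<in>X. s k * \<Theta> k v) = s v * p v" if "v \<in> X" for v
      using that assms by (simp add: \<Theta>_def if_distrib cong: if_cong)
    then show "\<exists>s. (\<forall>k\<in>X. s k \<in> polys (fst (X, HS))) \<and>
        (\<forall>v\<in>fst (X, HS). \<eta> v = (\<Sum>k\<in>X. s k * \<Theta> k v))"
      using s by (intro exI[of _ s]) (auto simp: mult.commute)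
  next
    fix s k assume s: "\<forall>v\<in>fst (X, HS). (\<Sum>k\<in>X. s k * \<Theta> k v) = 0" and k: "k \<in> X"
    have "(\<Sum>l\<in>X. s l * \<Theta> l k) = s k * p k"
      using k assms by (simp add: \<Theta>_def if_distrib cong: if_cong)
    then have "s k * p k = 0" using s k by simp
    moreover have "var_poly k \<noteq> (0 :: ('x, 'k) mvpoly)"
      unfolding var_poly_def by (metis lookup_single_eq lookup_zero zero_neq_one)
    then have "p k \<noteq> 0" by (simp add: p_def)
    ultimately show "s k = 0" by simp
  qed
  then show ?thesis
    using log_basis_imp_free[of "(X, HS)" X d \<Theta>] assms(1) by (simp add: HS_def d_def[abs_def])
qed

section \<open>Gain graphs\<close>

lemma gain_edge_swap: "gain_edge v u (- h) = gain_edge u v h"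
  by (auto simp: gain_edge_def)

lemma gain_edge_eq_iff:
  "gain_edge u v h = gain_edge u' v' h' \<longleftrightarrow>
    u = u' \<and> v = v' \<and> h = h' \<or> u = v' \<and> v = u' \<and> h = - h'"
  by (auto simp: gain_edge_def doubleton_eq_iff)

lemma simple_gain_graph_edgeD:
  assumes "simple_gain_graph \<Gamma>" "gain_edge u v h \<in> gedges \<Gamma>"
  shows "u \<in> gverts \<Gamma>" "v \<in> gverts \<Gamma>" "u \<noteq> v"
  using assms by (force simp: simple_gain_graph_def gain_edge_eq_iff)+

lemma simple_gain_graph_edgeE:
  assumes "simple_gain_graph \<Gamma>" "e \<in> gedges \<Gamma>"
  obtains u v h where "e = gain_edge u v h" "u \<in> gverts \<Gamma>" "v \<in> gverts \<Gamma>" "u \<noteq> v"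
  using assms by (fastforce simp: simple_gain_graph_def)

lemma simple_delete_edge: "simple_gain_graph \<Gamma> \<Longrightarrow> simple_gain_graph (delete_edge \<Gamma> e)"
  by (auto simp: simple_gain_graph_def delete_edge_def)

lemma simple_contract_edge:
  assumes \<Gamma>: "simple_gain_graph \<Gamma>" and e: "gain_edge i j g \<in> gedges \<Gamma>"
  shows "simple_gain_graph (contract_edge \<Gamma> i j g)"
proof -
  note D = simple_gain_graph_edgeD[OF \<Gamma>]
  let ?A = "{gain_edge u v h | u v h. gain_edge u v h \<in> gedges \<Gamma> \<and> u \<noteq> i \<and> v \<noteq> i}"
  let ?B = "{gain_edge k j (h + g) | k h. gain_edge k i h \<in> gedges \<Gamma> \<and> k \<noteq> i \<and> k \<noteq> j}"
  have fin: "finite (gedges \<Gamma>)" using \<Gamma> by (simp add: simple_gain_graph_def)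
  then have "finite ?A" by (rule rev_finite_subset) auto
  moreover have "finite ?B"
  proof (rule finite_subset)
    \<comment> \<open>A transferred edge is determined by a triple (k, i, h) contained in an old
      edge, and there are finitely many such triples.\<close>
    show "?B \<subseteq> (\<lambda>(k, _, h). gain_edge k j (h + g)) ` \<Union> (gedges \<Gamma>)"
    proof
      fix x assume "x \<in> ?B"
      then obtain k h where x: "x = gain_edge k j (h + g)" "gain_edge k i h \<in> gedges \<Gamma>" by blast
      moreover have "(k, i, h) \<in> gain_edge k i h" by (simp add: gain_edge_def)
      ultimately show "x \<in> (\<lambda>(k, _, h). gain_edge k j (h + g)) ` \<Union> (gedges \<Gamma>)" by force
    qed
    have "finite e'" if "e' \<in> gedges \<Gamma>" for e'
      using simple_gain_graph_edgeE[OF \<Gamma> that] by (metis finite.emptyI finite_insert gain_edge_def)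
    then show "finite ((\<lambda>(k, _, h). gain_edge k j (h + g)) ` \<Union> (gedges \<Gamma>))" using fin by blast
  qed
  moreover have "?A \<union> ?B \<subseteq> {gain_edge u v h | u v h. u \<in> gverts \<Gamma> - {i} \<and> v \<in> gverts \<Gamma> - {i} \<and> u \<noteq> v}"
    using D D(2)[OF e] D(3)[OF e] by blast
  ultimately show ?thesis
    using \<Gamma> by (simp add: simple_gain_graph_def contract_edge_def)
qed

text \<open>The exponents, reduced to the combinatorial part that the two arrangements of a gain graph share.\<close>

inductive edge_exponents :: "('v, 'g::group_add) gain_graph \<Rightarrow> nat multiset \<Rightarrow> bool" where
  no_edges: "gedges \<Gamma> = {} \<Longrightarrow> edge_exponents \<Gamma> (replicate_mset (card (gverts \<Gamma>)) 0)"
| edge: "\<lbrakk>gain_edge i j g \<in> gedges \<Gamma>;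
          edge_exponents (delete_edge \<Gamma> (gain_edge i j g)) (add_mset b M);
          edge_exponents (contract_edge \<Gamma> i j g) M\<rbrakk> \<Longrightarrow> edge_exponents \<Gamma> (add_mset (Suc b) M)"

text \<open>Each step restores one edge and raises one exponent by 1. Comparing deletion and
  contraction, b is the difference of their numbers of edges, which is the count needed in the
  addition theorem.\<close>

lemma edge_exponents_size_sum:
  assumes "edge_exponents \<Gamma> M" "simple_gain_graph \<Gamma>"
  shows "size M = card (gverts \<Gamma>) \<and> sum_mset M = card (gedges \<Gamma>)"
  using assms
proof (induction rule: edge_exponents.induct)
  case (no_edges \<Gamma>)
  then show ?case by simp
next
  case (edge i j g \<Gamma> b M)
  have "finite (gedges \<Gamma>)" using edge.prems by (simp add: simple_gain_graph_def)
  then have "card (gedges \<Gamma>) = Suc (card (gedges \<Gamma> - {gain_edge i j g}))"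
    using edge.hyps(1) by (metis card_Suc_Diff1)
  then show ?case
    using edge.IH(1)[OF simple_delete_edge[OF edge.prems]] by (simp add: delete_edge_def)
qed

text \<open>Common features of the two arrangements of a gain graph: \<open>T V u v h\<close> is the hyperplane of an edge and
  \<open>Bs V\<close> collects the hyperplanes that are present for every gain graph on \<open>V\<close>, while \<open>y v\<close> is the coordinate
  of the vertex \<open>v\<close>.  The exponents are obtained from the combinatorial ones by adding \<open>c\<close> to
  each of them and then including those in \<open>C\<close>.\<close>

locale gain_arrangement =
  fixes X :: "'v set \<Rightarrow> 'x::linorder set" and y :: "'v \<Rightarrow> 'x"
    and T :: "'v set \<Rightarrow> 'v \<Rightarrow> 'v \<Rightarrow> 'g::group_add \<Rightarrow> ('x \<Rightarrow> 'k::field) set"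
    and Bs :: "'v set \<Rightarrow> ('x \<Rightarrow> 'k) set set" and c :: nat and C :: "nat multiset"
  assumes finite_X: "finite V \<Longrightarrow> finite (X V)"
    and y_in_X: "v \<in> V \<Longrightarrow> y v \<in> X V"
    and X_remove: "v \<in> V \<Longrightarrow> X (V - {v}) = X V - {y v}"
    and T_swap: "T V v u (- h) = T V u v h"
    and T_inj: "\<lbrakk>u \<in> V; v \<in> V; u \<noteq> v; u' \<in> V; v' \<in> V; u' \<noteq> v'; T V u v h = T V u' v' h'\<rbrakk> \<Longrightarrow>
      gain_edge u v h = gain_edge u' v' h'"
    and T_form: "\<lbrakk>finite V; u \<in> V; v \<in> V; u \<noteq> v\<rbrakk> \<Longrightarrow> \<exists>a. a (y u) \<noteq> 0 \<and> defines_hyperplane (X V) a (T V u v h)"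
    and T_notin_Bs: "\<lbrakk>u \<in> V; v \<in> V; u \<noteq> v\<rbrakk> \<Longrightarrow> T V u v h \<notin> Bs V"
    and finite_Bs: "finite V \<Longrightarrow> finite (Bs V)"
    and card_Bs_remove: "finite V \<Longrightarrow> v \<in> V \<Longrightarrow> card (Bs V) = card (Bs (V - {v})) + c"
    and Bs_hyperplane: "finite V \<Longrightarrow> H \<in> Bs V \<Longrightarrow> is_hyperplane (X V) H"
    and restrict_Bs: "\<lbrakk>i \<in> V; j \<in> V; i \<noteq> j\<rbrakk> \<Longrightarrow>
      restrict_hyperplane (X V) (y i) (T V i j g) ` Bs V = Bs (V - {i})"
    and restrict_other: "\<lbrakk>i \<in> V; j \<in> V; i \<noteq> j; u \<in> V - {i}; v \<in> V - {i}; u \<noteq> v\<rbrakk> \<Longrightarrow>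
      restrict_hyperplane (X V) (y i) (T V i j g) (T V u v h) = T (V - {i}) u v h"
    and restrict_adjacent: "\<lbrakk>i \<in> V; j \<in> V; i \<noteq> j; k \<in> V; k \<noteq> i; k \<noteq> j\<rbrakk> \<Longrightarrow>
      restrict_hyperplane (X V) (y i) (T V i j g) (T V k i h) = T (V - {i}) k j (h + g)"
    and restrict_parallel: "\<lbrakk>i \<in> V; j \<in> V; i \<noteq> j; h \<noteq> - g\<rbrakk> \<Longrightarrow>
      restrict_hyperplane (X V) (y i) (T V i j g) (T V j i h) \<in> Bs (V - {i})"
    and free_Bs: "finite V \<Longrightarrow> free_with_exponents (X V, Bs V) (replicate_mset (card V) c + C)"
begin

definition edge_hyperplanes :: "('v, 'g) gain_graph \<Rightarrow> ('x \<Rightarrow> 'k) set set" where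
  "edge_hyperplanes \<Gamma> = {T (gverts \<Gamma>) u v h | u v h. gain_edge u v h \<in> gedges \<Gamma>}"

definition arr :: "('v, 'g) gain_graph \<Rightarrow> ('x, 'k) arrangement" where
  "arr \<Gamma> = (X (gverts \<Gamma>), Bs (gverts \<Gamma>) \<union> edge_hyperplanes \<Gamma>)"

lemma T_eqI: "gain_edge u v h = gain_edge u' v' h' \<Longrightarrow> T V u v h = T V u' v' h'"
  using T_swap by (auto simp: gain_edge_eq_iff)

text \<open>Turns counts of hyperplanes into counts of edges.\<close>

lemma bij_edge_hyperplanes:
  assumes \<Gamma>: "simple_gain_graph \<Gamma>"
  obtains f where "bij_betw f (gedges \<Gamma>) (edge_hyperplanes \<Gamma>)"
proof -
  \<comment> \<open>An arbitrary triple of the edge is read; by \<open>T_swap\<close> both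
    directions give the same hyperplane.\<close>
  define f where "f e = (case (SOME t. t \<in> e) of (u, v, h) \<Rightarrow> T (gverts \<Gamma>) u v h)" for e
  have f: "f (gain_edge u v h) = T (gverts \<Gamma>) u v h" for u v h
  proof -
    have "(SOME t. t \<in> gain_edge u v h) \<in> gain_edge u v h"
      by (rule someI[of _ "(u, v, h)"]) (simp add: gain_edge_def)
    then have "(SOME t. t \<in> gain_edge u v h) = (u, v, h) \<or> (SOME t. t \<in> gain_edge u v h) = (v, u, - h)"
      by (simp add: gain_edge_def)
    then show ?thesis by (auto simp: f_def T_swap)
  qed
  have "inj_on f (gedges \<Gamma>)"
  proof
    fix e e' assume e: "e \<in> gedges \<Gamma>" "e' \<in> gedges \<Gamma>" "f e = f e'"
    obtain u v h u' v' h' where uv: "e = gain_edge u v h" "u \<in> gverts \<Gamma>" "v \<in> gverts \<Gamma>" "u \<noteq> v"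
      "e' = gain_edge u' v' h'" "u' \<in> gverts \<Gamma>" "v' \<in> gverts \<Gamma>" "u' \<noteq> v'"
      using simple_gain_graph_edgeE[OF \<Gamma> e(1)] simple_gain_graph_edgeE[OF \<Gamma> e(2)] by metis
    show "e = e'" unfolding uv(1,5)
      using e(3) by (intro T_inj[where V = "gverts \<Gamma>"] uv) (simp add: uv(1,5) f)
  qed
  moreover have "f ` gedges \<Gamma> = edge_hyperplanes \<Gamma>"
  proof (intro equalityI subsetI)
    fix H assume "H \<in> f ` gedges \<Gamma>"
    then obtain e where "e \<in> gedges \<Gamma>" "H = f e" by auto
    moreover obtain u v h where "e = gain_edge u v h" using simple_gain_graph_edgeE[OF \<Gamma> \<open>e \<in> gedges \<Gamma>\<close>] .
    ultimately show "H \<in> edge_hyperplanes \<Gamma>" unfolding edge_hyperplanes_def using f by blast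
  next
    fix H assume "H \<in> edge_hyperplanes \<Gamma>"
    then obtain u v h where "gain_edge u v h \<in> gedges \<Gamma>" "H = f (gain_edge u v h)"
      by (auto simp: edge_hyperplanes_def f)
    then show "H \<in> f ` gedges \<Gamma>" by blast
  qed
  ultimately show ?thesis using that by (simp add: bij_betw_def)
qed

lemma finite_hyperplanes:
  assumes "simple_gain_graph \<Gamma>" shows "finite (snd (arr \<Gamma>))"
proof -
  obtain f where "bij_betw f (gedges \<Gamma>) (edge_hyperplanes \<Gamma>)"
    using bij_edge_hyperplanes[OF assms] .
  then have "finite (edge_hyperplanes \<Gamma>)"
    using assms bij_betw_finite by (auto simp: simple_gain_graph_def)
  then show ?thesis using assms finite_Bs by (simp add: arr_def simple_gain_graph_def)
qed

lemma card_hyperplanes: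
  assumes "simple_gain_graph \<Gamma>"
  shows "card (snd (arr \<Gamma>)) = card (Bs (gverts \<Gamma>)) + card (gedges \<Gamma>)"
proof -
  have "Bs (gverts \<Gamma>) \<inter> edge_hyperplanes \<Gamma> = {}"
    using T_notin_Bs simple_gain_graph_edgeD[OF assms] by (auto simp: edge_hyperplanes_def)
  moreover have "finite (Bs (gverts \<Gamma>))" "finite (edge_hyperplanes \<Gamma>)"
    using finite_hyperplanes[OF assms] by (auto simp: arr_def)
  moreover obtain f where "bij_betw f (gedges \<Gamma>) (edge_hyperplanes \<Gamma>)"
    using bij_edge_hyperplanes[OF assms] by blast
  ultimately show ?thesis by (simp add: arr_def card_Un_disjoint bij_betw_same_card)
qed

lemma arr_insert_edge:
  assumes "gain_edge i j g \<in> gedges \<Gamma>"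
  shows "arr \<Gamma> = (X (gverts \<Gamma>), insert (T (gverts \<Gamma>) i j g) (snd (arr (delete_edge \<Gamma> (gain_edge i j g)))))"
proof -
  have "edge_hyperplanes \<Gamma> = insert (T (gverts \<Gamma>) i j g) (edge_hyperplanes (delete_edge \<Gamma> (gain_edge i j g)))"
    (is "_ = insert ?H (edge_hyperplanes ?\<Delta>)")
  proof (intro equalityI subsetI)
    fix H assume "H \<in> edge_hyperplanes \<Gamma>"
    then obtain u v h where H: "H = T (gverts \<Gamma>) u v h" "gain_edge u v h \<in> gedges \<Gamma>"
      unfolding edge_hyperplanes_def by blast
    show "H \<in> insert ?H (edge_hyperplanes ?\<Delta>)"
    proof (cases "gain_edge u v h = gain_edge i j g")
      case True
      then show ?thesis using T_eqI[OF True] H(1) by simp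
    next
      case False
      then have "gain_edge u v h \<in> gedges ?\<Delta>" using H(2) by (simp add: delete_edge_def)
      moreover have "gverts ?\<Delta> = gverts \<Gamma>" by (simp add: delete_edge_def)
      ultimately show ?thesis unfolding edge_hyperplanes_def H(1) by auto
    qed
  next
    fix H assume "H \<in> insert ?H (edge_hyperplanes ?\<Delta>)"
    moreover have "edge_hyperplanes ?\<Delta> \<subseteq> edge_hyperplanes \<Gamma>"
      unfolding edge_hyperplanes_def delete_edge_def by auto
    moreover have "?H \<in> edge_hyperplanes \<Gamma>" unfolding edge_hyperplanes_def using assms by blast
    ultimately show "H \<in> edge_hyperplanes \<Gamma>" by blast
  qed
  then show ?thesis by (simp add: arr_def delete_edge_def)
qed

text \<open>Edges avoiding i survive, edges from k to i become edges from k to j, and edges parallel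
  to the contracted one fall into the base hyperplanes. So the loops dropped by
  \<open>contract_edge\<close> leave no gap.\<close>

lemma restrict_arr:
  assumes \<Gamma>: "simple_gain_graph \<Gamma>" and e: "gain_edge i j g \<in> gedges \<Gamma>"
  shows "(X (gverts \<Gamma>) - {y i}, restrict_hyperplane (X (gverts \<Gamma>)) (y i) (T (gverts \<Gamma>) i j g) `
    snd (arr (delete_edge \<Gamma> (gain_edge i j g)))) = arr (contract_edge \<Gamma> i j g)"
proof -
  let ?V = "gverts \<Gamma>" and ?\<Delta> = "delete_edge \<Gamma> (gain_edge i j g)" and ?K = "contract_edge \<Gamma> i j g"
  let ?\<rho> = "restrict_hyperplane (X ?V) (y i) (T ?V i j g)"
  note D = simple_gain_graph_edgeD[OF \<Gamma>]
  note ij = D[OF e]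
  have V: "gverts ?K = ?V - {i}" "gverts ?\<Delta> = ?V" by (simp_all add: contract_edge_def delete_edge_def)
  have "?\<rho> ` (Bs ?V \<union> edge_hyperplanes ?\<Delta>) = Bs (?V - {i}) \<union> edge_hyperplanes ?K"
  proof (intro equalityI subsetI)
    fix K assume "K \<in> ?\<rho> ` (Bs ?V \<union> edge_hyperplanes ?\<Delta>)"
    then consider "K \<in> ?\<rho> ` Bs ?V" | "K \<in> ?\<rho> ` edge_hyperplanes ?\<Delta>" by blast
    then show "K \<in> Bs (?V - {i}) \<union> edge_hyperplanes ?K"
    proof cases
      case 1
      then show ?thesis using restrict_Bs[OF ij] by simp
    next
      case 2
      then obtain u v h where uv: "K = ?\<rho> (T ?V u v h)" "gain_edge u v h \<in> gedges \<Gamma>"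
        "gain_edge u v h \<noteq> gain_edge i j g"
        by (auto simp: edge_hyperplanes_def delete_edge_def)
      have adjacent: "?\<rho> (T ?V k i l) \<in> Bs (?V - {i}) \<union> edge_hyperplanes ?K"
        if k: "gain_edge k i l \<in> gedges \<Gamma>" "gain_edge k i l \<noteq> gain_edge i j g" for k l
      proof (cases "k = j")
        case True
        \<comment> \<open>The only edge [j,i,l] equal to the contracted one has l = - g, and that
          edge has been deleted.\<close>
        then have "l \<noteq> - g" using k(2) by (auto simp: gain_edge_eq_iff)
        then show ?thesis using restrict_parallel[OF ij] True by simp
      next
        case False
        then have "gain_edge k j (l + g) \<in> gedges ?K" using k D[OF k(1)] by (auto simp: contract_edge_def)
        then show ?thesis
          using restrict_adjacent[OF ij, of k] False D[OF k(1)] V by (auto simp: edge_hyperplanes_def)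
      qed
      consider "v = i" | "u = i" | "u \<noteq> i" "v \<noteq> i" by blast
      then show ?thesis
      proof cases
        case 1
        then show ?thesis using adjacent uv by simp
      next
        case 2
        then show ?thesis using adjacent[of v "- h"] uv by (simp add: gain_edge_swap T_swap)
      next
        case 3
        then have "gain_edge u v h \<in> gedges ?K" using uv(2) unfolding contract_edge_def by simp blast
        then show ?thesis
          using restrict_other[OF ij, of u v] 3 D[OF uv(2)] V uv(1) by (auto simp: edge_hyperplanes_def)
      qed
    qed
  next
    fix K assume "K \<in> Bs (?V - {i}) \<union> edge_hyperplanes ?K"
    then consider "K \<in> Bs (?V - {i})" | "K \<in> edge_hyperplanes ?K" by blast
    then show "K \<in> ?\<rho> ` (Bs ?V \<union> edge_hyperplanes ?\<Delta>)"
    proof cases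
      case 1
      then show ?thesis using restrict_Bs[OF ij, of g] by blast
    next
      case 2
      then obtain u v h where K: "K = T (?V - {i}) u v h" "gain_edge u v h \<in> gedges ?K"
        using V by (auto simp: edge_hyperplanes_def)
      from K(2) consider
        u' v' h' where "gain_edge u v h = gain_edge u' v' h'" "gain_edge u' v' h' \<in> gedges \<Gamma>" "u' \<noteq> i" "v' \<noteq> i"
        | k l where "gain_edge u v h = gain_edge k j (l + g)" "gain_edge k i l \<in> gedges \<Gamma>" "k \<noteq> i" "k \<noteq> j"
        unfolding contract_edge_def by auto
      then show ?thesis
      proof cases
        case 1
        then have "K = ?\<rho> (T ?V u' v' h')"
          using restrict_other[OF ij, of u' v'] D[OF 1(2)] T_eqI[OF 1(1)] K(1) by simp
        \<comment> \<open>An edge that avoids i differs from the contracted one and survives the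
          deletion.\<close>
        moreover have "T ?V u' v' h' \<in> edge_hyperplanes ?\<Delta>"
          using 1 by (auto simp: edge_hyperplanes_def delete_edge_def gain_edge_eq_iff)
        ultimately show ?thesis by blast
      next
        case 2
        then have "K = ?\<rho> (T ?V k i l)"
          using restrict_adjacent[OF ij, of k] D[OF 2(2)] T_eqI[OF 2(1)] K(1) by simp
        \<comment> \<open>Here k is different from j, so this edge is not the contracted
          one.\<close>
        moreover have "T ?V k i l \<in> edge_hyperplanes ?\<Delta>"
          using 2 by (auto simp: edge_hyperplanes_def delete_edge_def gain_edge_eq_iff)
        ultimately show ?thesis by blast
      qed
    qed
  qed
  then show ?thesis using X_remove[OF ij(1)] by (simp add: arr_def V)
qed

lemma arr_hyperplane:
  assumes \<Gamma>: "simple_gain_graph \<Gamma>" and H: "H \<in> snd (arr \<Gamma>)"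
  shows "is_hyperplane (X (gverts \<Gamma>)) H"
proof -
  have fin: "finite (gverts \<Gamma>)" using \<Gamma> by (simp add: simple_gain_graph_def)
  consider "H \<in> Bs (gverts \<Gamma>)" | u v h where "H = T (gverts \<Gamma>) u v h" "gain_edge u v h \<in> gedges \<Gamma>"
    using H by (auto simp: arr_def edge_hyperplanes_def)
  then show ?thesis
  proof cases
    case 1
    then show ?thesis using Bs_hyperplane[OF fin] by blast
  next
    case 2
    note D = simple_gain_graph_edgeD[OF \<Gamma> 2(2)]
    show ?thesis using T_form[OF fin D] y_in_X[OF D(1)] 2(1) unfolding is_hyperplane_def by blast
  qed
qed

definition exps :: "nat multiset \<Rightarrow> nat multiset" where
  "exps M = image_mset ((+) c) M + C"

text \<open>Subtracting c undoes the shift and C cancels, so the exponent condition can be tested on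
  the shared combinatorial multisets.\<close>

lemma exps_subset_iff: "exps M \<subseteq># exps N \<longleftrightarrow> M \<subseteq># N"
proof -
  have "image_mset ((+) c) M \<subseteq># image_mset ((+) c) N \<longleftrightarrow> M \<subseteq># N"
  proof
    assume "image_mset ((+) c) M \<subseteq># image_mset ((+) c) N"
    then have "image_mset (\<lambda>n. n - c) (image_mset ((+) c) M) \<subseteq># image_mset (\<lambda>n. n - c) (image_mset ((+) c) N)"
      by (rule image_mset_subseteq_mono)
    then show "M \<subseteq># N" by (simp add: multiset.map_comp comp_def)
  qed (rule image_mset_subseteq_mono)
  then show ?thesis by (simp add: exps_def)
qed

lemma edge_exponents_free:
  assumes "edge_exponents \<Gamma> M" "simple_gain_graph \<Gamma>"
  shows "free_with_exponents (arr \<Gamma>) (exps M)"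
  using assms
proof (induction rule: edge_exponents.induct)
  case (no_edges \<Gamma>)
  then have "arr \<Gamma> = (X (gverts \<Gamma>), Bs (gverts \<Gamma>))" by (simp add: arr_def edge_hyperplanes_def)
  then show ?case using free_Bs no_edges by (simp add: exps_def simple_gain_graph_def)
next
  case (edge i j g \<Gamma> b M)
  let ?V = "gverts \<Gamma>" and ?\<Delta> = "delete_edge \<Gamma> (gain_edge i j g)" and ?K = "contract_edge \<Gamma> i j g"
  note e = edge.hyps(1) and \<Gamma> = edge.prems
  note ij = simple_gain_graph_edgeD[OF \<Gamma> e]
  have fin: "finite ?V" using \<Gamma> by (simp add: simple_gain_graph_def)
  have simple: "simple_gain_graph ?\<Delta>" "simple_gain_graph ?K"
    using simple_delete_edge[OF \<Gamma>] simple_contract_edge[OF \<Gamma> e] by auto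
  obtain a where a: "a (y i) \<noteq> 0" "defines_hyperplane (X ?V) a (T ?V i j g)"
    using T_form[OF fin ij] by blast
  let ?HS = "snd (arr ?\<Delta>)" and ?\<rho> = "restrict_hyperplane (X ?V) (y i) (T ?V i j g)"
  have arr': "arr ?\<Delta> = (X ?V, ?HS)" by (simp add: arr_def delete_edge_def)
  \<comment> \<open>Otherwise the graph and its deletion would have equally many hyperplanes,
    although they differ by one edge.\<close>
  have new: "T ?V i j g \<notin> ?HS"
  proof
    assume "T ?V i j g \<in> ?HS"
    then have "card (snd (arr \<Gamma>)) = card (snd (arr ?\<Delta>))"
      by (simp add: arr_insert_edge[OF e] insert_absorb)
    moreover have "card (gedges \<Gamma>) = Suc (card (gedges ?\<Delta>))"
      using card.remove[OF _ e] \<Gamma> by (simp add: simple_gain_graph_def delete_edge_def)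
    moreover have "gverts ?\<Delta> = ?V" by (simp add: delete_edge_def)
    ultimately show False using card_hyperplanes[OF \<Gamma>] card_hyperplanes[OF simple(1)] by simp
  qed
  \<comment> \<open>Passing to the contraction loses c base hyperplanes with the vertex i, and b
    edges by the sum formula for the exponents.\<close>
  have card: "card ?HS = card (?\<rho> ` ?HS) + (c + b)"
  proof -
    have "card (?\<rho> ` ?HS) = card (Bs (?V - {i})) + card (gedges ?K)"
      using card_hyperplanes[OF simple(2)] arg_cong[OF restrict_arr[OF \<Gamma> e], of snd]
      by (simp add: contract_edge_def)
    moreover have "card ?HS = card (Bs (?V - {i})) + c + card (gedges ?\<Delta>)"
      using card_hyperplanes[OF simple(1)] card_Bs_remove[OF fin ij(1)] by (simp add: delete_edge_def)
    ultimately show ?thesis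
      using edge_exponents_size_sum[OF edge.hyps(2) simple(1)] edge_exponents_size_sum[OF edge.hyps(3) simple(2)]
      by simp
  qed
  have "free_with_exponents (X ?V, insert (T ?V i j g) ?HS) (add_mset (Suc (c + b)) (exps M))"
  proof (rule free_addition[where i = "y i" and a = a])
    show "finite (X ?V)" using finite_X[OF fin] .
    show "y i \<in> X ?V" using y_in_X[OF ij(1)] .
    show "finite ?HS" using finite_hyperplanes[OF simple(1)] .
    show "is_hyperplane (X ?V) H" if "H \<in> ?HS" for H
      using arr_hyperplane[OF simple(1) that] by (simp add: delete_edge_def)
    show "free_with_exponents (X ?V, ?HS) (add_mset (c + b) (exps M))"
      using edge.IH(1)[OF simple(1)] arr' by (simp add: exps_def)
    show "free_with_exponents (X ?V - {y i}, ?\<rho> ` ?HS) (exps M)"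
      using edge.IH(2)[OF simple(2)] restrict_arr[OF \<Gamma> e] by simp
  qed (use a new card in auto)
  then show ?case using arr_insert_edge[OF e] by (simp add: exps_def)
qed

text \<open>The right side mentions only the gain graph, so any two instances of the locale for the
  same graph are inductively free along edges simultaneously.\<close>

theorem ind_free_iff_edge_exponents:
  assumes "simple_gain_graph \<Gamma>"
  shows "ind_free_along_edges arr \<Gamma> \<longleftrightarrow> (\<exists>M. edge_exponents \<Gamma> M)"
proof
  assume "\<exists>M. edge_exponents \<Gamma> M"
  then obtain M where "edge_exponents \<Gamma> M" ..
  then show "ind_free_along_edges arr \<Gamma>" using assms
  proof (induction rule: edge_exponents.induct)
    case (no_edges \<Gamma>)
    then show ?case by (simp add: ind_free_along_edges.no_edges)
  next
    case (edge i j g \<Gamma> b M)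
    note simple = simple_delete_edge[OF edge.prems, of "gain_edge i j g"]
      simple_contract_edge[OF edge.prems edge.hyps(1)]
    show ?case
    proof (rule ind_free_along_edges.edge[OF edge.hyps(1)])
      show "free_with_exponents (arr (contract_edge \<Gamma> i j g)) (exps M)"
        by (rule edge_exponents_free[OF edge.hyps(3) simple(2)])
      show "free_with_exponents (arr (delete_edge \<Gamma> (gain_edge i j g))) (exps (add_mset b M))"
        by (rule edge_exponents_free[OF edge.hyps(2) simple(1)])
      show "exps M \<subseteq># exps (add_mset b M)" by (simp add: exps_subset_iff)
    qed (use edge.IH simple in auto)
  qed
next
  assume "ind_free_along_edges arr \<Gamma>"
  then show "\<exists>M. edge_exponents \<Gamma> M" using assms
  proof (induction rule: ind_free_along_edges.induct)
    case (no_edges \<Gamma>)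
    then show ?case using edge_exponents.no_edges by blast
  next
    case (edge i j g \<Gamma> M N)
    let ?\<Delta> = "delete_edge \<Gamma> (gain_edge i j g)" and ?K = "contract_edge \<Gamma> i j g"
    note e = edge.hyps(1)
    note simple = simple_delete_edge[OF edge.prems, of "gain_edge i j g"]
      simple_contract_edge[OF edge.prems edge.hyps(1)]
    obtain N' M' where N': "edge_exponents ?\<Delta> N'" and M': "edge_exponents ?K M'"
      using edge.IH simple by blast
    have fin: "finite (fst (arr \<Delta>))" if "simple_gain_graph \<Delta>" for \<Delta>
      using that finite_X by (simp add: arr_def simple_gain_graph_def)
    have "M = exps M'"
      using free_exponents_unique[OF fin[OF simple(2)] edge.hyps(4) edge_exponents_free[OF M' simple(2)]] .
    moreover have "N = exps N'"
      using free_exponents_unique[OF fin[OF simple(1)] edge.hyps(5) edge_exponents_free[OF N' simple(1)]] .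
    ultimately have sub: "M' \<subseteq># N'" using edge.hyps(6) by (simp add: exps_subset_iff)
    note ij = simple_gain_graph_edgeD[OF edge.prems e]
    \<comment> \<open>The sizes differ by one vertex, so the inclusion of exponents leaves exactly
      one extra element, the b of the combinatorial rule.\<close>
    have "size N' = card (gverts \<Gamma>)" "size M' = card (gverts \<Gamma> - {i})"
      using edge_exponents_size_sum[OF N' simple(1)] edge_exponents_size_sum[OF M' simple(2)]
      by (simp_all add: delete_edge_def contract_edge_def)
    moreover have "card (gverts \<Gamma>) = Suc (card (gverts \<Gamma> - {i}))"
      using card.remove[OF _ ij(1)] edge.prems by (simp add: simple_gain_graph_def)
    ultimately have "size (N' - M') = 1" using sub by (simp add: size_Diff_submset)
    then obtain b where "N' - M' = {#b#}" using size_1_singleton_mset by blast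
    then have "N' = add_mset b M'" using sub by (metis add_mset_add_single subset_mset.diff_add add.commute)
    then show ?case using edge_exponents.edge[OF e, of b M'] N' M' by blast
  qed
qed

end

text \<open>H0 is the graph of \<phi> over the remaining coordinates, so restricting means
  substituting \<phi> y for the coordinate i.\<close>

lemma restrict_hyperplane_graph:
  assumes "H \<subseteq> points X" "i \<in> X"
    and H0: "\<And>x. x \<in> H0 \<longleftrightarrow> x \<in> points X \<and> x i = \<phi> (restrict x (X - {i}))"
  shows "restrict_hyperplane X i H0 H = {y \<in> points (X - {i}). y(i := \<phi> y) \<in> H}"
proof (intro equalityI subsetI)
  fix y assume "y \<in> restrict_hyperplane X i H0 H"
  then obtain x where x: "x \<in> H" "x \<in> H0" "y = restrict x (X - {i})"
    by (auto simp: restrict_hyperplane_def)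
  have "\<phi> y = x i" using H0[of x] x by simp
  then have "(y(i := \<phi> y)) w = x w" for w
    using H0[of x] x(2) by (cases "w = i"; cases "w \<in> X") (simp_all add: x(3) points_def PiE_def extensional_def)
  then have "y(i := \<phi> y) = x" ..
  then show "y \<in> {y \<in> points (X - {i}). y(i := \<phi> y) \<in> H}"
    using x by (simp add: points_def)
next
  fix y assume y: "y \<in> {y \<in> points (X - {i}). y(i := \<phi> y) \<in> H}"
  then have r: "restrict (y(i := \<phi> y)) (X - {i}) = y"
    by (auto simp: points_def PiE_def extensional_def fun_eq_iff)
  moreover have "y(i := \<phi> y) \<in> H0" using y r assms(1) by (subst H0) auto
  ultimately show "y \<in> restrict_hyperplane X i H0 H"
    unfolding restrict_hyperplane_def using y by (intro image_eqI[of _ _ "y(i := \<phi> y)"]) auto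
qed

lemma defines_hyperplane_sparse:
  assumes "finite X" "F \<subseteq> X" "\<And>v. v \<in> X - F \<Longrightarrow> a v = 0"
    and "\<And>x. x \<in> H \<longleftrightarrow> x \<in> points X \<and> (\<Sum>v\<in>F. a v * x v) = (0::'k::field)"
  shows "defines_hyperplane X a H"
proof -
  have "(\<Sum>v\<in>X. a v * x v) = (\<Sum>v\<in>F. a v * x v)" for x
    using assms by (intro sum.mono_neutral_right) auto
  then show ?thesis using assms(4) by (auto simp: defines_hyperplane_def)
qed

lemma is_hyperplane_coordinate:
  assumes "finite X" "w \<in> X" shows "is_hyperplane X {x \<in> points X. x w = (0::'k::field)}"
  unfolding is_hyperplane_def
  by (rule exI[of _ "\<lambda>v. if v = w then 1 else 0"], intro conjI, rule defines_hyperplane_sparse[of _ "{w}"])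
    (use assms in auto)

section \<open>The cone of the affinographic arrangement\<close>

text \<open>Injectivity keeps parallel edges with different gains on different hyperplanes, which
  then meet only inside z = 0.\<close>

locale additive_gains =
  fixes \<iota> :: "'g::group_add \<Rightarrow> 'k::field"
  assumes add: "\<iota> (g + h) = \<iota> g + \<iota> h" and inj: "inj \<iota>"
begin

lemma zero: "\<iota> 0 = 0"
  using add[of 0 0] by (metis add_0 add_cancel_right_right)

lemma uminus: "\<iota> (- g) = - \<iota> g" using add[of g "- g"] zero by (simp add: eq_neg_iff_add_eq_0 add.commute)

definition X :: "'v set \<Rightarrow> 'v option set" where "X V = insert None (Some ` V)"

definition T :: "'v set \<Rightarrow> 'v \<Rightarrow> 'v \<Rightarrow> 'g \<Rightarrow> ('v option \<Rightarrow> 'k) set" where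
  "T V u v h = {x \<in> points (X V). x (Some u) - x (Some v) = \<iota> h * x None}"

definition Bs :: "'v set \<Rightarrow> ('v option \<Rightarrow> 'k) set set" where
  "Bs V = {{x \<in> points (X V). x None = 0}}"

lemma restrict_T:
  assumes "H \<subseteq> points (X V)" "i \<in> V" "j \<in> V" "i \<noteq> j"
  shows "restrict_hyperplane (X V) (Some i) (T V i j g) H =
    {y \<in> points (X V - {Some i}). y(Some i := y (Some j) + \<iota> g * y None) \<in> H}"
  using assms by (intro restrict_hyperplane_graph) (auto simp: T_def X_def algebra_simps)

lemma upd_points: "i \<in> V \<Longrightarrow> y \<in> points (X V - {Some i}) \<Longrightarrow> y(Some i := t) \<in> points (X V)"
  by (auto simp: points_def PiE_def extensional_def X_def)

lemma X_remove: "X (V - {i}) = X V - {Some i}"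
  by (auto simp: X_def)

lemma T_inj:
  assumes "u \<in> V" "v \<in> V" "u \<noteq> v" "u' \<in> V" "v' \<in> V" "u' \<noteq> v'" "T V u v h = T V u' v' h'"
  shows "gain_edge u v h = gain_edge u' v' h'"
proof -
  \<comment> \<open>Unit points have z = 0 and see only the endpoints of an edge; the point x with z
    = 1 below then recovers the gain.\<close>
  define e where "e w = (\<lambda>t\<in>X V. if t = Some w then 1 else 0 :: 'k)" for w
  have e: "e w \<in> T V a b l \<longleftrightarrow> w \<notin> {a, b}" if "a \<in> V" "b \<in> V" "a \<noteq> b" for w a b l
    using that by (auto simp: T_def e_def points_def X_def)
  have "w \<in> {u, v} \<longleftrightarrow> w \<in> {u', v'}" for w
    using e[of u v w h] e[of u' v' w h'] assms by blast
  then have "{u, v} = {u', v'}" by blast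
  then have cases: "u = u' \<and> v = v' \<or> u = v' \<and> v = u'" using assms by (auto simp: doubleton_eq_iff)
  define x where "x = (\<lambda>t\<in>X V. if t = Some u then \<iota> h else if t = None then 1 else 0)"
  have "x \<in> T V u v h" using assms(1-6) by (auto simp: T_def x_def points_def X_def)
  then have "x \<in> T V u' v' h'" using assms(7) by simp
  then have "x (Some u') - x (Some v') = \<iota> h' * x None" by (simp add: T_def)
  then have "u = u' \<and> v = v' \<and> \<iota> h = \<iota> h' \<or> u = v' \<and> v = u' \<and> - \<iota> h = \<iota> h'"
    using cases assms(1-6) by (auto simp: x_def X_def)
  moreover have "h = - h'" if "- \<iota> h = \<iota> h'"
    using that inj by (metis injD uminus minus_minus)
  ultimately show ?thesis using inj by (auto simp: gain_edge_eq_iff inj_def)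
qed

text \<open>The one base hyperplane z = 0 persists when a vertex is removed, whence the shift 0, and
  contributes a single exponent 1.\<close>

sublocale cone: gain_arrangement X Some "T :: 'v::linorder set \<Rightarrow> _" Bs 0 "{#1#}"
proof
  fix V :: "'v set" and u v :: 'v and h :: 'g
  show "T V v u (- h) = T V u v h" by (auto simp: T_def uminus algebra_simps)
next
  fix V :: "'v set" and u v :: 'v and h :: 'g
  assume V: "finite V" "u \<in> V" "v \<in> V" "u \<noteq> v"
  let ?a = "\<lambda>t. if t = Some u then 1 else if t = Some v then - 1 else if t = None then - \<iota> h else 0"
  have "defines_hyperplane (X V) ?a (T V u v h)"
    using V by (intro defines_hyperplane_sparse[of _ "{Some u, Some v, None}"])
      (auto simp: X_def T_def algebra_simps)
  then show "\<exists>a. a (Some u) \<noteq> 0 \<and> defines_hyperplane (X V) a (T V u v h)"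
    by (intro exI[of _ ?a]) simp
next
  fix V :: "'v set" and u v :: 'v and h :: 'g
  assume V: "u \<in> V" "v \<in> V" "u \<noteq> v"
  let ?x = "\<lambda>t\<in>X V. if t = Some u then 1 else 0 :: 'k"
  have "?x \<notin> T V u v h" "?x \<in> {x \<in> points (X V). x None = 0}"
    using V by (auto simp: T_def points_def X_def)
  then show "T V u v h \<notin> Bs V" unfolding Bs_def by blast
next
  fix V :: "'v set" and H
  assume "finite V" "H \<in> Bs V"
  then show "is_hyperplane (X V) H"
    using is_hyperplane_coordinate[of "X V" None] by (auto simp: Bs_def X_def)
next
  fix V :: "'v set" and i j :: 'v and g :: 'g
  assume V: "i \<in> V" "j \<in> V" "i \<noteq> j"
  note rT = restrict_T[OF _ V, of _ g]
  show "restrict_hyperplane (X V) (Some i) (T V i j g) ` Bs V = Bs (V - {i})"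
    using upd_points[OF V(1)] by (auto simp: Bs_def rT X_remove)
  show "restrict_hyperplane (X V) (Some i) (T V i j g) (T V u v h) = T (V - {i}) u v h"
    if "u \<in> V - {i}" "v \<in> V - {i}" "u \<noteq> v" for u v h
    using upd_points[OF V(1)] that by (subst rT) (auto simp: T_def X_remove)
  show "restrict_hyperplane (X V) (Some i) (T V i j g) (T V k i h) = T (V - {i}) k j (h + g)"
    if "k \<in> V" "k \<noteq> i" "k \<noteq> j" for k h
    using upd_points[OF V(1)] that by (subst rT) (auto simp: T_def X_remove add algebra_simps)
  show "restrict_hyperplane (X V) (Some i) (T V i j g) (T V j i h) \<in> Bs (V - {i})"
    if "h \<noteq> - g" for h
  proof -
    have "h + g \<noteq> 0" using that by (simp add: eq_neg_iff_add_eq_0)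
    then have ne: "\<iota> h + \<iota> g \<noteq> 0" using inj zero add by (metis injD)
    \<comment> \<open>On x_i = x_j + g z the equation x_j - x_i = h z becomes (h + g) z = 0.\<close>
    have "- (\<iota> g * t) = \<iota> h * t \<longleftrightarrow> t = 0" for t
    proof -
      have "- (\<iota> g * t) = \<iota> h * t \<longleftrightarrow> (\<iota> h + \<iota> g) * t = 0"
        by (simp add: distrib_right neg_eq_iff_add_eq_0 add.commute)
      then show ?thesis using ne by simp
    qed
    then have "restrict_hyperplane (X V) (Some i) (T V i j g) (T V j i h) =
        {x \<in> points (X (V - {i})). x None = 0}"
      using upd_points[OF V(1)] V by (subst rT) (auto simp: T_def X_remove)
    then show ?thesis by (simp add: Bs_def)
  qed
next
  fix V :: "'v set" assume "finite V"
  have "mset_set (X V) = add_mset None (mset_set (Some ` V))"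
    using \<open>finite V\<close> by (simp add: X_def)
  moreover have "image_mset (\<lambda>v. if v = None then 1 else 0 :: nat) (mset_set (Some ` V)) = replicate_mset (card V) 0"
    by (simp add: image_mset_mset_set[symmetric] multiset.map_comp comp_def image_mset_const_eq)
  moreover have "{{x \<in> points (X V). x w = (0::'k)} | w. w \<in> {None}} = Bs V" by (auto simp: Bs_def)
  ultimately show "free_with_exponents (X V, Bs V :: ('v option \<Rightarrow> 'k) set set) (replicate_mset (card V) 0 + {#1#})"
    using free_coordinate_arrangement[of "X V" "{None}", where 'k = 'k] \<open>finite V\<close> by (simp add: X_def)
next
  fix V :: "'v set" and u v u' v' :: 'v and h h' :: 'g
  assume "u \<in> V" "v \<in> V" "u \<noteq> v" "u' \<in> V" "v' \<in> V" "u' \<noteq> v'" "T V u v h = T V u' v' h'"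
  then show "gain_edge u v h = gain_edge u' v' h'" by (rule T_inj)
qed (auto simp: X_def Bs_def)

lemma cone_arr: "cone.arr = cone_affinographic \<iota>"
  by (auto simp: fun_eq_iff cone.arr_def cone.edge_hyperplanes_def cone_affinographic_def Let_def T_def Bs_def X_def)

end

section \<open>The bias arrangement\<close>

text \<open>Injectivity is the abstract form of q having infinite order, or order exactly p on the
  residues.\<close>

locale multiplicative_gains =
  fixes \<chi> :: "'g::group_add \<Rightarrow> complex"
  assumes mult: "\<chi> (g + h) = \<chi> g * \<chi> h" and inj: "inj \<chi>" and nonzero: "\<chi> g \<noteq> 0"
begin

lemma zero: "\<chi> 0 = 1" using mult[of 0 0] nonzero[of 0] by simp

lemma uminus: "\<chi> (- g) = inverse (\<chi> g)"
  using mult[of g "- g"] zero nonzero[of g] by (simp add: field_simps)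

definition T :: "'v set \<Rightarrow> 'v \<Rightarrow> 'v \<Rightarrow> 'g \<Rightarrow> ('v \<Rightarrow> complex) set" where
  "T V u v h = {x \<in> points V. x u - \<chi> h * x v = 0}"

definition Bs :: "'v set \<Rightarrow> ('v \<Rightarrow> complex) set set" where
  "Bs V = {{x \<in> points V. x w = 0} | w. w \<in> V}"

lemma restrict_T:
  assumes "H \<subseteq> points V" "i \<in> V" "j \<in> V" "i \<noteq> j"
  shows "restrict_hyperplane V i (T V i j g) H = {y \<in> points (V - {i}). y(i := \<chi> g * y j) \<in> H}"
  using assms by (intro restrict_hyperplane_graph) (auto simp: T_def)

lemma upd_points: "i \<in> V \<Longrightarrow> y \<in> points (V - {i}) \<Longrightarrow> y(i := t) \<in> points V"
  by (auto simp: points_def PiE_def extensional_def)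

lemma T_inj:
  assumes "u \<in> V" "v \<in> V" "u \<noteq> v" "u' \<in> V" "v' \<in> V" "u' \<noteq> v'" "T V u v h = T V u' v' h'"
  shows "gain_edge u v h = gain_edge u' v' h'"
proof -
  \<comment> \<open>As \<chi> has no zeros, a unit point lies on an edge hyperplane exactly when its
    vertex is no endpoint; x below then recovers the gain.\<close>
  define e where "e w = (\<lambda>t\<in>V. if t = w then 1 else 0 :: complex)" for w
  have e: "e w \<in> T V a b l \<longleftrightarrow> w \<notin> {a, b}" if "a \<in> V" "b \<in> V" "a \<noteq> b" for w a b l
    using that nonzero by (auto simp: T_def e_def points_def)
  have "w \<in> {u, v} \<longleftrightarrow> w \<in> {u', v'}" for w
    using e[of u v w h] e[of u' v' w h'] assms by blast
  then have "{u, v} = {u', v'}" by blast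
  then have cases: "u = u' \<and> v = v' \<or> u = v' \<and> v = u'" using assms by (auto simp: doubleton_eq_iff)
  define x where "x = (\<lambda>t\<in>V. if t = u then \<chi> h else if t = v then 1 else 0)"
  have "x \<in> T V u v h" using assms(1-6) by (auto simp: T_def x_def points_def)
  then have "x \<in> T V u' v' h'" using assms(7) by simp
  then have "x u' - \<chi> h' * x v' = 0" by (simp add: T_def)
  then have "u = u' \<and> v = v' \<and> \<chi> h = \<chi> h' \<or> u = v' \<and> v = u' \<and> \<chi> h = \<chi> (- h')"
    using cases assms(1-6) nonzero by (auto simp: x_def uminus field_simps)
  then show ?thesis using inj by (auto simp: gain_edge_eq_iff inj_def)
qed

lemma inj_coordinate_hyperplane: "inj_on (\<lambda>w. {x \<in> points V. x w = (0::complex)}) V"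
proof
  fix v w assume V: "v \<in> V" "w \<in> V" and eq: "{x \<in> points V. x v = (0::complex)} = {x \<in> points V. x w = 0}"
  let ?x = "\<lambda>t\<in>V. if t = v then 0 else 1 :: complex"
  have "?x \<in> {x \<in> points V. x v = 0}" using V by (simp add: points_def)
  then have "?x \<in> {x \<in> points V. x w = 0}" unfolding eq .
  then show "v = w" using V by (auto split: if_splits)
qed

lemma Bs_image: "Bs V = (\<lambda>w. {x \<in> points V. x w = 0}) ` V"
  by (auto simp: Bs_def)

text \<open>There is one base hyperplane per vertex, each with exponent 1, whence the shift 1 and no
  further exponents.\<close>

sublocale bias: gain_arrangement "\<lambda>V. V" "\<lambda>v. v" "T :: 'v::linorder set \<Rightarrow> _" Bs 1 "{#}"
proof
  fix V :: "'v set" and u v :: 'v and h :: 'g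
  show "T V v u (- h) = T V u v h" using nonzero by (auto simp: T_def uminus field_simps)
next
  fix V :: "'v set" and u v :: 'v and h :: 'g
  assume V: "finite V" "u \<in> V" "v \<in> V" "u \<noteq> v"
  let ?a = "\<lambda>t. if t = u then 1 else if t = v then - \<chi> h else 0"
  have "defines_hyperplane V ?a (T V u v h)"
    using V by (intro defines_hyperplane_sparse[of _ "{u, v}"]) (auto simp: T_def)
  then show "\<exists>a. a u \<noteq> 0 \<and> defines_hyperplane V a (T V u v h)"
    by (intro exI[of _ ?a]) simp
next
  fix V :: "'v set" and u v :: 'v and h :: 'g
  assume V: "u \<in> V" "v \<in> V" "u \<noteq> v"
  show "T V u v h \<notin> Bs V"
  proof
    assume "T V u v h \<in> Bs V"
    then obtain w where w: "w \<in> V" "T V u v h = {x \<in> points V. x w = 0}" by (auto simp: Bs_def)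
    \<comment> \<open>A point of the edge hyperplane without zero coordinates.\<close>
    let ?x = "\<lambda>t\<in>V. if t = u then \<chi> h else 1"
    have "?x \<in> T V u v h" using V by (simp add: T_def points_def)
    then have "?x w = 0" unfolding w(2) by blast
    then show False using w(1) nonzero[of h] by (auto split: if_splits)
  qed
next
  fix V :: "'v set" and v
  assume "finite V" "v \<in> V"
  then show "card (Bs V) = card (Bs (V - {v})) + 1"
    using card.remove[of V v] inj_coordinate_hyperplane[of V] inj_coordinate_hyperplane[of "V - {v}"]
    by (simp add: Bs_image card_image)
next
  fix V :: "'v set" and H
  assume "finite V" "H \<in> Bs V"
  then show "is_hyperplane V H"
    using is_hyperplane_coordinate[of V] by (auto simp: Bs_def)
next
  fix V :: "'v set" and i j :: 'v and g :: 'g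
  assume V: "i \<in> V" "j \<in> V" "i \<noteq> j"
  note rT = restrict_T[OF _ V, of _ g]
  \<comment> \<open>The substitution x_i = \<chi> g x_j with nonzero \<chi> g merges the coordinate
    hyperplanes of i and j and keeps the others.\<close>
  have coord: "restrict_hyperplane V i (T V i j g) {x \<in> points V. x w = 0} =
      {x \<in> points (V - {i}). x (if w = i then j else w) = 0}" if "w \<in> V" for w
    using upd_points[OF V(1)] V nonzero by (subst rT) auto
  show "restrict_hyperplane V i (T V i j g) ` Bs V = Bs (V - {i})"
  proof (intro equalityI subsetI)
    fix K assume "K \<in> restrict_hyperplane V i (T V i j g) ` Bs V"
    then obtain w where "w \<in> V" "K = {x \<in> points (V - {i}). x (if w = i then j else w) = 0}"
      using coord by (auto simp: Bs_def)
    then show "K \<in> Bs (V - {i})" using V unfolding Bs_image by (intro image_eqI[of _ _ "if w = i then j else w"]) auto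
  next
    fix K assume "K \<in> Bs (V - {i})"
    then obtain w where w: "w \<in> V" "w \<noteq> i" "K = {x \<in> points (V - {i}). x w = 0}" by (auto simp: Bs_def)
    then have "K = restrict_hyperplane V i (T V i j g) {x \<in> points V. x w = 0}" using coord[OF w(1)] by simp
    moreover have "{x \<in> points V. x w = 0} \<in> Bs V" using w(1) by (auto simp: Bs_def)
    ultimately show "K \<in> restrict_hyperplane V i (T V i j g) ` Bs V" by blast
  qed
  show "restrict_hyperplane V i (T V i j g) (T V u v h) = T (V - {i}) u v h"
    if "u \<in> V - {i}" "v \<in> V - {i}" "u \<noteq> v" for u v h
    using upd_points[OF V(1)] that by (subst rT) (auto simp: T_def)
  show "restrict_hyperplane V i (T V i j g) (T V k i h) = T (V - {i}) k j (h + g)"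
    if "k \<in> V" "k \<noteq> i" "k \<noteq> j" for k h
    using upd_points[OF V(1)] that by (subst rT) (auto simp: T_def mult)
  show "restrict_hyperplane V i (T V i j g) (T V j i h) \<in> Bs (V - {i})"
    if "h \<noteq> - g" for h
  proof -
    have "h + g \<noteq> 0" using that by (simp add: eq_neg_iff_add_eq_0)
    then have ne: "\<chi> (h + g) \<noteq> 1" using inj zero by (metis injD)
    \<comment> \<open>On x_i = \<chi> g x_j the parallel equation becomes (1 - \<chi> (h + g)) x_j =
      0, with a nonzero factor by injectivity.\<close>
    have "t - \<chi> h * (\<chi> g * t) = 0 \<longleftrightarrow> t = 0" for t
    proof -
      have "t - \<chi> h * (\<chi> g * t) = (1 - \<chi> (h + g)) * t" by (simp add: mult algebra_simps)
      then show ?thesis using ne by simp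
    qed
    then have "restrict_hyperplane V i (T V i j g) (T V j i h) = {x \<in> points (V - {i}). x j = 0}"
      using upd_points[OF V(1)] V by (subst rT) (auto simp: T_def)
    then show ?thesis using V by (auto simp: Bs_def)
  qed
next
  fix V :: "'v set" assume "finite V"
  then have "image_mset (\<lambda>v. if v \<in> V then 1 else 0 :: nat) (mset_set V) = replicate_mset (card V) 1"
    by (subst image_mset_cong[of _ _ "\<lambda>_. 1"]) (auto simp: image_mset_const_eq)
  then show "free_with_exponents (V, Bs V) (replicate_mset (card V) 1 + {#})"
    using free_coordinate_arrangement[of V V, where 'k = complex] \<open>finite V\<close> by (simp add: Bs_def)
next
  fix V :: "'v set" and u v u' v' :: 'v and h h' :: 'g
  assume "u \<in> V" "v \<in> V" "u \<noteq> v" "u' \<in> V" "v' \<in> V" "u' \<noteq> v'" "T V u v h = T V u' v' h'"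
  then show "gain_edge u v h = gain_edge u' v' h'" by (rule T_inj)
qed (auto simp: Bs_image)

lemma bias_arr: "bias.arr = bias_arrangement \<chi>"
  by (auto simp: fun_eq_iff bias.arr_def bias.edge_hyperplanes_def bias_arrangement_def T_def Bs_def)

end

lemma cone_bias_ind_free_iff:
  fixes \<Gamma> :: "('v::linorder, 'g::group_add) gain_graph"
  assumes "additive_gains \<iota>" "multiplicative_gains \<chi>" "simple_gain_graph \<Gamma>"
  shows "ind_free_along_edges (cone_affinographic \<iota>) \<Gamma> \<longleftrightarrow> ind_free_along_edges (bias_arrangement \<chi>) \<Gamma>"
proof -
  interpret additive_gains \<iota> by fact
  interpret B: multiplicative_gains \<chi> by fact
  show ?thesis
    using cone.ind_free_iff_edge_exponents[OF assms(3)] B.bias.ind_free_iff_edge_exponents[OF assms(3)]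
    by (simp add: cone_arr B.bias_arr)
qed

section \<open>The integers and the prime fields as gain groups\<close>

lemma additive_gains_of_int: "additive_gains (of_int :: int \<Rightarrow> rat)"
  by unfold_locales (auto simp: inj_def)

lemma additive_gains_id: "additive_gains (\<lambda>g :: 'k::field. g)"
  by unfold_locales (auto simp: inj_def)

text \<open>Brings relations with a possibly negative exponent into the form in which the order of q
  is constrained.\<close>

lemma powi_eq_1_imp:
  fixes q :: complex
  assumes "q powi n = 1" "n \<noteq> 0"
  shows "q ^ nat \<bar>n\<bar> = 1"
proof (cases "n \<ge> 0")
  case True
  then show ?thesis using assms by (simp add: power_int_def)
next
  case False
  then have "inverse q ^ nat (- n) = 1" using assms by (simp add: power_int_def)
  then have "inverse (q ^ nat (- n)) = 1" by (simp add: power_inverse)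
  then show ?thesis using False by simp
qed

lemma multiplicative_gains_int:
  fixes q :: complex
  assumes "q \<noteq> 0" "\<And>n::nat. n > 0 \<Longrightarrow> q ^ n \<noteq> 1"
  shows "multiplicative_gains (\<lambda>g :: int. q powi g)"
proof
  show "q powi (g + h) = q powi g * q powi h" for g h :: int
    using assms(1) by (simp add: power_int_add)
  show "q powi g \<noteq> 0" for g :: int using assms(1) by simp
  show "inj (\<lambda>g :: int. q powi g)"
  proof
    fix g h :: int assume "q powi g = q powi h"
    then have "q powi (g - h) = 1" using assms(1) by (simp add: power_int_diff)
    then show "g = h"
      using powi_eq_1_imp[of q "g - h"] assms(2)[of "nat \<bar>g - h\<bar>"] by (cases "g = h") auto
  qed
qed

lemma multiplicative_gains_mod_ring:
  fixes q :: complex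
  assumes root: "q ^ CARD('p) = 1" and prim: "\<And>n::nat. 0 < n \<Longrightarrow> n < CARD('p) \<Longrightarrow> q ^ n \<noteq> 1"
  shows "multiplicative_gains (\<lambda>g :: 'p::prime_card mod_ring. q powi to_int_mod_ring g)"
proof
  have q: "q \<noteq> 0" using root by (metis power_0_left zero_less_card_finite zero_neq_one less_irrefl)
  have range: "0 \<le> to_int_mod_ring g" "to_int_mod_ring g < int CARD('p)" for g :: "'p mod_ring"
    using range_to_int_mod_ring[where 'a = 'p] by (auto dest: equalityD1)
  have per: "q powi (int CARD('p) * m) = 1" for m
    using root by (simp add: power_int_mult)
  \<comment> \<open>Addition of residues reduces the sum of representatives modulo p, which powers
    of q do not notice.\<close>
  have modp: "q powi (m mod int CARD('p)) = q powi m" for m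
  proof -
    have "q powi m = q powi (int CARD('p) * (m div int CARD('p)) + m mod int CARD('p))" by simp
    also have "\<dots> = q powi (m mod int CARD('p))" by (subst power_int_add) (simp_all add: q per)
    finally show ?thesis ..
  qed
  show "q powi to_int_mod_ring (g + h) = q powi to_int_mod_ring g * q powi to_int_mod_ring h"
    for g h :: "'p mod_ring"
  proof -
    have "to_int_mod_ring (g + h) = (to_int_mod_ring g + to_int_mod_ring h) mod int CARD('p)"
      by (rule to_int_mod_ring_add)
    then show ?thesis using q by (simp add: modp power_int_add)
  qed
  show "q powi to_int_mod_ring g \<noteq> 0" for g :: "'p mod_ring" using q by simp
  show "inj (\<lambda>g :: 'p mod_ring. q powi to_int_mod_ring g)"
  proof
    fix g h :: "'p mod_ring"
    let ?d = "to_int_mod_ring g - to_int_mod_ring h"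
    assume "q powi to_int_mod_ring g = q powi to_int_mod_ring h"
    then have "q powi ?d = 1" using q by (simp add: power_int_diff)
    \<comment> \<open>Both representatives lie in the range from 0 to p - 1, so primitivity of q
      applies to their difference.\<close>
    moreover have "nat \<bar>?d\<bar> < CARD('p)" using range[of g] range[of h] by linarith
    ultimately have "?d = 0" using powi_eq_1_imp[of q ?d] prim[of "nat \<bar>?d\<bar>"] by (cases "?d = 0") auto
    then show "g = h" by simp
  qed
qed

theorem theorem1p15:
  fixes l :: nat
  shows
    "(\<forall>(\<Gamma> :: (nat, int) gain_graph) (q :: complex).
        simple_gain_graph \<Gamma> \<and> gverts \<Gamma> = {1..l} \<and>
        q \<noteq> 0 \<and> (\<forall>n::nat. n > 0 \<longrightarrow> q ^ n \<noteq> 1) \<longrightarrow>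
        (ind_free_along_edges (cone_affinographic (of_int :: int \<Rightarrow> rat)) \<Gamma> \<longleftrightarrow>
         ind_free_along_edges (bias_arrangement (\<lambda>g. q powi g)) \<Gamma>)) \<and>
     (\<forall>(\<Gamma> :: (nat, 'p::prime_card mod_ring) gain_graph) (q :: complex).
        simple_gain_graph \<Gamma> \<and> gverts \<Gamma> = {1..l} \<and>
        q ^ CARD('p) = 1 \<and> (\<forall>n::nat. 0 < n \<and> n < CARD('p) \<longrightarrow> q ^ n \<noteq> 1) \<longrightarrow>
        (ind_free_along_edges (cone_affinographic (\<lambda>g :: 'p mod_ring. g)) \<Gamma> \<longleftrightarrow>
         ind_free_along_edges (bias_arrangement (\<lambda>g. q powi to_int_mod_ring g)) \<Gamma>))"
  using cone_bias_ind_free_iff[OF additive_gains_of_int multiplicative_gains_int]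
    cone_bias_ind_free_iff[OF additive_gains_id multiplicative_gains_mod_ring]
  by blast

end
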